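(* If $\lambda_{1}>\lambda_{2}\geq\ldots\geq\lambda_{n-\mathcal{E}_{X}}>0$ are the positive eigenvalues of $A$, then $B$ is unitarily equivalent to a block-diagonal matrix composed of: \begin{enumerate} \item The block $\left(\begin{smallmatrix} 0 & K\\ k & 0 \end{smallmatrix}\right)$. \item \begin{enumerate} \item For each $2\leq j\leq n-\mathcal{E}_{X}$ with $\lambda_{j}\in\left[\sqrt{K}-\sqrt{k},\sqrt{K}+\sqrt{k}\right]$, the block \[ \left(\begin{smallmatrix}0 & 0 & \mu_{j}^{+}\sqrt[4]{\frac{k}{K}} & k-1\\ 0 & 0 & 0 & -\mu_{j}^{-}\sqrt[4]{\frac{k}{K}}\\ \mu_{j}^{+}\sqrt[4]{\frac{K}{k}} & K-1 & 0 & 0\\ 0 & -\mu_{j}^{-}\sqrt[4]{\frac{K}{k}} & 0 & 0 \end{smallmatrix}\right). \] \item For each $2\leq j\leq n-\mathcal{E}_{X}$ with $\lambda_{j}\notin\left[\sqrt{K}-\sqrt{k},\sqrt{K}+\sqrt{k}\right]$, a block of the form $\left(\begin{smallmatrix}0 & 0 & \mu_{j}^{+}\alpha_{j} & \gamma_{j}\\ 0 & 0 & 0 & \mu_{j}^{-}\beta_{j}\\ \mu_{j}^{+}/\alpha_{j} & \delta_{j} & 0 & 0\\ 0 & \mu_{j}^{-}/\beta_{j} & 0 & 0 \end{smallmatrix}\right)$, where $\alpha_{j},\beta_{j}\in\mathbb{R}_{>0}$ and $\gamma_{j},\delta_{j}\in\mathbb{C}$ are all bounded by $K$. \end{enumerate}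 \item $\mathcal{E}_{X}$ times the block $\left(\begin{smallmatrix} 0 & i\\ iK & 0 \end{smallmatrix}\right)$ (here $iK$ denotes $i\cdot K$, with $i=\sqrt{-1}$). \item $\mathcal{N}_{X}$ times the block $\left(\begin{smallmatrix} 0 & ik\\ i & 0 \end{smallmatrix}\right)$. \item $\chi\left(X\right)=\frac{|E|}{2}-|V|+1=\frac{Kk-1}{k+1}\cdot n+1$ times the diagonal block $\left(\begin{smallmatrix}1 & 0\\ 0 & -1 \end{smallmatrix}\right)$. \end{enumerate}
   Context: Let $X=(V=L\sqcup R,E)$ be a connected undirected $(K\!+\!1,k\!+\!1)$-biregular bipartite graph (vertices in $L$ have degree $K+1$, vertices in $R$ have degree $k+1$) with $K>k$ and $|L|=n$; $E$ denotes the set of directed edges (each edge with both orientations), so $|E|=2n(K+1)$. $A=A_X$ is the adjacency operator on $L^2(V)$, and $B=B_X$ is the non-backtracking operator on $L^2(E)$, $(Bf)(v\to u)=\sum_{v\neq w\sim u}f(u\to w)$. The excessiveness is $\mathcal{E}_X=\dim\ker(A|_{L})$ (kernel of $A$ restricted to functions supported on $L$), and $\mathcal{N}_X=\dim\ker(A|_{R})=\frac{K-k}{k+1}n+\mathcal{E}_X$. $A$ has exactly $n-\mathcal{E}_X$ positive eigenvalues counted with multiplicity, the largest being $\lambda_1=\sqrt{(K+1)(k+1)}$. For $\lambda\in[0,\sqrt{(K+1)(k+1)}]$ set $\vartheta_\lambda=\arccos\left(\frac{\lambda^2-K-k}{2\sqrt{Kk}}\right)$ and $\mu_\lambda^{\pm}=\sqrt{e^{\pm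 i\vartheta_\lambda}\sqrt{Kk}}$ (equivalently $\mu^{\pm}=\sqrt{\tfrac12(\lambda^2-K-k\pm\sqrt{(\lambda^2-K-k)^2-4Kk})}$), where the outer square root is chosen so that $\mu^{\pm}$ lie in the upper half plane or in the positive reals; $\mu_j^{\pm}:=\mu_{\lambda_j}^{\pm}$.
   Formalization: At the right endpoint λ_j = √K+√k the printed block 2(a) is false for k ≥ 2; there −μ_j^- is replaced by its limit from the left, +(Kk)^{1/4}. For k = 1 the two blocks are unitarily equivalent; nothing else is changed. *)

theory Defs
  imports
    "HOL-Library.Function_Algebras"
    "Graph_Theory.Graph_Theory"
    "Jordan_Normal_Form.Matrix"
    "Jordan_Normal_Form.Conjugate"
begin

text \<open>
  Undirected graphs are finite, loop-free, symmetric digraphs whose arcs are pairs of vertices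
  (\<^locale>\<open>pair_graph\<close>). Hence \<^term>\<open>parcs G\<close> is the set of directed edges, in which every
  undirected edge occurs with both orientations.
\<close>

definition biregular_bipartite ::
    "'a pair_pre_digraph \<Rightarrow> 'a set \<Rightarrow> 'a set \<Rightarrow> nat \<Rightarrow> nat \<Rightarrow> bool" where
  "biregular_bipartite G L R K k \<longleftrightarrow>
     pair_graph G \<and>
     pverts G = L \<union> R \<and> L \<inter> R = {} \<and>
     parcs G \<subseteq> L \<times> R \<union> R \<times> L \<and>
     (\<forall>v\<in>L. out_degree (with_proj G) v = K + 1) \<and>
     (\<forall>v\<in>R. out_degree (with_proj G) v = k + 1)"

text \<open>
  The space of complex functions on a finite set \<open>S\<close> is realised as the space of functions
  on the whole type that vanish outside \<open>S\<close>.
\<close>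

definition L2_space :: "'b set \<Rightarrow> ('b \<Rightarrow> complex) set" where
  "L2_space S = {f. \<forall>x. x \<notin> S \<longrightarrow> f x = 0}"

definition L2_inner :: "'b set \<Rightarrow> ('b \<Rightarrow> complex) \<Rightarrow> ('b \<Rightarrow> complex) \<Rightarrow> complex" where
  "L2_inner S f g = (\<Sum>x\<in>S. f x * cnj (g x))"

definition fun_scale :: "complex \<Rightarrow> ('b \<Rightarrow> complex) \<Rightarrow> 'b \<Rightarrow> complex" where
  "fun_scale c f = (\<lambda>x. c * f x)"

lemma vector_space_fun_scale: "vector_space (fun_scale :: complex \<Rightarrow> ('b \<Rightarrow> complex) \<Rightarrow> _)"
  by unfold_locales (auto simp: fun_scale_def fun_eq_iff algebra_simps)

definition complex_dim :: "('b \<Rightarrow> complex) set \<Rightarrow> nat" where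
  "complex_dim W = vector_space.dim fun_scale W"

definition adjacency_op :: "'a pair_pre_digraph \<Rightarrow> ('a \<Rightarrow> complex) \<Rightarrow> 'a \<Rightarrow> complex" where
  "adjacency_op G f = (\<lambda>v. \<Sum>w | (v, w) \<in> parcs G. f w)"

definition non_backtracking_op ::
    "'a pair_pre_digraph \<Rightarrow> ('a \<times> 'a \<Rightarrow> complex) \<Rightarrow> 'a \<times> 'a \<Rightarrow> complex" where
  "non_backtracking_op G f = (\<lambda>(v, u).
     if (v, u) \<in> parcs G then \<Sum>w | (u, w) \<in> parcs G \<and> w \<noteq> v. f (u, w) else 0)"

text \<open>
  For \<open>S = L\<close> this is the excessiveness of the graph, for \<open>S = R\<close> it is the number
  \<open>\<N>\<close> of the other side.
\<close>

definition adjacency_nullity :: "'a pair_pre_digraph \<Rightarrow> 'a set \<Rightarrow> nat" where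
  "adjacency_nullity G S = complex_dim {f \<in> L2_space S. adjacency_op G f = 0}"

definition eigenspace :: "'a pair_pre_digraph \<Rightarrow> real \<Rightarrow> ('a \<Rightarrow> complex) set" where
  "eigenspace G x =
     {f \<in> L2_space (pverts G). adjacency_op G f = fun_scale (complex_of_real x) f}"

text \<open>
  The numbers \<open>lam 1 > lam 2 \<ge> \<dots> \<ge> lam m > 0\<close> are the positive eigenvalues of the
  adjacency operator, each listed as often as its multiplicity.
\<close>

definition positive_eigenvalues :: "'a pair_pre_digraph \<Rightarrow> nat \<Rightarrow> (nat \<Rightarrow> real) \<Rightarrow> bool" where
  "positive_eigenvalues G m lam \<longleftrightarrow>
     (\<forall>j\<in>{2..m}. lam j < lam 1) \<and>
     (\<forall>i j. 1 \<le> i \<longrightarrow> i \<le> j \<longrightarrow> j \<le> m \<longrightarrow> lam j \<le> lam i) \<and>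
     (\<forall>j\<in>{1..m}. 0 < lam j) \<and>
     (\<forall>x>0. card {j\<in>{1..m}. lam j = x} = complex_dim (eigenspace G x))"

text \<open>The number of arcs is even, so the integer division by 2 is exact.\<close>

definition cycle_rank :: "'a pair_pre_digraph \<Rightarrow> int" where
  "cycle_rank G = int (card (parcs G)) div 2 - int (card (pverts G)) + 1"

text \<open>
  The square root that lies in the open upper half plane or is a nonnegative real. It differs
  from the principal root \<^const>\<open>csqrt\<close>, which has nonnegative real part, in sign on
  the open lower half plane.
\<close>

definition upper_sqrt :: "complex \<Rightarrow> complex" where
  "upper_sqrt z = (if Im (csqrt z) < 0 then - csqrt z else csqrt z)"

definition mu_plus :: "nat \<Rightarrow> nat \<Rightarrow> real \<Rightarrow> complex" where
  "mu_plus K k l = (let x = complex_of_real (l\<^sup>2 - real K - real k) in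
     upper_sqrt ((x + csqrt (x\<^sup>2 - 4 * of_nat K * of_nat k)) / 2))"

definition mu_minus :: "nat \<Rightarrow> nat \<Rightarrow> real \<Rightarrow> complex" where
  "mu_minus K k l = (let x = complex_of_real (l\<^sup>2 - real K - real k) in
     upper_sqrt ((x - csqrt (x\<^sup>2 - 4 * of_nat K * of_nat k)) / 2))"

definition block_trivial :: "nat \<Rightarrow> nat \<Rightarrow> complex mat" where
  "block_trivial K k = mat_of_rows_list 2
     [[0, of_nat K],
      [of_nat k, 0]]"

definition tempered_interval :: "nat \<Rightarrow> nat \<Rightarrow> real set" where
  "tempered_interval K k =
     {sqrt (real K) - sqrt (real k) .. sqrt (real K) + sqrt (real k)}"

text \<open>
  On the half-open interval \<open>[sqrt K - sqrt k, sqrt K + sqrt k)\<close> the block below contains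
  \<open>- mu_minus = cnj mu_plus\<close>. At the right endpoint the root of \<open>sqrt (K k)\<close> defining
  \<^const>\<open>mu_minus\<close> is the positive one, so \<open>mu_minus\<close> jumps there:
  \<open>mu_minus = mu_plus > 0\<close>, whereas its limit from the left is \<open>- mu_plus\<close>. The entries
  of the block at the endpoint are taken to be their limits from the left. With the positive root
  the block would not have the right norms if \<open>k \<ge> 2\<close>: three copies of each line of the
  affine cube \<open>F_3^3\<close> parallel to an axis, against the 27 points, have \<open>K = 8\<close>,
  \<open>k = 2\<close> and an eigenvalue \<open>sqrt 18 = sqrt 8 + sqrt 2\<close>, and the resulting block
  matrix \<open>M\<close> would give \<open>trace (M^2 (M^2)^*) = 6432\<close> in place of \<open>7776\<close>.
\<close>

definition mu_minus_left :: "nat \<Rightarrow> nat \<Rightarrow> real \<Rightarrow> complex" where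
  "mu_minus_left K k l =
     (if l = sqrt (real K) + sqrt (real k) then - mu_minus K k l else mu_minus K k l)"

definition block_tempered :: "nat \<Rightarrow> nat \<Rightarrow> real \<Rightarrow> complex mat" where
  "block_tempered K k l =
     (let p = mu_plus K k l; q = mu_minus_left K k l;
          s = complex_of_real (root 4 (real k / real K));
          t = complex_of_real (root 4 (real K / real k))
      in mat_of_rows_list 4
        [[0,     0,              p * s, of_nat k - 1],
         [0,     0,              0,     - q * s],
         [p * t, of_nat K - 1,   0,     0],
         [0,     - q * t,        0,     0]])"

definition block_nontempered ::
    "nat \<Rightarrow> nat \<Rightarrow> real \<Rightarrow> real \<Rightarrow> real \<Rightarrow> complex \<Rightarrow> complex \<Rightarrow> complex mat" where
  "block_nontempered K k l \<alpha> \<beta> \<gamma> \<delta> =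
     (let p = mu_plus K k l; q = mu_minus K k l;
          a = complex_of_real \<alpha>; b = complex_of_real \<beta>
      in mat_of_rows_list 4
        [[0,     0,     p * a, \<gamma>],
         [0,     0,     0,     q * b],
         [p / a, \<delta>, 0,     0],
         [0,     q / b, 0,     0]])"

definition block_excess_L :: "nat \<Rightarrow> complex mat" where
  "block_excess_L K = mat_of_rows_list 2
     [[0, \<i>],
      [\<i> * of_nat K, 0]]"

definition block_excess_R :: "nat \<Rightarrow> complex mat" where
  "block_excess_R k = mat_of_rows_list 2
     [[0, \<i> * of_nat k],
      [\<i>, 0]]"

definition block_sign :: "complex mat" where
  "block_sign = mat_of_rows_list 2
     [[1, 0],
      [0, -1]]"

text \<open>
  An operator \<open>T\<close> on the functions on \<open>S\<close> and a square matrix \<open>M\<close> are unitarily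
  equivalent if a unitary isomorphism from the standard Hermitian space onto \<^term>\<open>L2_space S\<close>
  intertwines them.
\<close>

definition unitarily_equivalent ::
    "'b set \<Rightarrow> (('b \<Rightarrow> complex) \<Rightarrow> 'b \<Rightarrow> complex) \<Rightarrow> complex mat \<Rightarrow> bool" where
  "unitarily_equivalent S T M \<longleftrightarrow>
     (\<exists>N U. M \<in> carrier_mat N N \<and>
        bij_betw U (carrier_vec N) (L2_space S) \<and>
        (\<forall>v\<in>carrier_vec N. \<forall>w\<in>carrier_vec N. U (v + w) = U v + U w) \<and>
        (\<forall>c. \<forall>v\<in>carrier_vec N. U (c \<cdot>\<^sub>v v) = fun_scale c (U v)) \<and>
        (\<forall>v\<in>carrier_vec N. \<forall>w\<in>carrier_vec N. L2_inner S (U v) (U w) = v \<bullet>c w) \<and>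
        (\<forall>v\<in>carrier_vec N. T (U v) = U (M *\<^sub>v v)))"

end

theory Submission
  imports Defs
begin

text \<open>
  Write \<open>src F\<close> and \<open>tgt F\<close> for the functions \<open>F v\<close> and \<open>F u\<close> of an arc \<open>v \<rightarrow> u\<close>. Since
  \<open>B (tgt F) = tgt (A F) - src F\<close> and \<open>B (src F) = (deg - 1) tgt F\<close>, every pair \<open>f\<close>, \<open>g\<close> of functions
  on \<open>L\<close> and \<open>R\<close> with \<open>A f = l g\<close> and \<open>A g = l f\<close> spans a \<open>B\<close>-invariant space of arc functions,
  and orthogonal pairs span orthogonal spaces. In general the space has dimension 4, and on it \<open>B\<close> exchanges
  the two classes of arcs, acting by \<open>diag(K, -1)\<close> in one direction and by a reflected copy of
  \<open>diag(k, -1)\<close> in the other; a simultaneous unitary triangularisation of these two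
  2-by-2 matrices gives the blocks. The space degenerates to dimension 2 at the top eigenvalue and
  for the kernel of \<open>A\<close>. On the orthogonal complement of all these spaces all sums of a function
  over the arcs into or out of a vertex vanish, so there \<open>-B\<close> is the reversal of arcs.

  No spectral theorem is needed: the hypothesis \<open>m = n - dim ker\<close> says that the eigenfunctions
  for positive eigenvalues together with the kernel already exhaust the functions on \<open>L\<close>.
\<close>

section \<open>Orthonormal lists of functions\<close>

text \<open>Both triangular 2-by-2 matrices come from one eigenvector. With
  \<open>l^2 = c^2 (K + 1) (k + 1)\<close> the product \<open>X Y\<close> has trace
  \<open>l^2 - K - k\<close> and determinant \<open>K k\<close>, so its eigenvalues are the squares
  of the two mu. If \<open>a1\<close> is a unit eigenvector and \<open>b1\<close> is the normalised
  \<open>Y a1\<close>, then \<open>X b1\<close> is a multiple of \<open>a1\<close>; completing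
  \<open>a1\<close> and \<open>b1\<close> to orthonormal bases makes \<open>X\<close> and
  \<open>Y\<close> upper triangular, and the freedom left lies in phases. The tempered interval is
  where the discriminant is nonpositive. There the eigenvalues are conjugate of modulus
  \<open>sqrt (K k)\<close>, \<open>Y a1\<close> is orthogonal to \<open>a1\<close>, and the
  off-diagonal entries are the traces \<open>K - 1\<close> of \<open>Y\<close> and
  \<open>k - 1\<close> of \<open>X\<close>. Outside it the eigenvalues are real, and the bounds come
  from the operator norms of \<open>X\<close> and \<open>Y\<close>. The sign blocks are counted on
  one orientation of every edge: the other spaces occupy \<open>|L| + |R| - 1\<close> dimensions
  there, and the number of edges minus this is the cycle rank.\<close>

interpretation cspace: vector_space "fun_scale :: complex \<Rightarrow> ('b \<Rightarrow> complex) \<Rightarrow> _"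
  by (rule vector_space_fun_scale)

lemma fun_scale_apply [simp]: "fun_scale c f x = c * f x"
  by (simp add: fun_scale_def)

lemma sum_apply: "(\<Sum>i\<in>A. f i) x = (\<Sum>i\<in>A. f i x)"
  by (induction A rule: infinite_finite_induct) auto

lemma subspace_L2_space: "cspace.subspace (L2_space S)"
  by (auto simp: cspace.subspace_def L2_space_def)

lemma L2_inner_add_left: "L2_inner S (f + g) h = L2_inner S f h + L2_inner S g h"
  and L2_inner_add_right: "L2_inner S h (f + g) = L2_inner S h f + L2_inner S h g"
  and L2_inner_diff_left: "L2_inner S (f - g) h = L2_inner S f h - L2_inner S g h"
  and L2_inner_diff_right: "L2_inner S h (f - g) = L2_inner S h f - L2_inner S h g"
  by (simp_all add: L2_inner_def algebra_simps sum.distrib sum_subtractf)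

lemma L2_inner_scale_left: "L2_inner S (fun_scale c f) h = c * L2_inner S f h"
  and L2_inner_scale_right: "L2_inner S h (fun_scale c f) = cnj c * L2_inner S h f"
  by (simp_all add: L2_inner_def algebra_simps sum_distrib_left)

lemma L2_inner_zero [simp]: "L2_inner S 0 h = 0" "L2_inner S h 0 = 0"
  by (simp_all add: L2_inner_def)

lemma L2_inner_sum_left: "L2_inner S (\<Sum>i\<in>A. f i) h = (\<Sum>i\<in>A. L2_inner S (f i) h)"
  unfolding L2_inner_def sum_apply sum_distrib_right by (rule sum.swap)

lemma L2_inner_sum_right: "L2_inner S h (\<Sum>i\<in>A. f i) = (\<Sum>i\<in>A. L2_inner S h (f i))"
  unfolding L2_inner_def sum_apply cnj_sum sum_distrib_left by (rule sum.swap)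

lemma cnj_L2_inner: "cnj (L2_inner S f g) = L2_inner S g f"
  by (simp add: L2_inner_def mult.commute)

lemma L2_inner_zero_sym: "L2_inner S f g = 0 \<longleftrightarrow> L2_inner S g f = 0"
  using cnj_L2_inner[of S f g] cnj_L2_inner[of S g f] by auto

lemma L2_inner_self: "L2_inner S f f = complex_of_real (\<Sum>x\<in>S. (cmod (f x))\<^sup>2)"
  by (simp add: L2_inner_def complex_norm_square flip: of_real_power)

lemma L2_inner_self_pos:
  assumes "finite S" "f \<in> L2_space S" "f \<noteq> 0"
  obtains r where "r > 0" "L2_inner S f f = complex_of_real r"
proof -
  from assms(2,3) obtain x where x: "x \<in> S" "f x \<noteq> 0"
    by (auto simp: L2_space_def fun_eq_iff)
  have "0 < (\<Sum>x\<in>S. (cmod (f x))\<^sup>2)"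
    using assms(1) x by (intro sum_pos2[of _ x]) auto
  then show thesis using that L2_inner_self by blast
qed

lemma L2_inner_self_eq_0:
  assumes "finite S" "f \<in> L2_space S" "L2_inner S f f = 0"
  shows "f = 0"
  using L2_inner_self_pos[OF assms(1,2)] assms(3) by (metis less_irrefl of_real_eq_0_iff)

text \<open>Lists rather than sets, so that bases concatenate in the order in which
  \<open>diag_block_mat\<close> places the blocks. Orthogonality is asked between positions; with
  the norm condition this excludes repetitions.\<close>

definition orthonormal :: "'b set \<Rightarrow> ('b \<Rightarrow> complex) list \<Rightarrow> bool" where
  "orthonormal S ws \<longleftrightarrow>
     sorted_wrt (\<lambda>v w. L2_inner S v w = 0) ws \<and> (\<forall>w\<in>set ws. L2_inner S w w = 1)"

text \<open>A trivial orthogonal complement inside \<open>W\<close> is the form of completeness that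
  later forces vertex sums to vanish; for orthonormal lists in a subspace
  \<open>complete_span\<close> turns it into spanning.\<close>

definition complete_in :: "'b set \<Rightarrow> ('b \<Rightarrow> complex) set \<Rightarrow> ('b \<Rightarrow> complex) list \<Rightarrow> bool" where
  "complete_in S W ws \<longleftrightarrow> (\<forall>v\<in>W. (\<forall>w\<in>set ws. L2_inner S v w = 0) \<longrightarrow> v = 0)"

lemma orthonormal_append:
  "orthonormal S (vs @ ws) \<longleftrightarrow>
     orthonormal S vs \<and> orthonormal S ws \<and> (\<forall>v\<in>set vs. \<forall>w\<in>set ws. L2_inner S v w = 0)"
  by (auto simp: orthonormal_def sorted_wrt_append)

lemma orthonormal_concat:
  assumes "\<forall>ws\<in>set wss. orthonormal S ws"
    and "sorted_wrt (\<lambda>vs ws. \<forall>v\<in>set vs. \<forall>w\<in>set ws. L2_inner S v w = 0) wss"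
  shows "orthonormal S (concat wss)"
  using assms by (induction wss) (auto simp: orthonormal_append, simp add: orthonormal_def)

lemma orthonormal_nth:
  assumes "orthonormal S ws" "i < length ws" "j < length ws"
  shows "L2_inner S (ws ! i) (ws ! j) = (if i = j then 1 else 0)"
proof (cases i j rule: linorder_cases)
  case greater
  then have "L2_inner S (ws ! j) (ws ! i) = 0"
    using assms unfolding orthonormal_def sorted_wrt_iff_nth_less by blast
  then show ?thesis using greater L2_inner_zero_sym by auto
qed (use assms in \<open>auto simp: orthonormal_def sorted_wrt_iff_nth_less\<close>)

lemma orthonormal_distinct: "orthonormal S ws \<Longrightarrow> distinct ws"
  unfolding distinct_conv_nth
proof (intro allI impI)
  fix i j assume *: "orthonormal S ws" "i < length ws" "j < length ws" "i \<noteq> j"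
  then have "L2_inner S (ws ! i) (ws ! i) = 1" "L2_inner S (ws ! i) (ws ! j) = 0"
    using orthonormal_nth[OF *(1), of i i] orthonormal_nth[OF *(1), of i j] by simp_all
  then show "ws ! i \<noteq> ws ! j" by auto
qed

lemma orthonormal_inner:
  assumes "orthonormal S ws" "v \<in> set ws" "w \<in> set ws"
  shows "L2_inner S v w = (if v = w then 1 else 0)"
proof -
  obtain i j where ij: "i < length ws" "ws ! i = v" "j < length ws" "ws ! j = w"
    using assms by (auto simp: in_set_conv_nth)
  then have "v = w \<longleftrightarrow> i = j"
    using nth_eq_iff_index_eq[OF orthonormal_distinct[OF assms(1)]] by auto
  then show ?thesis using orthonormal_nth[OF assms(1), of i j] ij by auto
qed

lemma orthonormal_independent:
  assumes "orthonormal S ws"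
  shows "cspace.independent (set ws)"
proof (rule cspace.independent_if_scalars_zero)
  fix c w assume *: "(\<Sum>v\<in>set ws. fun_scale (c v) v) = 0" "w \<in> set ws"
  have "0 = L2_inner S (\<Sum>v\<in>set ws. fun_scale (c v) v) w"
    using * by simp
  also have "\<dots> = (\<Sum>v\<in>set ws. if v = w then c v else 0)"
    unfolding L2_inner_sum_left L2_inner_scale_left
    by (rule sum.cong) (use orthonormal_inner[OF assms] * in auto)
  also have "\<dots> = c w" using * by simp
  finally show "c w = 0" by simp
qed simp

lemma orthonormal_residual:
  assumes "orthonormal S ws" "w \<in> set ws"
  shows "L2_inner S (v - (\<Sum>u\<in>set ws. fun_scale (L2_inner S v u) u)) w = 0"
proof -
  have "L2_inner S (\<Sum>u\<in>set ws. fun_scale (L2_inner S v u) u) w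
      = (\<Sum>u\<in>set ws. if u = w then L2_inner S v u else 0)"
    unfolding L2_inner_sum_left L2_inner_scale_left
    by (rule sum.cong) (use orthonormal_inner[OF assms(1)] assms in auto)
  then show ?thesis using assms by (simp add: L2_inner_diff_left)
qed

lemma complete_expansion:
  assumes "orthonormal S ws" "cspace.subspace W" "set ws \<subseteq> W" "complete_in S W ws" "v \<in> W"
  shows "v = (\<Sum>u\<in>set ws. fun_scale (L2_inner S v u) u)"
proof -
  let ?d = "v - (\<Sum>u\<in>set ws. fun_scale (L2_inner S v u) u)"
  have "(\<Sum>u\<in>set ws. fun_scale (L2_inner S v u) u) \<in> W"
    by (rule cspace.subspace_sum[OF assms(2)], rule cspace.subspace_scale[OF assms(2)])
      (use assms(3) in blast)
  then have "?d \<in> W"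
    by (rule cspace.subspace_diff[OF assms(2,5)])
  then have "?d = 0"
    using assms(4) orthonormal_residual[OF assms(1)] unfolding complete_in_def by blast
  then show ?thesis by (simp only: right_minus_eq)
qed

lemma complete_span:
  assumes "orthonormal S ws" "cspace.subspace W" "set ws \<subseteq> W" "complete_in S W ws"
  shows "W \<subseteq> cspace.span (set ws)"
proof
  fix v assume "v \<in> W"
  show "v \<in> cspace.span (set ws)"
    by (subst complete_expansion[OF assms \<open>v \<in> W\<close>])
      (intro cspace.span_sum cspace.span_scale cspace.span_base)
qed

text \<open>The bridge from \<open>complex_dim\<close> to lists: multiplicities and nullities enter
  the argument as lengths of complete orthonormal lists.\<close>

lemma complete_length:
  assumes "orthonormal S ws" "cspace.subspace W" "set ws \<subseteq> W" "complete_in S W ws"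
  shows "length ws = complex_dim W"
  using cspace.dim_unique[OF assms(3) complete_span[OF assms] orthonormal_independent[OF assms(1)] refl]
    distinct_card[OF orthonormal_distinct[OF assms(1)]]
  by (simp add: complex_dim_def)

lemma complete_orthonormal_L2_space:
  assumes "finite S"
  obtains ws where "orthonormal S ws" "set ws \<subseteq> L2_space S" "complete_in S (L2_space S) ws"
    "length ws = card S"
proof -
  obtain xs where xs: "set xs = S" "distinct xs" using finite_distinct_list[OF assms] by blast
  define d :: "'a \<Rightarrow> 'a \<Rightarrow> complex" where "d x = (\<lambda>y. if y = x then 1 else 0)" for x
  have inner: "L2_inner S f (d x) = f x" if "x \<in> S" for f x
  proof -
    have "L2_inner S f (d x) = (\<Sum>y\<in>S. if y = x then f y else 0)"
      unfolding L2_inner_def by (rule sum.cong) (auto simp: d_def)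
    then show ?thesis using that assms by simp
  qed
  have "sorted_wrt (\<lambda>x y. L2_inner S (d x) (d y) = 0) xs"
    using xs inner by (auto simp: sorted_wrt_iff_nth_less d_def distinct_conv_nth)
  then have "orthonormal S (map d xs)"
    using xs inner by (auto simp: orthonormal_def sorted_wrt_map d_def)
  moreover have "set (map d xs) \<subseteq> L2_space S"
    using xs by (auto simp: L2_space_def d_def)
  moreover have "complete_in S (L2_space S) (map d xs)"
    unfolding complete_in_def
  proof (intro ballI impI ext)
    fix f y assume f: "f \<in> L2_space S" "\<forall>w\<in>set (map d xs). L2_inner S f w = 0"
    then show "f y = 0 y"
      using inner[of y f] xs by (cases "y \<in> S") (auto simp: L2_space_def)
  qed
  moreover have "length (map d xs) = card S" using xs distinct_card by fastforce
  ultimately show thesis using that by blast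
qed

lemma orthonormal_length_le:
  assumes "finite S" "orthonormal S ws" "set ws \<subseteq> L2_space S"
  shows "length ws \<le> card S"
proof -
  obtain ds where ds: "orthonormal S ds" "set ds \<subseteq> L2_space S" "complete_in S (L2_space S) ds"
    "length ds = card S" using complete_orthonormal_L2_space[OF assms(1)] .
  have "card (set ws) \<le> card (set ds)"
    using cspace.independent_span_bound[OF _ orthonormal_independent[OF assms(2)], of "set ds"]
      complete_span[OF ds(1) subspace_L2_space ds(2,3)] assms(3) by auto
  then show ?thesis
    using ds distinct_card orthonormal_distinct assms(2) by metis
qed

text \<open>A longest orthonormal continuation takes the place of Gram-Schmidt. Lengths are bounded
  by \<open>card S\<close>, and a nonzero vector of \<open>W\<close> orthogonal to the whole list
  could be normalised and appended.\<close>

lemma orthonormal_extend: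
  assumes "finite S" "cspace.subspace W" "W \<subseteq> L2_space S" "orthonormal S ws" "set ws \<subseteq> W"
  obtains ws' where "set ws' \<subseteq> W" "orthonormal S (ws @ ws')" "complete_in S W (ws @ ws')"
proof -
  define P where "P ws' \<longleftrightarrow> set ws' \<subseteq> W \<and> orthonormal S (ws @ ws')" for ws'
  have P0: "P []" using assms by (simp add: P_def)
  have "length ws' < Suc (card S)" if "P ws'" for ws'
  proof -
    have "set (ws @ ws') \<subseteq> L2_space S" using that assms by (auto simp: P_def)
    then show ?thesis
      using orthonormal_length_le[OF assms(1), of "ws @ ws'"] that by (simp add: P_def)
  qed
  then have "\<forall>us. P us \<longrightarrow> length us < Suc (card S)" by blast
  from ex_has_greatest_nat[of P "[]" length, OF P0 this]
  obtain ws' where ws': "P ws'" "\<And>us. P us \<Longrightarrow> length us \<le> length ws'" by blast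
  have "complete_in S W (ws @ ws')"
    unfolding complete_in_def
  proof (intro ballI impI, rule ccontr)
    fix v assume v: "v \<in> W" "\<forall>w\<in>set (ws @ ws'). L2_inner S v w = 0" "v \<noteq> 0"
    then obtain r where r: "r > 0" "L2_inner S v v = complex_of_real r"
      using L2_inner_self_pos[OF assms(1)] assms(3) by blast
    define u where "u = fun_scale (complex_of_real (1 / sqrt r)) v"
    have "complex_of_real (sqrt r) * complex_of_real (sqrt r) = complex_of_real r"
      using r by (simp flip: of_real_mult)
    then have "L2_inner S u u = 1"
      using r by (simp add: u_def L2_inner_scale_left L2_inner_scale_right field_simps)
    moreover have "\<forall>w\<in>set (ws @ ws'). L2_inner S w u = 0"
      using v(2) by (auto simp: u_def L2_inner_scale_right L2_inner_zero_sym[of S _ v])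
    moreover have "u \<in> W" using v assms by (simp add: u_def cspace.subspace_scale)
    ultimately have "P (ws' @ [u])"
      using ws'(1) orthonormal_append[of S "ws @ ws'" "[u]"] by (simp add: P_def orthonormal_def[of S "[u]"])
    from ws'(2)[OF this] show False by simp
  qed
  then show thesis using that ws'(1) by (auto simp: P_def)
qed

lemma orthonormal_card_complete:
  assumes "finite S" "orthonormal S ws" "set ws \<subseteq> L2_space S" "length ws = card S"
  shows "complete_in S (L2_space S) ws"
proof -
  obtain ws' where ws': "set ws' \<subseteq> L2_space S" "orthonormal S (ws @ ws')"
      "complete_in S (L2_space S) (ws @ ws')"
    using assms by (rule_tac orthonormal_extend[of S "L2_space S" ws])
      (simp_all add: subspace_L2_space)
  then have "ws' = []"
    using orthonormal_length_le[OF assms(1) ws'(2)] assms ws'(1) by simp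
  then show ?thesis using ws' by simp
qed

lemma complex_dim_L2_space:
  assumes "finite S"
  shows "complex_dim (L2_space S) = card S"
proof -
  obtain ds where "orthonormal S ds" "set ds \<subseteq> L2_space S" "complete_in S (L2_space S) ds"
    "length ds = card S" using complete_orthonormal_L2_space[OF assms] .
  then show ?thesis using complete_length[OF _ subspace_L2_space] by metis
qed

text \<open>The inner product stays that of the larger set \<open>T\<close> (the vertices or the
  arcs), while the functions live on \<open>S\<close> (one side, or the arcs leaving
  \<open>L\<close>).\<close>

lemma orthonormal_extend_L2_space:
  assumes "finite T" "S \<subseteq> T" "orthonormal T ws" "set ws \<subseteq> L2_space S"
  obtains ws' where "set ws' \<subseteq> L2_space S" "orthonormal T (ws @ ws')"
    "complete_in T (L2_space S) (ws @ ws')" "length ws + length ws' = card S"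
proof -
  have "L2_space S \<subseteq> L2_space T" using assms(2) by (auto simp: L2_space_def)
  then obtain ws' where *: "set ws' \<subseteq> L2_space S" "orthonormal T (ws @ ws')"
    "complete_in T (L2_space S) (ws @ ws')"
    by (rule orthonormal_extend[OF assms(1) subspace_L2_space _ assms(3,4)])
  moreover have "length (ws @ ws') = card S"
    using complete_length[OF *(2) subspace_L2_space _ *(3)] assms * finite_subset[OF assms(2,1)]
    by (simp add: complex_dim_L2_space)
  ultimately show thesis using that by simp
qed

text \<open>The vectors orthogonal to a fixed set form a subspace; this is used for one argument at
  a time.\<close>

lemma L2_inner_span_zero:
  assumes "\<And>x y. x \<in> A \<Longrightarrow> y \<in> B \<Longrightarrow> L2_inner S x y = 0"
    and "x \<in> cspace.span A" "y \<in> cspace.span B"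
  shows "L2_inner S x y = 0"
proof -
  have "cspace.span A \<subseteq> {x. \<forall>y\<in>B. L2_inner S x y = 0}"
    by (rule cspace.span_minimal)
      (use assms(1) in \<open>auto simp: cspace.subspace_def L2_inner_add_left L2_inner_scale_left\<close>)
  moreover have "cspace.span B \<subseteq> {y. L2_inner S x y = 0}" if "\<forall>y\<in>B. L2_inner S x y = 0"
    by (rule cspace.span_minimal)
      (use that in \<open>auto simp: cspace.subspace_def L2_inner_add_right L2_inner_scale_right\<close>)
  ultimately show ?thesis using assms(2,3) by blast
qed

lemma sorted_wrt_conj:
  "sorted_wrt (\<lambda>x y. P x y \<and> Q x y) xs \<longleftrightarrow> sorted_wrt P xs \<and> sorted_wrt Q xs"
  by (induction xs) auto

lemma comb_span:
  "v \<in> W \<Longrightarrow> w \<in> W \<Longrightarrow> cspace.subspace W \<Longrightarrow> fun_scale a v + fun_scale b w \<in> W"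
  by (simp add: cspace.subspace_add cspace.subspace_scale)

section \<open>Matrix representations and unitary equivalence\<close>

definition linear_op :: "(('b \<Rightarrow> complex) \<Rightarrow> 'b \<Rightarrow> complex) \<Rightarrow> bool" where
  "linear_op T \<longleftrightarrow>
     (\<forall>f g. T (f + g) = T f + T g) \<and> (\<forall>c f. T (fun_scale c f) = fun_scale c (T f))"

lemma linear_op_add: "linear_op T \<Longrightarrow> T (f + g) = T f + T g"
  and linear_op_scale: "linear_op T \<Longrightarrow> T (fun_scale c f) = fun_scale c (T f)"
  by (simp_all add: linear_op_def)

lemma linear_op_zero: "linear_op T \<Longrightarrow> T 0 = 0"
  using linear_op_scale[of T 0 0] by simp

lemma linear_op_minus: "linear_op T \<Longrightarrow> T (- f) = - T f"
  using linear_op_scale[of T "-1" f] by simp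

lemma linear_op_diff: "linear_op T \<Longrightarrow> T (f - g) = T f - T g"
  unfolding diff_conv_add_uminus by (simp only: linear_op_add linear_op_minus)

lemma linear_op_sum:
  assumes "linear_op T"
  shows "T (\<Sum>i\<in>A. f i) = (\<Sum>i\<in>A. T (f i))"
proof (induction A rule: infinite_finite_induct)
  case (insert x F)
  then show ?case by (simp only: sum.insert[OF insert.hyps] linear_op_add[OF assms])
next
  case (infinite A)
  then show ?case by (simp only: sum.infinite[OF infinite.hyps] linear_op_zero[OF assms])
next
  case empty
  then show ?case by (simp only: sum.empty linear_op_zero[OF assms])
qed

definition represents ::
    "(('b \<Rightarrow> complex) \<Rightarrow> 'b \<Rightarrow> complex) \<Rightarrow> ('b \<Rightarrow> complex) list \<Rightarrow> complex mat \<Rightarrow> bool" where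
  "represents T ws M \<longleftrightarrow> M \<in> carrier_mat (length ws) (length ws) \<and>
     (\<forall>c<length ws. T (ws ! c) = (\<Sum>r<length ws. fun_scale (M $$ (r, c)) (ws ! r)))"

lemma sum_lessThan_add:
  fixes f :: "nat \<Rightarrow> 'c :: comm_monoid_add"
  shows "(\<Sum>r<a + b. f r) = (\<Sum>r<a. f r) + (\<Sum>r<b. f (a + r))"
  by (induction b) (simp_all add: add.assoc)

lemma represents_append:
  assumes A: "represents T vs A" and B: "represents T ws B"
  shows "represents T (vs @ ws)
    (four_block_mat A (0\<^sub>m (dim_row A) (dim_col B)) (0\<^sub>m (dim_row B) (dim_col A)) B)"
proof -
  let ?M = "four_block_mat A (0\<^sub>m (dim_row A) (dim_col B)) (0\<^sub>m (dim_row B) (dim_col A)) B"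
  let ?a = "length vs" and ?b = "length ws"
  have dims: "dim_row A = ?a" "dim_col A = ?a" "dim_row B = ?b" "dim_col B = ?b"
    using A B by (auto simp: represents_def)
  have "T ((vs @ ws) ! c) = (\<Sum>r<?a + ?b. fun_scale (?M $$ (r, c)) ((vs @ ws) ! r))"
    if c: "c < ?a + ?b" for c
  proof (cases "c < ?a")
    case True
    have "(\<Sum>r<?a. fun_scale (?M $$ (r, c)) ((vs @ ws) ! r))
        = (\<Sum>r<?a. fun_scale (A $$ (r, c)) (vs ! r))"
      using True by (intro sum.cong) (simp_all add: dims nth_append)
    moreover have "(\<Sum>r<?b. fun_scale (?M $$ (?a + r, c)) ((vs @ ws) ! (?a + r))) = 0"
      using True by (intro sum.neutral ballI) (simp add: dims)
    moreover have "T (vs ! c) = (\<Sum>r<?a. fun_scale (A $$ (r, c)) (vs ! r))"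
      using A True unfolding represents_def by blast
    ultimately show ?thesis
      using True by (simp only: sum_lessThan_add nth_append if_True add_0_right)
  next
    case False
    have "(\<Sum>r<?a. fun_scale (?M $$ (r, c)) ((vs @ ws) ! r)) = 0"
      using False c by (intro sum.neutral ballI) (simp add: dims)
    moreover have "(\<Sum>r<?b. fun_scale (?M $$ (?a + r, c)) ((vs @ ws) ! (?a + r)))
        = (\<Sum>r<?b. fun_scale (B $$ (r, c - ?a)) (ws ! r))"
      using False c by (intro sum.cong) (simp_all add: dims)
    moreover have "T (ws ! (c - ?a)) = (\<Sum>r<?b. fun_scale (B $$ (r, c - ?a)) (ws ! r))"
      using B False c unfolding represents_def by auto
    ultimately show ?thesis
      using False by (simp only: sum_lessThan_add nth_append if_False add_0_left)
  qed
  moreover have "?M \<in> carrier_mat (?a + ?b) (?a + ?b)"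
    by (rule carrier_matI) (simp_all add: dims)
  ultimately show ?thesis unfolding represents_def length_append by blast
qed

text \<open>Together with orthonormality of the concatenated list this reduces the theorem to one
  invariant subspace at a time.\<close>

lemma represents_concat:
  assumes "list_all2 (represents T) wss Ms"
  shows "represents T (concat wss) (diag_block_mat Ms)"
  using assms
proof (induction rule: list_all2_induct)
  case (Cons ws wss M Ms)
  then show ?case using represents_append by (simp add: Let_def)
qed (simp add: represents_def)

text \<open>The unitary map sends the standard basis to \<open>ws\<close>. Orthonormality gives
  injectivity and preserves inner products; having \<open>card S\<close> members leaves no
  orthogonal complement, which gives surjectivity.\<close>

lemma represents_unitarily_equivalent:
  assumes fin: "finite S" and T: "linear_op T" and ortho: "orthonormal S ws"
    and sub: "set ws \<subseteq> L2_space S" and card: "length ws = card S" and M: "represents T ws M"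
  shows "unitarily_equivalent S T M"
proof -
  let ?N = "length ws"
  define U where "U v = (\<Sum>i<?N. fun_scale (v $ i) (ws ! i))" for v :: "complex vec"
  have M': "M \<in> carrier_mat ?N ?N" using M by (simp add: represents_def)
  have add: "U (v + w) = U v + U w" if "v \<in> carrier_vec ?N" "w \<in> carrier_vec ?N" for v w
  proof -
    have "U (v + w) = (\<Sum>i<?N. fun_scale (v $ i) (ws ! i) + fun_scale (w $ i) (ws ! i))"
      unfolding U_def using that by (intro sum.cong) (auto simp: cspace.scale_left_distrib)
    then show ?thesis by (simp only: U_def sum.distrib)
  qed
  have scale: "U (c \<cdot>\<^sub>v v) = fun_scale c (U v)" if "v \<in> carrier_vec ?N" for c v
    unfolding U_def cspace.scale_sum_right using that by (intro sum.cong) auto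
  have coeff: "L2_inner S (U v) (ws ! j) = v $ j" if "j < ?N" for v j
  proof -
    have "L2_inner S (U v) (ws ! j) = (\<Sum>i<?N. if i = j then v $ i else 0)"
      unfolding U_def L2_inner_sum_left L2_inner_scale_left
      by (rule sum.cong) (use that orthonormal_nth[OF ortho] in auto)
    then show ?thesis using that by simp
  qed
  have inner: "L2_inner S (U v) (U w) = v \<bullet>c w"
    if "v \<in> carrier_vec ?N" "w \<in> carrier_vec ?N" for v w
  proof -
    have "L2_inner S (U v) (U w) = (\<Sum>i<?N. cnj (w $ i) * (v $ i))"
      unfolding U_def[of w] L2_inner_sum_right L2_inner_scale_right
      by (rule sum.cong) (use coeff in auto)
    also have "\<dots> = v \<bullet>c w"
      unfolding scalar_prod_def using that
      by (intro sum.cong) (auto simp: conjugate_complex_def mult.commute)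
    finally show ?thesis .
  qed
  have mem: "U v \<in> L2_space S" for v
    unfolding U_def
    by (rule cspace.subspace_sum[OF subspace_L2_space], rule cspace.subspace_scale[OF subspace_L2_space])
      (use sub in auto)
  have bij: "bij_betw U (carrier_vec ?N) (L2_space S)"
  proof (rule bij_betwI')
    fix v w :: "complex vec"
    assume *: "v \<in> carrier_vec ?N" "w \<in> carrier_vec ?N"
    show "U v = U w \<longleftrightarrow> v = w"
    proof
      assume "U v = U w"
      then have "v $ j = w $ j" if "j < ?N" for j using coeff[OF that] by metis
      then show "v = w" using * by (intro eq_vecI) auto
    qed simp
  next
    fix f assume f: "f \<in> L2_space S"
    define v where "v = vec ?N (\<lambda>i. L2_inner S f (ws ! i))"
    have "f - U v \<in> L2_space S"
      by (rule cspace.subspace_diff[OF subspace_L2_space f mem])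
    moreover have "\<forall>w\<in>set ws. L2_inner S (f - U v) w = 0"
      using coeff by (auto simp: in_set_conv_nth L2_inner_diff_left v_def)
    ultimately have "f - U v = 0"
      using orthonormal_card_complete[OF fin ortho sub card] unfolding complete_in_def by blast
    then show "\<exists>v\<in>carrier_vec ?N. f = U v"
      by (intro bexI[of _ v]) (simp_all only: right_minus_eq, simp add: v_def)
  qed (use mem in auto)
  have "T (U v) = U (M *\<^sub>v v)" if v: "v \<in> carrier_vec ?N" for v :: "complex vec"
  proof -
    have "T (U v) = (\<Sum>i<?N. fun_scale (v $ i) (\<Sum>r<?N. fun_scale (M $$ (r, i)) (ws ! r)))"
      unfolding U_def linear_op_sum[OF T] linear_op_scale[OF T]
      by (rule sum.cong) (use M in \<open>auto simp: represents_def\<close>)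
    also have "\<dots> = (\<Sum>r<?N. \<Sum>i<?N. fun_scale (v $ i * M $$ (r, i)) (ws ! r))"
      unfolding cspace.scale_sum_right cspace.scale_scale by (rule sum.swap)
    also have "\<dots> = (\<Sum>r<?N. fun_scale ((M *\<^sub>v v) $ r) (ws ! r))"
    proof (rule sum.cong)
      fix r assume "r \<in> {..<?N}"
      then have "(M *\<^sub>v v) $ r = (\<Sum>i<?N. v $ i * M $$ (r, i))"
        using M' v by (simp add: scalar_prod_def mult.commute lessThan_atLeast0)
      then show "(\<Sum>i<?N. fun_scale (v $ i * M $$ (r, i)) (ws ! r))
          = fun_scale ((M *\<^sub>v v) $ r) (ws ! r)"
        by (simp only: cspace.scale_sum_left)
    qed simp
    finally show ?thesis by (simp only: U_def)
  qed
  with M' bij add scale inner show ?thesis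
    unfolding unitarily_equivalent_def by blast
qed

section \<open>Functions on the arcs of a biregular graph\<close>

locale biregular_graph =
  fixes G :: "'a pair_pre_digraph" and L R :: "'a set" and K k :: nat
  assumes biregular: "biregular_bipartite G L R K k"
begin

abbreviation "V \<equiv> pverts G"
abbreviation "E \<equiv> parcs G"
abbreviation "ad \<equiv> adjacency_op G"
abbreviation "nb \<equiv> non_backtracking_op G"

definition nbrs :: "'a \<Rightarrow> 'a set" where
  "nbrs v = {w. (v, w) \<in> E}"

definition src :: "('a \<Rightarrow> complex) \<Rightarrow> 'a \<times> 'a \<Rightarrow> complex" where
  "src F = (\<lambda>(v, u). if (v, u) \<in> E then F v else 0)"

definition tgt :: "('a \<Rightarrow> complex) \<Rightarrow> 'a \<times> 'a \<Rightarrow> complex" where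
  "tgt F = (\<lambda>(v, u). if (v, u) \<in> E then F u else 0)"

definition flip :: "('a \<times> 'a \<Rightarrow> complex) \<Rightarrow> 'a \<times> 'a \<Rightarrow> complex" where
  "flip h = (\<lambda>(v, u). h (u, v))"

lemma pair_graph: "pair_graph G"
  and V_eq: "V = L \<union> R"
  and disjoint: "L \<inter> R = {}"
  and E_subset: "E \<subseteq> L \<times> R \<union> R \<times> L"
  using biregular by (auto simp: biregular_bipartite_def)

interpretation pair_graph G by (rule pair_graph)

lemma finite_V [simp]: "finite V" and finite_E [simp]: "finite E"
  by (rule pair_finite_verts, rule pair_finite_arcs)

lemma finite_LR [simp]: "finite L" "finite R"
  using finite_V V_eq by auto

lemma E_sym: "(v, u) \<in> E \<longleftrightarrow> (u, v) \<in> E"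
  using arcs_symmetric by blast

lemma E_sides: "(v, u) \<in> E \<Longrightarrow> v \<in> L \<and> u \<in> R \<and> v \<notin> R \<and> u \<notin> L \<or> v \<in> R \<and> u \<in> L \<and> v \<notin> L \<and> u \<notin> R"
  using E_subset disjoint by blast

lemma finite_nbrs [simp]: "finite (nbrs v)"
  by (rule finite_subset[of _ "snd ` E"]) (force simp: nbrs_def)+

lemma out_degree_eq: "out_degree (with_proj G) v = card (nbrs v)"
proof -
  have "out_arcs (with_proj G) v = Pair v ` nbrs v"
    by (auto simp: out_arcs_def nbrs_def)
  then show ?thesis by (simp add: out_degree_def card_image inj_on_def)
qed

lemma card_nbrs: "v \<in> L \<Longrightarrow> card (nbrs v) = K + 1" "v \<in> R \<Longrightarrow> card (nbrs v) = k + 1"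
  using biregular by (auto simp: biregular_bipartite_def out_degree_eq)

lemma E_Sigma: "E = Sigma V nbrs"
  using V_eq E_sides by (auto simp: nbrs_def)

lemma sum_E: "(\<Sum>e\<in>E. f e) = (\<Sum>v\<in>V. \<Sum>u\<in>nbrs v. f (v, u))"
  unfolding E_Sigma by (subst sum.Sigma) auto

lemma sum_E_flip: "(\<Sum>e\<in>E. f e) = (\<Sum>(v, u)\<in>E. f (u, v))"
  by (rule sum.reindex_bij_witness[of _ prod.swap prod.swap]) (use E_sym in auto)

lemma ad_eq: "ad F v = (\<Sum>w\<in>nbrs v. F w)"
  by (simp add: adjacency_op_def nbrs_def)

lemma linear_ad: "linear_op ad"
  by (auto simp: linear_op_def fun_eq_iff ad_eq sum.distrib sum_distrib_left)

lemma linear_nb: "linear_op nb"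
  by (auto simp: linear_op_def fun_eq_iff non_backtracking_op_def sum.distrib sum_distrib_left)

lemma src_tgt_scale: "src (fun_scale c F) = fun_scale c (src F)" "tgt (fun_scale c F) = fun_scale c (tgt F)"
  and src_tgt_zero: "src 0 = 0" "tgt 0 = 0"
  by (auto simp: fun_eq_iff src_def tgt_def)

lemma src_tgt_mem: "src F \<in> L2_space E" "tgt F \<in> L2_space E"
  by (auto simp: L2_space_def src_def tgt_def)

section \<open>The non-backtracking operator on functions lifted from vertices\<close>

lemma nb_apply:
  assumes "(v, u) \<in> E"
  shows "nb f (v, u) = (\<Sum>w\<in>nbrs u. f (u, w)) - f (u, v)"
proof -
  have "{w. (u, w) \<in> E \<and> w \<noteq> v} = nbrs u - {v}" by (auto simp: nbrs_def)
  moreover have "v \<in> nbrs u" using assms E_sym by (simp add: nbrs_def)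
  ultimately show ?thesis using assms by (simp add: non_backtracking_op_def sum_diff1)
qed

lemma nb_outside: "(v, u) \<notin> E \<Longrightarrow> nb f (v, u) = 0"
  by (simp add: non_backtracking_op_def)

text \<open>An arc into \<open>u\<close> is continued by \<open>d\<close> arcs other than its
  reversal, each carrying the value \<open>F u\<close>. The degree is prescribed only where
  \<open>F\<close> is nonzero, so that one statement serves both sides.\<close>

lemma nb_src:
  assumes "\<And>u. u \<in> V \<Longrightarrow> F u \<noteq> 0 \<Longrightarrow> card (nbrs u) = d + 1"
  shows "nb (src F) = fun_scale (of_nat d) (tgt F)"
proof (rule ext, clarify)
  fix v u
  show "nb (src F) (v, u) = fun_scale (of_nat d) (tgt F) (v, u)"
  proof (cases "(v, u) \<in> E")
    case True
    then have "u \<in> V" "(u, v) \<in> E" using E_sides V_eq E_sym by blast+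
    moreover have "(\<Sum>w\<in>nbrs u. src F (u, w)) = (\<Sum>w\<in>nbrs u. F u)"
      by (rule sum.cong) (auto simp: src_def nbrs_def)
    ultimately have "nb (src F) (v, u) = of_nat (card (nbrs u)) * F u - F u"
      using nb_apply[OF True] by (simp add: src_def)
    also have "\<dots> = of_nat d * F u"
      using assms[OF \<open>u \<in> V\<close>] by (cases "F u = 0") (auto simp: algebra_simps)
    finally show ?thesis using True by (simp add: tgt_def)
  qed (simp add: nb_outside tgt_def)
qed

lemma nb_src_L: "f \<in> L2_space L \<Longrightarrow> nb (src f) = fun_scale (of_nat K) (tgt f)"
  by (rule nb_src) (use card_nbrs in \<open>auto simp: L2_space_def\<close>)

lemma nb_src_R: "g \<in> L2_space R \<Longrightarrow> nb (src g) = fun_scale (of_nat k) (tgt g)"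
  by (rule nb_src) (use card_nbrs in \<open>auto simp: L2_space_def\<close>)

lemma nb_tgt: "nb (tgt F) = tgt (ad F) - src F"
proof (rule ext, clarify)
  fix v u
  show "nb (tgt F) (v, u) = (tgt (ad F) - src F) (v, u)"
  proof (cases "(v, u) \<in> E")
    case True
    have "(\<Sum>w\<in>nbrs u. tgt F (u, w)) = ad F u"
      unfolding ad_eq by (rule sum.cong) (auto simp: tgt_def nbrs_def)
    then show ?thesis
      using nb_apply[OF True] True E_sym[of v u] by (simp add: tgt_def src_def)
  qed (simp add: nb_outside tgt_def src_def)
qed

section \<open>Inner products of lifted functions\<close>

lemma inner_src_left:
  "L2_inner E (src F) h = (\<Sum>v\<in>V. F v * cnj (\<Sum>u\<in>nbrs v. h (v, u)))"
  unfolding L2_inner_def sum_E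
  by (rule sum.cong) (auto simp: sum_distrib_left src_def nbrs_def intro!: sum.cong)

lemma inner_src_src:
  assumes "\<And>u. u \<in> V \<Longrightarrow> F u \<noteq> 0 \<Longrightarrow> card (nbrs u) = d"
  shows "L2_inner E (src F) (src F') = of_nat d * L2_inner V F F'"
  unfolding inner_src_left L2_inner_def[of V] sum_distrib_left
proof (rule sum.cong)
  fix v assume v: "v \<in> V"
  have "(\<Sum>u\<in>nbrs v. src F' (v, u)) = (\<Sum>u\<in>nbrs v. F' v)"
    by (rule sum.cong) (auto simp: src_def nbrs_def)
  then show "F v * cnj (\<Sum>u\<in>nbrs v. src F' (v, u)) = of_nat d * (F v * cnj (F' v))"
    using assms[OF v] by (cases "F v = 0") auto
qed simp

lemma inner_src_tgt: "L2_inner E (src F) (tgt F') = L2_inner V F (ad F')"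
  unfolding inner_src_left ad_eq L2_inner_def[of V]
  by (rule sum.cong) (auto simp: tgt_def nbrs_def intro!: sum.cong)

lemma inner_flip: "L2_inner E (flip h) (flip h') = L2_inner E h h'"
  unfolding L2_inner_def by (subst sum_E_flip) (auto simp: flip_def intro!: sum.cong)

lemma flip_flip [simp]: "flip (flip h) = h"
  by (auto simp: flip_def)

lemma flip_src [simp]: "flip (src F) = tgt F" and flip_tgt [simp]: "flip (tgt F) = src F"
  using E_sym by (auto simp: flip_def src_def tgt_def fun_eq_iff)

lemma inner_tgt_tgt: "L2_inner E (tgt F) (tgt F') = L2_inner E (src F) (src F')"
  by (simp flip: flip_src add: inner_flip)

lemma inner_tgt_src: "L2_inner E (tgt F) (src F') = L2_inner V F (ad F')"
  using inner_flip[of "src F" "tgt F'"] by (simp add: inner_src_tgt)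

text \<open>Both sides are the arc inner product of \<open>tgt F\<close> and \<open>src F'\<close>,
  computed from either end of the arcs.\<close>

lemma ad_symmetric: "L2_inner V (ad F) F' = L2_inner V F (ad F')"
  by (metis inner_src_tgt inner_tgt_src cnj_L2_inner)

lemma inner_src_src_L: "f \<in> L2_space L \<Longrightarrow> L2_inner E (src f) (src F) = of_nat (K + 1) * L2_inner V f F"
  by (rule inner_src_src) (use card_nbrs in \<open>auto simp: L2_space_def\<close>)

lemma inner_src_src_R: "g \<in> L2_space R \<Longrightarrow> L2_inner E (src g) (src F) = of_nat (k + 1) * L2_inner V g F"
  by (rule inner_src_src) (use card_nbrs in \<open>auto simp: L2_space_def\<close>)

lemma inner_LR: "f \<in> L2_space L \<Longrightarrow> g \<in> L2_space R \<Longrightarrow> L2_inner V f g = 0"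
  and inner_RL: "f \<in> L2_space L \<Longrightarrow> g \<in> L2_space R \<Longrightarrow> L2_inner V g f = 0"
proof -
  assume "f \<in> L2_space L" "g \<in> L2_space R"
  then have "f v = 0 \<or> g v = 0" for v
    using disjoint by (auto simp: L2_space_def)
  then show "L2_inner V f g = 0" "L2_inner V g f = 0"
    unfolding L2_inner_def by (force intro: sum.neutral)+
qed

section \<open>Singular pairs of the adjacency operator and their arc spaces\<close>

lemma ad_L: "f \<in> L2_space L \<Longrightarrow> ad f \<in> L2_space R"
  and ad_R: "g \<in> L2_space R \<Longrightarrow> ad g \<in> L2_space L"
  using E_sides by (auto simp: L2_space_def ad_eq nbrs_def intro!: sum.neutral) 

text \<open>Singular vectors of the biadjacency matrix with singular value \<open>l\<close>. The
  value 0 and zero components are allowed, so that a kernel function paired with 0 on the other side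
  is a mode too.\<close>

definition mode :: "('a \<Rightarrow> complex) \<Rightarrow> ('a \<Rightarrow> complex) \<Rightarrow> real \<Rightarrow> bool" where
  "mode f g l \<longleftrightarrow> f \<in> L2_space L \<and> g \<in> L2_space R \<and>
     ad f = fun_scale (complex_of_real l) g \<and> ad g = fun_scale (complex_of_real l) f"

definition arc_span :: "('a \<Rightarrow> complex) \<Rightarrow> ('a \<Rightarrow> complex) \<Rightarrow> ('a \<times> 'a \<Rightarrow> complex) set" where
  "arc_span f g = cspace.span {src f, tgt f, src g, tgt g}"

lemma subspace_arc_span: "cspace.subspace (arc_span f g)"
  by (simp add: arc_span_def)

lemma arc_span_base:
  "src f \<in> arc_span f g" "tgt f \<in> arc_span f g" "src g \<in> arc_span f g" "tgt g \<in> arc_span f g"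
  by (auto simp: arc_span_def intro: cspace.span_base)

lemma arc_span_subset: "arc_span f g \<subseteq> L2_space E"
  unfolding arc_span_def
  by (rule cspace.span_minimal) (auto simp: src_tgt_mem subspace_L2_space)

text \<open>Every inner product between generators of the two spaces is a multiple of that of
  \<open>f\<close> with \<open>f'\<close> or of \<open>g\<close> with \<open>g'\<close>, or it pairs
  functions of opposite sides. The eigenvalues may coincide.\<close>

lemma arc_span_orthogonal:
  assumes f: "mode f g l" and f': "mode f' g' l'"
    and ortho: "L2_inner V f f' = 0" "L2_inner V g g' = 0"
    and "x \<in> arc_span f g" "y \<in> arc_span f' g'"
  shows "L2_inner E x y = 0"
proof -
  have mem: "f \<in> L2_space L" "g \<in> L2_space R" "f' \<in> L2_space L" "g' \<in> L2_space R"
    and ad: "ad f' = fun_scale (complex_of_real l') g'" "ad g' = fun_scale (complex_of_real l') f'"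
    using f f' by (auto simp: mode_def)
  show ?thesis
    by (rule L2_inner_span_zero[OF _ assms(5,6)[unfolded arc_span_def]])
      (auto simp: inner_tgt_tgt inner_src_tgt inner_tgt_src inner_src_src_L inner_src_src_R
        mem ad ortho L2_inner_scale_right inner_LR inner_RL)
qed

end

section \<open>Simultaneous triangularisation of the two 2-by-2 matrices\<close>

text \<open>
  In the bases of the lemma \<open>mode_basis\<close> below, \<open>B\<close> acts by \<open>Y = diag(K, -1)\<close> from the arcs
  leaving \<open>L\<close> to the arcs leaving \<open>R\<close>, and by \<open>X = (k + 1) r r\<^sup>T - 1\<close> with \<open>r = (c, s)\<close> in the
  other direction. The predicate provides orthonormal bases \<open>a\<^sub>1, a\<^sub>2\<close> and \<open>b\<^sub>1, b\<^sub>2\<close> of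
  \<open>\<complex>\<^sup>2\<close> (the primed variables are the second coordinates) in which \<open>X\<close> and \<open>Y\<close> become upper
  triangular with rows \<open>(x1, x12), (0, x2)\<close> and \<open>(y1, y12), (0, y2)\<close>.
\<close>

definition schur_pair ::
    "nat \<Rightarrow> nat \<Rightarrow> real \<Rightarrow> real \<Rightarrow> complex \<Rightarrow> complex \<Rightarrow> complex \<Rightarrow> complex \<Rightarrow> complex \<Rightarrow> complex \<Rightarrow> bool"
where
  "schur_pair K k c s x1 x12 x2 y1 y12 y2 \<longleftrightarrow>
     (\<exists>a1 a1' a2 a2' b1 b1' b2 b2' :: complex.
        a1 * cnj a1 + a1' * cnj a1' = 1 \<and> a2 * cnj a2 + a2' * cnj a2' = 1 \<and>
        a1 * cnj a2 + a1' * cnj a2' = 0 \<and>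
        b1 * cnj b1 + b1' * cnj b1' = 1 \<and> b2 * cnj b2 + b2' * cnj b2' = 1 \<and>
        b1 * cnj b2 + b1' * cnj b2' = 0 \<and>
        of_nat K * a1 = y1 * b1 \<and> - a1' = y1 * b1' \<and>
        of_nat K * a2 = y12 * b1 + y2 * b2 \<and> - a2' = y12 * b1' + y2 * b2' \<and>
        of_real ((real k + 1) * c\<^sup>2 - 1) * b1 + of_real ((real k + 1) * c * s) * b1' = x1 * a1 \<and>
        of_real ((real k + 1) * c * s) * b1 + of_real ((real k + 1) * s\<^sup>2 - 1) * b1' = x1 * a1' \<and>
        of_real ((real k + 1) * c\<^sup>2 - 1) * b2 + of_real ((real k + 1) * c * s) * b2'
          = x12 * a1 + x2 * a2 \<and>
        of_real ((real k + 1) * c * s) * b2 + of_real ((real k + 1) * s\<^sup>2 - 1) * b2'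
          = x12 * a1' + x2 * a2')"

text \<open>The vector \<open>a1\<close> is orthogonal to \<open>Y a1\<close>, so the second basis
  can be the first in reverse order: \<open>b1 = a2\<close> and \<open>b2 = a1\<close>. In this
  basis \<open>Y\<close> has diagonal entry 0 at \<open>a1\<close>, hence its trace
  \<open>K - 1\<close> at \<open>a2\<close>, and its off-diagonal entries are conjugate because
  \<open>Y\<close> is symmetric. For \<open>X\<close> the entry 0 is at \<open>a2\<close> and the
  trace \<open>k - 1\<close> at \<open>a1\<close>.\<close>

lemma schur_pair_tempered:
  fixes u :: complex
  assumes cs: "c > 0" "s > 0" "c\<^sup>2 + s\<^sup>2 = 1" and u: "u * cnj u = 1"
    and tr: "sqrt K * sqrt k * Re (2 * u\<^sup>2) = c\<^sup>2 * (real K + 1) * (real k + 1) - K - k"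
  shows "schur_pair K k c s (sqrt k * u) (of_nat k - 1) (sqrt k * cnj u)
           (sqrt K * u) (of_nat K - 1) (sqrt K * cnj u)"
proof -
  define \<kappa> \<iota> C S P Q v v' where
    defs: "\<kappa> = complex_of_real (sqrt K)" "\<iota> = complex_of_real (sqrt k)" "C = complex_of_real c"
      "S = complex_of_real s" "P = (of_nat K + 1 :: complex)" "Q = (of_nat k + 1 :: complex)"
      "v = u\<^sup>2" "v' = cnj v"
  define r where "r = complex_of_real (1 / sqrt (real K + 1))"
  \<comment> \<open>A unit vector \<open>a\<close> with \<open>|Y a| = sqrt K\<close> has the form \<open>(1, sqrt K w) / sqrt (K + 1)\<close> with
    \<open>|w| = 1\<close>, up to a phase; the first component of \<open>X Y a = sqrt (K k) u\<^sup>2 a\<close> determines \<open>w\<close>.\<close>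
  define w where "w = (C * \<kappa> - (\<kappa> + \<iota> * v) / (C * Q)) / S"
  define w' where "w' = cnj w"
  have \<kappa>: "\<kappa>\<^sup>2 = P - 1" "\<iota>\<^sup>2 = Q - 1"
    unfolding defs by (simp_all flip: of_real_power)
  have vv': "v * v' = 1"
    using u unfolding defs by (simp add: power2_eq_square) (metis mult.assoc mult.left_commute mult_1_right)
  have "s\<^sup>2 = 1 - c\<^sup>2" using cs by simp
  then have "complex_of_real (s\<^sup>2) = complex_of_real (1 - c\<^sup>2)" by simp
  then have CS: "C \<noteq> 0" "S \<noteq> 0" "S\<^sup>2 = 1 - C\<^sup>2"
    using cs by (simp_all add: defs)
  have PQ: "P \<noteq> 0" "Q \<noteq> 0"
    unfolding defs by (metis of_nat_Suc of_nat_eq_0_iff add.commute nat.distinct(1))+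
  have r: "r\<^sup>2 * P = 1" "cnj r = r"
  proof -
    have "(1 / sqrt (real K + 1))\<^sup>2 * (real K + 1) = 1" by (simp add: power_divide)
    then have "complex_of_real ((1 / sqrt (real K + 1))\<^sup>2 * (real K + 1)) = 1" by simp
    then show "r\<^sup>2 * P = 1" by (simp add: r_def defs)
  qed (simp add: r_def)
  have tr': "\<iota> * \<kappa> * (v + v') = P * Q * C\<^sup>2 - P - Q + 2"
  proof -
    have "v + v' = of_real (Re (2 * u\<^sup>2))"
      unfolding defs complex_add_cnj by simp
    then have "\<iota> * \<kappa> * (v + v') = of_real (sqrt K * sqrt k * Re (2 * u\<^sup>2))"
      by (simp add: defs)
    then show ?thesis unfolding tr by (simp add: defs algebra_simps)
  qed
  have cnjs: "cnj \<kappa> = \<kappa>" "cnj \<iota> = \<iota>" "cnj C = C" "cnj S = S" "cnj Q = Q" "cnj v = v'"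
    by (simp_all add: defs)
  have Qcs: "Q * C * S * w = (Q * C\<^sup>2 - 1) * \<kappa> - \<iota> * v"
    using CS PQ by (simp add: w_def field_simps power2_eq_square)
  have Qcs': "Q * C * S * w' = (Q * C\<^sup>2 - 1) * \<kappa> - \<iota> * v'"
    using arg_cong[OF Qcs, of cnj] by (simp add: w'_def cnjs)
  \<comment> \<open>Here the trace hypothesis makes the solution \<open>w\<close> of the first row
    have modulus 1.\<close>
  have ww': "w * w' = 1"
  proof -
    have "(Q * C * S)\<^sup>2 * (w * w') = (Q * C * S)\<^sup>2"
    proof -
      have "(Q * C * S)\<^sup>2 * (w * w') = (Q * C * S * w) * (Q * C * S * w')"
        by (simp add: power2_eq_square)
      also have "\<dots> = ((Q * C\<^sup>2 - 1) * \<kappa> - \<iota> * v) * ((Q * C\<^sup>2 - 1) * \<kappa> - \<iota> * v')"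
        by (simp only: Qcs Qcs')
      also have "\<dots> = (Q * C\<^sup>2 - 1)\<^sup>2 * \<kappa>\<^sup>2 - (Q * C\<^sup>2 - 1) * (\<iota> * \<kappa> * (v + v')) + \<iota>\<^sup>2 * (v * v')"
        by Groebner_Basis.algebra
      also have "\<dots> = (Q * C * S)\<^sup>2"
        unfolding tr' \<kappa> vv' using CS(3) by Groebner_Basis.algebra
      finally show ?thesis .
    qed
    then show ?thesis using CS PQ by simp
  qed
  \<comment> \<open>The second row of the eigenvector equation for \<open>X Y\<close>, with a factor
    \<open>\<kappa>\<close> cancelled.\<close>
  have X2: "Q * C * S * \<kappa> - (Q * S\<^sup>2 - 1) * w = \<iota> * v * \<kappa> * w"
  proof -
    have "(Q * C * S) * (Q * C * S * \<kappa> - (Q * S\<^sup>2 - 1) * w - \<iota> * v * \<kappa> * w) = 0"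
      using Qcs CS(3) \<kappa> tr' vv' by Groebner_Basis.algebra
    then show ?thesis using CS PQ by simp
  qed
  \<comment> \<open>\<open>X3\<close> and \<open>X4\<close> are the two rows of
    \<open>X a1 = (k - 1) a1 + sqrt k * cnj u * a2\<close>, up to the factor
    \<open>r\<close>.\<close>
  have X3: "(Q * C\<^sup>2 - 1) + Q * C * S * \<kappa> * w = Q - 2 + \<iota> * v' * \<kappa>"
    using Qcs \<kappa> tr' by Groebner_Basis.algebra
  have X4: "Q * C * S + (Q * S\<^sup>2 - 1) * \<kappa> * w = (Q - 2) * \<kappa> * w - \<iota> * v' * w"
    using X2 Qcs' ww' \<kappa> tr' by Groebner_Basis.algebra
  have uu: "u * cnj u = 1" "cnj u * u = 1" using u by (simp_all add: mult.commute)
  have v: "v = u * u" "v' = cnj u * cnj u" by (simp_all add: defs power2_eq_square)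
  have re: "of_real ((real k + 1) * c\<^sup>2 - 1) = Q * C\<^sup>2 - 1" "of_real ((real k + 1) * c * s) = Q * C * S"
    "of_real ((real k + 1) * s\<^sup>2 - 1) = Q * S\<^sup>2 - 1" "of_nat K = P - 1" "of_nat k = Q - 1"
    by (simp_all add: defs)
  have cw: "cnj w = w'" by (simp add: w'_def)
  show ?thesis
    unfolding schur_pair_def re defs(1,2)[symmetric]
  proof (intro exI conjI)
    \<comment> \<open>The witnesses are schematic and get fixed by the first goals:
      \<open>a1\<close> is \<open>r\<close> times \<open>(1, \<kappa> w)\<close> and
      \<open>a2\<close> is \<open>cnj u * r\<close> times \<open>(\<kappa>, - w)\<close>. The norm
      identities recur because \<open>b1 = a2\<close> and \<open>b2 = a1\<close>.\<close>
    show "r * cnj r + (r * \<kappa> * w) * cnj (r * \<kappa> * w) = 1"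
      unfolding complex_cnj_mult r(2) cnjs cw using r(1) \<kappa> ww' by Groebner_Basis.algebra
    show "(cnj u * r * \<kappa>) * cnj (cnj u * r * \<kappa>) + (- cnj u * r * w) * cnj (- cnj u * r * w) = 1"
      unfolding complex_cnj_mult complex_cnj_minus complex_cnj_cnj r(2) cnjs cw
      using r(1) \<kappa> ww' uu by Groebner_Basis.algebra
    then show "(cnj u * r * \<kappa>) * cnj (cnj u * r * \<kappa>) + (- cnj u * r * w) * cnj (- cnj u * r * w) = 1" .
    show "r * cnj (cnj u * r * \<kappa>) + (r * \<kappa> * w) * cnj (- cnj u * r * w) = 0"
      unfolding complex_cnj_mult complex_cnj_minus complex_cnj_cnj r(2) cnjs cw
      using ww' by Groebner_Basis.algebra
    show "r * cnj r + (r * \<kappa> * w) * cnj (r * \<kappa> * w) = 1"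
      unfolding complex_cnj_mult r(2) cnjs cw using r(1) \<kappa> ww' by Groebner_Basis.algebra
    show "(cnj u * r * \<kappa>) * cnj r + (- cnj u * r * w) * cnj (r * \<kappa> * w) = 0"
      unfolding complex_cnj_mult complex_cnj_minus complex_cnj_cnj r(2) cnjs cw
      using ww' by Groebner_Basis.algebra
    show "(P - 1) * r = \<kappa> * u * (cnj u * r * \<kappa>)" using \<kappa> uu by Groebner_Basis.algebra
    show "- (r * \<kappa> * w) = \<kappa> * u * (- cnj u * r * w)" using uu by Groebner_Basis.algebra
    show "(P - 1) * (cnj u * r * \<kappa>) = (P - 1 - 1) * (cnj u * r * \<kappa>) + \<kappa> * cnj u * r" by Groebner_Basis.algebra
    show "- (- cnj u * r * w) = (P - 1 - 1) * (- cnj u * r * w) + \<kappa> * cnj u * (r * \<kappa> * w)"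
      using \<kappa> by Groebner_Basis.algebra
    show "(Q * C\<^sup>2 - 1) * (cnj u * r * \<kappa>) + Q * C * S * (- cnj u * r * w) = \<iota> * u * r"
      using Qcs uu v by Groebner_Basis.algebra
    show "Q * C * S * (cnj u * r * \<kappa>) + (Q * S\<^sup>2 - 1) * (- cnj u * r * w) = \<iota> * u * (r * \<kappa> * w)"
      using X2 uu v by Groebner_Basis.algebra
    show "(Q * C\<^sup>2 - 1) * r + Q * C * S * (r * \<kappa> * w) = (Q - 1 - 1) * r + \<iota> * cnj u * (cnj u * r * \<kappa>)"
      using X3 v by Groebner_Basis.algebra
    show "Q * C * S * r + (Q * S\<^sup>2 - 1) * (r * \<kappa> * w)
        = (Q - 1 - 1) * (r * \<kappa> * w) + \<iota> * cnj u * (- cnj u * r * w)"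
      using X4 v by Groebner_Basis.algebra
  qed
qed

text \<open>Multiplying \<open>b1\<close> and \<open>b2\<close> by phases rotates the columns of
  \<open>X\<close> and, conjugately, the rows of \<open>Y\<close>. This freedom gives a real
  triangular form the arguments of the two mu.\<close>

lemma schur_pair_rotate:
  assumes "schur_pair K k c s x1 x12 x2 y1 y12 y2" and t1: "t1 * cnj t1 = 1" and t2: "t2 * cnj t2 = 1"
  shows "schur_pair K k c s (t1 * x1) (t2 * x12) (t2 * x2) (y1 * cnj t1) (y12 * cnj t1) (y2 * cnj t2)"
proof -
  obtain a1 a1' a2 a2' b1 b1' b2 b2' :: complex where
    a: "a1 * cnj a1 + a1' * cnj a1' = 1" "a2 * cnj a2 + a2' * cnj a2' = 1"
      "a1 * cnj a2 + a1' * cnj a2' = 0"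
    and b: "b1 * cnj b1 + b1' * cnj b1' = 1" "b2 * cnj b2 + b2' * cnj b2' = 1"
      "b1 * cnj b2 + b1' * cnj b2' = 0"
    and y: "of_nat K * a1 = y1 * b1" "- a1' = y1 * b1'"
      "of_nat K * a2 = y12 * b1 + y2 * b2" "- a2' = y12 * b1' + y2 * b2'"
    and x: "of_real ((real k + 1) * c\<^sup>2 - 1) * b1 + of_real ((real k + 1) * c * s) * b1' = x1 * a1"
      "of_real ((real k + 1) * c * s) * b1 + of_real ((real k + 1) * s\<^sup>2 - 1) * b1' = x1 * a1'"
      "of_real ((real k + 1) * c\<^sup>2 - 1) * b2 + of_real ((real k + 1) * c * s) * b2' = x12 * a1 + x2 * a2"
      "of_real ((real k + 1) * c * s) * b2 + of_real ((real k + 1) * s\<^sup>2 - 1) * b2' = x12 * a1' + x2 * a2'"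
    using assms(1) unfolding schur_pair_def by blast
  show ?thesis
    unfolding schur_pair_def
  proof (rule exI[of _ a1], rule exI[of _ a1'], rule exI[of _ a2], rule exI[of _ a2'],
      rule exI[of _ "t1 * b1"], rule exI[of _ "t1 * b1'"], rule exI[of _ "t2 * b2"],
      rule exI[of _ "t2 * b2'"], unfold complex_cnj_mult, intro conjI)
    show "(t1 * b1) * (cnj t1 * cnj b1) + (t1 * b1') * (cnj t1 * cnj b1') = 1"
      using b t1 by Groebner_Basis.algebra
    show "(t2 * b2) * (cnj t2 * cnj b2) + (t2 * b2') * (cnj t2 * cnj b2') = 1"
      using b t2 by Groebner_Basis.algebra
    show "(t1 * b1) * (cnj t2 * cnj b2) + (t1 * b1') * (cnj t2 * cnj b2') = 0"
      using b by Groebner_Basis.algebra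
    show "of_nat K * a1 = y1 * cnj t1 * (t1 * b1)" "- a1' = y1 * cnj t1 * (t1 * b1')"
      using y t1 by Groebner_Basis.algebra+
    show "of_nat K * a2 = y12 * cnj t1 * (t1 * b1) + y2 * cnj t2 * (t2 * b2)"
      "- a2' = y12 * cnj t1 * (t1 * b1') + y2 * cnj t2 * (t2 * b2')"
      using y t1 t2 by Groebner_Basis.algebra+
    show "of_real ((real k + 1) * c\<^sup>2 - 1) * (t1 * b1) + of_real ((real k + 1) * c * s) * (t1 * b1')
        = t1 * x1 * a1"
      "of_real ((real k + 1) * c * s) * (t1 * b1) + of_real ((real k + 1) * s\<^sup>2 - 1) * (t1 * b1')
        = t1 * x1 * a1'"
      "of_real ((real k + 1) * c\<^sup>2 - 1) * (t2 * b2) + of_real ((real k + 1) * c * s) * (t2 * b2')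
        = t2 * x12 * a1 + t2 * x2 * a2"
      "of_real ((real k + 1) * c * s) * (t2 * b2) + of_real ((real k + 1) * s\<^sup>2 - 1) * (t2 * b2')
        = t2 * x12 * a1' + t2 * x2 * a2'"
      using x by Groebner_Basis.algebra+
  qed (fact a)+
qed

lemma le_of_square_sum: "x\<^sup>2 + z\<^sup>2 \<le> y\<^sup>2 \<Longrightarrow> 0 \<le> y \<Longrightarrow> \<bar>x\<bar> \<le> (y :: real)"
  by (rule power2_le_imp_le) (auto intro: order_trans[rotated])

text \<open>Coordinates of the vector \<open>(u, v)\<close> in the orthonormal basis
  \<open>(x, y)\<close>, \<open>(-y, x)\<close>, and Pythagoras for them.\<close>

lemma rotation_expansion:
  fixes x y u v :: real
  assumes "x\<^sup>2 + y\<^sup>2 = 1"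
  shows "u = (u * x + v * y) * x + (- u * y + v * x) * (- y)"
    and "v = (u * x + v * y) * y + (- u * y + v * x) * x"
    and "(u * x + v * y)\<^sup>2 + (- u * y + v * x)\<^sup>2 = u\<^sup>2 + v\<^sup>2"
  using assms by Groebner_Basis.algebra+

lemma schur_pair_of_real:
  fixes a1 a1' a2 a2' b1 b1' b2 b2' :: real
  assumes "a1 * a1 + a1' * a1' = 1" "a2 * a2 + a2' * a2' = 1" "a1 * a2 + a1' * a2' = 0"
    "b1 * b1 + b1' * b1' = 1" "b2 * b2 + b2' * b2' = 1" "b1 * b2 + b1' * b2' = 0"
    "real K * a1 = y1 * b1" "- a1' = y1 * b1'"
    "real K * a2 = y12 * b1 + y2 * b2" "- a2' = y12 * b1' + y2 * b2'"
    "((real k + 1) * c\<^sup>2 - 1) * b1 + ((real k + 1) * c * s) * b1' = x1 * a1"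
    "((real k + 1) * c * s) * b1 + ((real k + 1) * s\<^sup>2 - 1) * b1' = x1 * a1'"
    "((real k + 1) * c\<^sup>2 - 1) * b2 + ((real k + 1) * c * s) * b2' = x12 * a1 + x2 * a2"
    "((real k + 1) * c * s) * b2 + ((real k + 1) * s\<^sup>2 - 1) * b2' = x12 * a1' + x2 * a2'"
  shows "schur_pair K k c s (of_real x1) (of_real x12) (of_real x2) (of_real y1) (of_real y12) (of_real y2)"
  unfolding schur_pair_def
  by (rule exI[of _ "of_real a1"], rule exI[of _ "of_real a1'"], rule exI[of _ "of_real a2"],
      rule exI[of _ "of_real a2'"], rule exI[of _ "of_real b1"], rule exI[of _ "of_real b1'"],
      rule exI[of _ "of_real b2"], rule exI[of _ "of_real b2'"])
    (use assms[THEN arg_cong[where f = complex_of_real]] in simp)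

text \<open>Here all vectors can be real: \<open>a1 = (x, y)\<close> is a unit eigenvector of
  \<open>X Y\<close> for \<open>r1\<close>, \<open>\<eta>\<close> is the norm of
  \<open>Y a1\<close>, \<open>b1\<close> is \<open>Y a1 / \<eta>\<close>, and \<open>a2\<close>,
  \<open>b2\<close> are quarter turns of \<open>a1\<close>, \<open>b1\<close>. The second diagonal
  entries follow from \<open>det X = -k\<close> and \<open>det Y = -K\<close>. The bounds hold
  because \<open>X\<close> has norm \<open>k\<close>, \<open>Y\<close> has norm \<open>K\<close>,
  and \<open>Y\<close> shrinks no vector.\<close>

lemma schur_pair_real:
  fixes r1 :: real
  assumes cs: "c > 0" "s > 0" "c\<^sup>2 + s\<^sup>2 = 1" and k: "k \<ge> 1" "k < K"
    and r: "r1 + r2 = c\<^sup>2 * (real K + 1) * (real k + 1) - K - k" "r1 * r2 = real K * real k"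
  obtains \<eta> \<gamma> \<delta> :: real where "1 \<le> \<eta>" "\<eta> \<le> K" "\<bar>r1\<bar> \<le> k * \<eta>" "\<bar>r2\<bar> * \<eta> \<le> real K * real k"
    "\<bar>\<gamma>\<bar> \<le> k" "\<bar>\<delta>\<bar> \<le> K"
    "schur_pair K k c s (of_real (r1 / \<eta>)) (of_real \<gamma>) (of_real (- r2 * \<eta> / K))
       (of_real \<eta>) (of_real \<delta>) (of_real (- real K / \<eta>))"
proof -
  define P Q A C D where
    defs: "P = real K + 1" "Q = real k + 1" "A = Q * c\<^sup>2 - 1" "C = Q * c * s" "D = Q * s\<^sup>2 - 1"
  have kK: "0 < real k" "0 < real K" "1 \<le> real K" "real k \<le> real K" "1 \<le> real k" using k by auto
  have "C > 0" using cs kK by (simp add: defs)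
  have AD: "A + D = Q - 2" "A * D - C * C = 1 - Q"
    using cs(3) unfolding defs by Groebner_Basis.algebra+
  have tr: "r1 + r2 = (P - 1) * A - D" "r1 * r2 = (P - 1) * (Q - 1)"
    using r cs(3) unfolding defs by Groebner_Basis.algebra+
  \<comment> \<open>\<open>(x0, y0)\<close> is an eigenvector of \<open>X Y\<close> for \<open>r1\<close>.\<close>
  define x0 y0 where "x0 = C" and "y0 = (P - 1) * A - r1"
  define n where "n = sqrt (x0\<^sup>2 + y0\<^sup>2)"
  have "0 < x0\<^sup>2 + y0\<^sup>2" using \<open>C > 0\<close> by (simp add: x0_def add_pos_nonneg)
  then have n: "n > 0" "n\<^sup>2 = x0\<^sup>2 + y0\<^sup>2" by (simp_all add: n_def)
  define x y where "x = x0 / n" and "y = y0 / n"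
  have xy: "x\<^sup>2 + y\<^sup>2 = 1"
    using n by (simp add: x_def y_def power_divide add_divide_distrib[symmetric] del: sum_power2_eq_zero_iff)
      (metis divide_self less_irrefl power_not_zero)
  have e1: "(P - 1) * A * x - C * y = r1 * x"
    unfolding x_def y_def using n(1) by (simp add: field_simps x0_def y0_def)
  \<comment> \<open>The first row holds by the choice of \<open>(x0, y0)\<close>; the second is the
    characteristic equation of \<open>X Y\<close> at \<open>r1\<close>.\<close>
  have "(P - 1) * C * x0 - D * y0 = r1 * y0"
    unfolding x0_def y0_def using tr AD by Groebner_Basis.algebra
  then have e2: "(P - 1) * C * x - D * y = r1 * y"
    unfolding x_def y_def using n(1) by (simp add: field_simps)
  define \<eta> where "\<eta> = sqrt ((P - 1)\<^sup>2 * x\<^sup>2 + y\<^sup>2)"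
  have P1: "1 \<le> (P - 1)\<^sup>2" using kK by (simp add: defs)
  have Pxy: "(P - 1)\<^sup>2 * x\<^sup>2 + (P - 1)\<^sup>2 * y\<^sup>2 = (P - 1)\<^sup>2"
    unfolding distrib_left[symmetric] xy by simp
  have sq1: "1 \<le> (P - 1)\<^sup>2 * x\<^sup>2 + y\<^sup>2"
    using mult_right_mono[OF P1, of "x\<^sup>2"] xy by simp
  then have \<eta>2: "\<eta>\<^sup>2 = (P - 1)\<^sup>2 * x\<^sup>2 + y\<^sup>2" by (simp add: \<eta>_def)
  have \<eta>1: "1 \<le> \<eta>" using sq1 by (simp add: \<eta>_def)
  have "\<eta>\<^sup>2 \<le> (P - 1)\<^sup>2"
    using mult_right_mono[OF P1, of "y\<^sup>2"] Pxy unfolding \<eta>2 by simp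
  then have \<eta>K: "\<eta> \<le> K" using kK by (simp add: defs power2_le_iff_abs_le)
  define b1 b1' b2 b2' where b: "b1 = (P - 1) * x / \<eta>" "b1' = - y / \<eta>" "b2 = y / \<eta>" "b2' = (P - 1) * x / \<eta>"
  have "b1\<^sup>2 + b1'\<^sup>2 = ((P - 1)\<^sup>2 * x\<^sup>2 + y\<^sup>2) / \<eta>\<^sup>2"
    by (simp add: b power_divide power_mult_distrib add_divide_distrib)
  then have bn: "b1\<^sup>2 + b1'\<^sup>2 = 1" "b2\<^sup>2 + b2'\<^sup>2 = 1"
    unfolding \<eta>2[symmetric] using \<eta>1 by (simp_all add: b add.commute)
  define \<delta> where "\<delta> = (P - 1) * (- y) * b1 + (- x) * b1'"
  define \<gamma> where "\<gamma> = (A * b2 + C * b2') * x + (C * b2 + D * b2') * y"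
  define x2 where "x2 = - r2 * \<eta> / (P - 1)"
  \<comment> \<open>The coordinate of \<open>Y a2\<close> along \<open>b2\<close>: both bases are
    rotations of the standard one, so the diagonal entries of the triangular form multiply to
    \<open>det Y = -K\<close>.\<close>
  have "- ((P - 1) * (- y)) * b1' + (- x) * b1 = - ((P - 1) * (x\<^sup>2 + y\<^sup>2)) / \<eta>"
    unfolding b by (simp add: power2_eq_square diff_divide_distrib add_divide_distrib algebra_simps)
  then have Yt: "- ((P - 1) * (- y)) * b1' + (- x) * b1 = - (P - 1) / \<eta>"
    unfolding xy by simp
  have Y2: "(P - 1) * (- y) = \<delta> * b1 + (- (P - 1) / \<eta>) * b2"
    "- x = \<delta> * b1' + (- (P - 1) / \<eta>) * b2'"
  proof -
    show "(P - 1) * (- y) = \<delta> * b1 + (- (P - 1) / \<eta>) * b2"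
      using rotation_expansion(1)[OF bn(1), of "(P - 1) * (- y)" "- x"]
      unfolding Yt \<delta>_def[symmetric] by (simp add: b)
    show "- x = \<delta> * b1' + (- (P - 1) / \<eta>) * b2'"
      using rotation_expansion(2)[OF bn(1), of "- x" "(P - 1) * (- y)"]
      unfolding Yt \<delta>_def[symmetric] by (simp add: b)
  qed
  have r1: "r1 \<noteq> 0" and r2: "r2 \<noteq> 0" using r(2) kK by auto
  have X1: "A * b1 + C * b1' = r1 / \<eta> * x" "C * b1 + D * b1' = r1 / \<eta> * y"
    using e1 e2 \<eta>1 by (simp_all add: b field_simps)
  have X2: "A * b2 + C * b2' = \<gamma> * x + x2 * (- y)" "C * b2 + D * b2' = \<gamma> * y + x2 * x"
  proof -
    \<comment> \<open>The same determinant argument for \<open>X\<close>: \<open>r1 / \<eta>\<close>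
      times the second diagonal entry is \<open>det X = 1 - Q\<close>, written without
      division.\<close>
    have "r1 * (- (A * y + C * (P - 1) * x) * y + (C * y + D * (P - 1) * x) * x) = (1 - Q) * \<eta>\<^sup>2"
      unfolding \<eta>2 using e1 e2 AD(2) by Groebner_Basis.algebra
    moreover have "r1 * (\<eta> * x2) = (1 - Q) * \<eta>\<^sup>2"
      unfolding x2_def using tr(2) kK by (simp add: field_simps power2_eq_square defs)
    ultimately have "- (A * y + C * (P - 1) * x) * y + (C * y + D * (P - 1) * x) * x = \<eta> * x2"
      using r1 by (metis mult_left_cancel)
    moreover have "- (A * b2 + C * b2') * y + (C * b2 + D * b2') * x
        = (- (A * y + C * (P - 1) * x) * y + (C * y + D * (P - 1) * x) * x) / \<eta>"
      unfolding b by (simp add: diff_divide_distrib add_divide_distrib algebra_simps)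
    ultimately have *: "- (A * b2 + C * b2') * y + (C * b2 + D * b2') * x = x2"
      using \<eta>1 by simp
    show "A * b2 + C * b2' = \<gamma> * x + x2 * (- y)"
      using rotation_expansion(1)[OF xy, of "A * b2 + C * b2'" "C * b2 + D * b2'"]
      unfolding * \<gamma>_def[symmetric] .
    show "C * b2 + D * b2' = \<gamma> * y + x2 * x"
      using rotation_expansion(2)[OF xy, of "C * b2 + D * b2'" "A * b2 + C * b2'"]
      unfolding * \<gamma>_def[symmetric] .
  qed
  \<comment> \<open>\<open>X\<close> is symmetric with eigenvalue \<open>k\<close> along
    \<open>(c, s)\<close> and \<open>-1\<close> along \<open>(s, -c)\<close>; as
    \<open>k \<ge> 1\<close>, its norm is \<open>k\<close>.\<close>
  have normX: "(A * z + C * z')\<^sup>2 + (C * z + D * z')\<^sup>2 \<le> (real k)\<^sup>2" if "z\<^sup>2 + z'\<^sup>2 = 1" for z z'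
  proof -
    have "(A * z + C * z')\<^sup>2 + (C * z + D * z')\<^sup>2 = (Q - 1)\<^sup>2 * (c * z + s * z')\<^sup>2 + 1 * (s * z - c * z')\<^sup>2"
      unfolding defs using cs(3) by Groebner_Basis.algebra
    also have "\<dots> \<le> (Q - 1)\<^sup>2 * (c * z + s * z')\<^sup>2 + (Q - 1)\<^sup>2 * (s * z - c * z')\<^sup>2"
      using kK by (intro add_left_mono mult_right_mono) (simp_all add: defs)
    also have "\<dots> = (Q - 1)\<^sup>2" using cs(3) that by Groebner_Basis.algebra
    finally show ?thesis by (simp add: defs)
  qed
  have "(r1 / \<eta> * x)\<^sup>2 + (r1 / \<eta> * y)\<^sup>2 = (r1 / \<eta>)\<^sup>2 * (x\<^sup>2 + y\<^sup>2)"
    by (simp only: power_mult_distrib distrib_left)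
  then have "(r1 / \<eta>)\<^sup>2 + 0\<^sup>2 \<le> (real k)\<^sup>2"
    using normX[OF bn(1)] unfolding X1 xy by simp
  then have "\<bar>r1 / \<eta>\<bar> \<le> k" by (rule le_of_square_sum) simp
  then have B1: "\<bar>r1\<bar> \<le> k * \<eta>" using \<eta>1 by (simp add: abs_divide field_simps)
  have "(\<gamma> * x + x2 * (- y))\<^sup>2 + (\<gamma> * y + x2 * x)\<^sup>2 = \<gamma>\<^sup>2 + x2\<^sup>2"
    using xy by Groebner_Basis.algebra
  then have g: "\<gamma>\<^sup>2 + x2\<^sup>2 \<le> (real k)\<^sup>2"
    using normX[OF bn(2)] unfolding X2 by simp
  then have B3: "\<bar>\<gamma>\<bar> \<le> k" by (rule le_of_square_sum) simp
  have "\<bar>x2\<bar> \<le> k" using g by (intro le_of_square_sum[of _ \<gamma>]) (simp_all add: add.commute)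
  then have B2: "\<bar>r2\<bar> * \<eta> \<le> real K * real k"
    using \<eta>1 kK by (simp add: x2_def defs abs_mult field_simps)
  \<comment> \<open>\<open>\<delta>\<close> and \<open>-K / \<eta>\<close> are the coordinates of
    \<open>Y a2\<close>, whose norm is at most \<open>K\<close>.\<close>
  have "\<delta>\<^sup>2 + ((P - 1) / \<eta>)\<^sup>2 = (P - 1)\<^sup>2 * y\<^sup>2 + x\<^sup>2"
    using rotation_expansion(3)[OF bn(1), of "(P - 1) * (- y)" "- x"]
    unfolding Yt \<delta>_def[symmetric] by (simp add: power_mult_distrib power_divide power2_commute)
  also have "\<dots> \<le> (P - 1)\<^sup>2"
    using mult_right_mono[OF P1, of "x\<^sup>2"] Pxy by simp
  finally have B4: "\<bar>\<delta>\<bar> \<le> K" using le_of_square_sum[of \<delta> "(P - 1) / \<eta>" "real K"] by (simp add: defs)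
  have "schur_pair K k c s (of_real (r1 / \<eta>)) (of_real \<gamma>) (of_real (- r2 * \<eta> / K))
       (of_real \<eta>) (of_real \<delta>) (of_real (- real K / \<eta>))"
  proof (rule schur_pair_of_real[where ?a1.0 = x and a1' = y and ?a2.0 = "- y" and a2' = x
        and ?b1.0 = b1 and b1' = b1' and ?b2.0 = b2 and b2' = b2'])
    have K: "real K = P - 1" "real k + 1 = Q" by (simp_all add: defs)
    show "x * x + y * y = 1" using xy by (simp add: power2_eq_square)
    show "- y * - y + x * x = 1" using xy by (simp add: power2_eq_square)
    show "x * - y + y * x = 0" by simp
    show "b1 * b1 + b1' * b1' = 1" "b2 * b2 + b2' * b2' = 1" using bn by (simp_all add: power2_eq_square)
    show "b1 * b2 + b1' * b2' = 0" by (simp add: b)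
    show "real K * x = \<eta> * b1" "- y = \<eta> * b1'" using \<eta>1 by (simp_all add: b defs)
    show "real K * - y = \<delta> * b1 + (- real K / \<eta>) * b2" "- x = \<delta> * b1' + (- real K / \<eta>) * b2'"
      using Y2 unfolding K by simp_all
    show "((real k + 1) * c\<^sup>2 - 1) * b1 + ((real k + 1) * c * s) * b1' = r1 / \<eta> * x"
      "((real k + 1) * c * s) * b1 + ((real k + 1) * s\<^sup>2 - 1) * b1' = r1 / \<eta> * y"
      using X1 unfolding K defs(3-5) by simp_all
    show "((real k + 1) * c\<^sup>2 - 1) * b2 + ((real k + 1) * c * s) * b2' = \<gamma> * x + (- r2 * \<eta> / K) * - y"
      "((real k + 1) * c * s) * b2 + ((real k + 1) * s\<^sup>2 - 1) * b2' = \<gamma> * y + (- r2 * \<eta> / K) * x"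
      using X2 unfolding K defs(3-5) x2_def by simp_all
  qed
  with \<eta>1 \<eta>K B1 B2 B3 B4 show thesis by (rule that)
qed

section \<open>The square roots mu\<close>

lemma upper_sqrt_power2 [simp]: "(upper_sqrt z)\<^sup>2 = z"
  by (simp add: upper_sqrt_def)

lemma upper_sqrt_upper: "Im z \<ge> 0 \<Longrightarrow> upper_sqrt z = csqrt z"
  using complex_Re_le_cmod[of z]
  by (auto simp: upper_sqrt_def zero_le_mult_iff mult_less_0_iff sgn_if split: if_splits)

text \<open>For \<open>Im z > 0\<close> the principal root lies in the open first quadrant, so that
  of \<open>cnj z\<close> lies in the lower half plane and is negated. On the real axis this can
  fail, which is what singles out the endpoints of the tempered interval.\<close>

lemma upper_sqrt_cnj: "Im z > 0 \<Longrightarrow> upper_sqrt (cnj z) = - cnj (csqrt z)"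
proof -
  assume "Im z > 0"
  then have "(Re z)\<^sup>2 < (cmod z)\<^sup>2" by (simp add: cmod_power2)
  then have "Re z < cmod z" by (rule power2_less_imp_less) simp
  then show ?thesis
    using \<open>Im z > 0\<close> by (simp add: upper_sqrt_def complex_eq_iff)
qed

text \<open>The interval is where \<open>t^2 - (l^2 - K - k) t + K k\<close> has nonpositive
  discriminant. The condition \<open>k \<le> K\<close> keeps the left endpoint nonnegative, so that
  the inequalities can be squared.\<close>

lemma mem_tempered_iff:
  assumes "0 \<le> l" "k \<le> K"
  shows "l \<in> tempered_interval K k \<longleftrightarrow> (l\<^sup>2 - real K - real k)\<^sup>2 \<le> 4 * real K * real k"
proof -
  have sq: "(sqrt K - sqrt k)\<^sup>2 = K + k - 2 * (sqrt K * sqrt k)" "(sqrt K + sqrt k)\<^sup>2 = K + k + 2 * (sqrt K * sqrt k)"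
    by (simp_all add: power2_diff power2_sum)
  have "l \<in> tempered_interval K k \<longleftrightarrow> (sqrt K - sqrt k)\<^sup>2 \<le> l\<^sup>2 \<and> l\<^sup>2 \<le> (sqrt K + sqrt k)\<^sup>2"
    using assms by (simp add: tempered_interval_def power_mono_iff)
  also have "\<dots> \<longleftrightarrow> \<bar>l\<^sup>2 - real K - real k\<bar> \<le> 2 * (sqrt K * sqrt k)"
    unfolding sq by (simp add: abs_le_iff) linarith
  also have "\<dots> \<longleftrightarrow> (l\<^sup>2 - real K - real k)\<^sup>2 \<le> (2 * (sqrt K * sqrt k))\<^sup>2"
    using abs_le_square_iff[of "l\<^sup>2 - real K - real k" "2 * (sqrt K * sqrt k)"]
    by (simp only: abs_mult abs_numeral real_sqrt_abs2 abs_of_nonneg real_sqrt_ge_zero of_nat_0_le_iff)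
  also have "(2 * (sqrt K * sqrt k))\<^sup>2 = 4 * real K * real k"
    by (simp add: power_mult_distrib)
  finally show ?thesis .
qed

text \<open>The squares of the two mu are conjugate roots \<open>z\<close> and \<open>cnj z\<close>
  of modulus \<open>sqrt (K k)\<close>. In the interior the third claim is the choice of branch. At
  the endpoints \<open>z\<close> is real, and at the right one the sign in
  \<open>mu_minus_left\<close> makes the formula true.\<close>

lemma mu_tempered:
  assumes l: "0 < l" "l \<in> tempered_interval K k" and k: "k \<ge> 1" "k \<le> K"
  defines "x \<equiv> l\<^sup>2 - real K - real k"
  shows "Re ((mu_plus K k l)\<^sup>2) = x / 2"
    and "mu_plus K k l * cnj (mu_plus K k l) = of_real (sqrt K * sqrt k)"
    and "mu_minus_left K k l = - cnj (mu_plus K k l)"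
proof -
  define D where "D = sqrt (4 * real K * real k - x\<^sup>2)"
  define z where "z = Complex (x / 2) (D / 2)"
  have le: "x\<^sup>2 \<le> 4 * real K * real k" using mem_tempered_iff[of l k K] l k by (simp add: x_def)
  then have D: "D \<ge> 0" "D\<^sup>2 = 4 * real K * real k - x\<^sup>2" by (simp_all add: D_def)
  have "csqrt ((complex_of_real x)\<^sup>2 - 4 * of_nat K * of_nat k) = csqrt (of_real (x\<^sup>2 - 4 * real K * real k))"
    by simp
  also have "\<dots> = \<i> * of_real D"
    using le by (subst csqrt_of_real_nonpos) (simp_all add: D_def)
  finally have c: "csqrt ((complex_of_real x)\<^sup>2 - 4 * of_nat K * of_nat k) = \<i> * of_real D" .
  have p: "mu_plus K k l = csqrt z"
  proof -
    have "mu_plus K k l = upper_sqrt ((of_real x + \<i> * of_real D) / 2)"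
      unfolding mu_plus_def Let_def x_def[symmetric] c ..
    also have "(of_real x + \<i> * of_real D) / 2 = z" by (simp add: z_def complex_eq_iff)
    finally show ?thesis using D(1) by (simp add: upper_sqrt_upper z_def)
  qed
  have q: "mu_minus K k l = upper_sqrt (cnj z)"
  proof -
    have "mu_minus K k l = upper_sqrt ((of_real x - \<i> * of_real D) / 2)"
      unfolding mu_minus_def Let_def x_def[symmetric] c ..
    also have "(of_real x - \<i> * of_real D) / 2 = cnj z" by (simp add: z_def complex_eq_iff)
    finally show ?thesis .
  qed
  show "Re ((mu_plus K k l)\<^sup>2) = x / 2" by (simp add: p z_def)
  have "(cmod z)\<^sup>2 = real K * real k"
    using D(2) by (simp add: z_def cmod_power2 power_divide add_divide_distrib[symmetric])
  then have cz: "cmod z = sqrt K * sqrt k"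
    by (metis norm_ge_zero real_sqrt_mult real_sqrt_unique)
  have "(cmod (csqrt z))\<^sup>2 = cmod z" by (simp flip: norm_power)
  then show "mu_plus K k l * cnj (mu_plus K k l) = of_real (sqrt K * sqrt k)"
    unfolding p complex_norm_square[symmetric] cz[symmetric] by (simp flip: of_real_power)
  have end_sq: "x = 2 * (sqrt K * sqrt k)" if "l = sqrt K + sqrt k"
    unfolding x_def that by (simp add: power2_sum)
  show "mu_minus_left K k l = - cnj (mu_plus K k l)"
  proof (cases "D = 0")
    case False
    then have "Im z > 0" using D by (simp add: z_def)
    moreover have "l \<noteq> sqrt K + sqrt k"
    proof
      assume "l = sqrt K + sqrt k"
      from end_sq[OF this] have "x\<^sup>2 = 4 * real K * real k" by (simp add: power_mult_distrib)
      then show False using False D by simp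
    qed
    ultimately show ?thesis by (simp add: mu_minus_left_def q p upper_sqrt_cnj)
  next
    case True
    then have z: "z = of_real (x / 2)" "cnj z = z" by (simp_all add: z_def complex_eq_iff)
    have q': "mu_minus K k l = csqrt z" unfolding q z(2) by (simp add: upper_sqrt_upper z)
    show ?thesis
    proof (cases "l = sqrt K + sqrt k")
      case True
      then have "0 \<le> x / 2" using end_sq by simp
      then have "csqrt z = of_real (sqrt (x / 2))" unfolding z(1) by (rule csqrt_of_real)
      then show ?thesis unfolding mu_minus_left_def if_P[OF True] q' p by simp
    next
      case neq: False
      \<comment> \<open>With \<open>D = 0\<close> and \<open>l\<close> not the right endpoint,
        \<open>z\<close> is nonpositive; its root is then imaginary and equals minus its own
        conjugate.\<close>
      have "x \<le> 0"
      proof (rule ccontr)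
        assume "\<not> x \<le> 0"
        have "x\<^sup>2 = (2 * (sqrt K * sqrt k))\<^sup>2" using True D by (simp add: power_mult_distrib)
        then have "x = 2 * (sqrt K * sqrt k)"
          by (rule power2_eq_imp_eq) (use \<open>\<not> x \<le> 0\<close> in auto)
        then have "l\<^sup>2 = (sqrt K + sqrt k)\<^sup>2" by (simp add: x_def power2_sum)
        then show False using neq l by (simp add: power2_eq_iff_nonneg)
      qed
      then have "csqrt z = \<i> * of_real (sqrt (- x / 2))" unfolding z(1) by (simp add: csqrt_of_real_nonpos)
      then show ?thesis using neq by (simp add: mu_minus_left_def q' p)
    qed
  qed
qed

text \<open>The discriminant is positive, so the roots are real. Below the interval they are not
  positive and mu may be imaginary; hence the formulation through squares.\<close>

lemma mu_nontempered:
  assumes l: "0 < l" "l \<notin> tempered_interval K k" and k: "k \<le> K"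
  obtains r1 r2 where "(mu_plus K k l)\<^sup>2 = of_real r1" "(mu_minus K k l)\<^sup>2 = of_real r2"
    "r1 + r2 = l\<^sup>2 - real K - real k" "r1 * r2 = real K * real k"
proof -
  define x where "x = l\<^sup>2 - real K - real k"
  define D where "D = sqrt (x\<^sup>2 - 4 * real K * real k)"
  have le: "x\<^sup>2 > 4 * real K * real k" using mem_tempered_iff[of l k K] l k by (simp add: x_def)
  then have D: "D\<^sup>2 = x\<^sup>2 - 4 * real K * real k" by (simp add: D_def)
  have "csqrt ((complex_of_real x)\<^sup>2 - 4 * of_nat K * of_nat k) = csqrt (of_real (x\<^sup>2 - 4 * real K * real k))"
    by simp
  also have "\<dots> = of_real D"
    using le by (subst csqrt_of_real) (simp_all add: D_def)
  finally have c: "csqrt ((complex_of_real x)\<^sup>2 - 4 * of_nat K * of_nat k) = of_real D" .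
  show thesis
  proof (rule that)
    show "(mu_plus K k l)\<^sup>2 = of_real ((x + D) / 2)" "(mu_minus K k l)\<^sup>2 = of_real ((x - D) / 2)"
      unfolding mu_plus_def mu_minus_def Let_def x_def[symmetric] c by simp_all
    show "(x + D) / 2 + (x - D) / 2 = l\<^sup>2 - real K - real k" by (simp add: x_def field_simps)
    have "(x + D) / 2 * ((x - D) / 2) = (x\<^sup>2 - D\<^sup>2) / 4" by (simp add: power2_eq_square field_simps)
    then show "(x + D) / 2 * ((x - D) / 2) = real K * real k" by (simp add: D)
  qed
qed

lemma root4_square: "0 \<le> a \<Longrightarrow> root 4 (a\<^sup>2) = sqrt a"
  using real_root_mult_exp[of 2 2 "a\<^sup>2"] by (simp add: sqrt_def[symmetric])

text \<open>Write \<open>mu_plus = \<rho> u\<close> with \<open>\<rho>\<close> the fourth root of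
  \<open>K k\<close> and \<open>|u| = 1\<close>. The fourth roots in the block are tuned so that
  \<open>\<rho>\<close> times them is \<open>sqrt k\<close> and \<open>sqrt K\<close>, the moduli in
  \<open>schur_pair_tempered\<close>.\<close>

lemma schur_pair_mu_tempered:
  assumes cs: "c > 0" "s > 0" "c\<^sup>2 + s\<^sup>2 = 1" and k: "k \<ge> 1" "k < K"
    and l: "0 < l" "l\<^sup>2 = c\<^sup>2 * (real K + 1) * (real k + 1)" "l \<in> tempered_interval K k"
  defines "\<sigma> \<equiv> complex_of_real (root 4 (real k / real K))"
    and "\<tau> \<equiv> complex_of_real (root 4 (real K / real k))"
  shows "schur_pair K k c s (mu_plus K k l * \<sigma>) (of_nat k - 1) (- mu_minus_left K k l * \<sigma>)
     (mu_plus K k l * \<tau>) (of_nat K - 1) (- mu_minus_left K k l * \<tau>)"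
proof -
  note mu = mu_tempered[OF l(1,3) k(1) less_imp_le[OF k(2)]]
  define p where "p = mu_plus K k l"
  define \<rho> where "\<rho> = root 4 (real K * real k)"
  have \<rho>: "\<rho> > 0" using k by (simp add: \<rho>_def)
  have "\<rho>\<^sup>2 = root 4 ((real K * real k)\<^sup>2)" by (simp add: \<rho>_def real_root_power)
  then have \<rho>2: "\<rho>\<^sup>2 = sqrt K * sqrt k" by (simp add: root4_square real_sqrt_mult)
  have "\<rho> * root 4 (real k / real K) = root 4 ((real k)\<^sup>2)"
    unfolding \<rho>_def real_root_mult[symmetric] using k by (simp add: power2_eq_square)
  then have s: "\<rho> * root 4 (real k / real K) = sqrt k" by (simp add: root4_square)
  have "\<rho> * root 4 (real K / real k) = root 4 ((real K)\<^sup>2)"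
    unfolding \<rho>_def real_root_mult[symmetric] using k by (simp add: power2_eq_square)
  then have t: "\<rho> * root 4 (real K / real k) = sqrt K" by (simp add: root4_square)
  define u where "u = p / of_real \<rho>"
  have pu: "p = of_real \<rho> * u" "cnj p = of_real \<rho> * cnj u" using \<rho> by (simp_all add: u_def)
  have "u * cnj u = (p * cnj p) / of_real (\<rho>\<^sup>2)" by (simp add: u_def power2_eq_square)
  also have "\<dots> = 1" unfolding p_def mu(2) \<rho>2 using k by simp
  finally have u: "u * cnj u = 1" .
  have "u\<^sup>2 = p\<^sup>2 / of_real (\<rho>\<^sup>2)" by (simp add: u_def power_divide)
  then have "Re (u\<^sup>2) = Re (p\<^sup>2) / \<rho>\<^sup>2" by (simp only: Re_divide_of_real)
  then have "sqrt K * sqrt k * Re (2 * u\<^sup>2) = c\<^sup>2 * (real K + 1) * (real k + 1) - K - k"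
    unfolding p_def mu(1) l(2) \<rho>2 using k by simp
  from schur_pair_tempered[OF cs u this]
  have "schur_pair K k c s (of_real (sqrt k) * u) (of_nat k - 1) (of_real (sqrt k) * cnj u)
     (of_real (sqrt K) * u) (of_nat K - 1) (of_real (sqrt K) * cnj u)" .
  then show ?thesis
    unfolding mu(3) p_def[symmetric] pu \<sigma>_def \<tau>_def s[symmetric] t[symmetric] of_real_mult
    by (simp add: mult_ac)
qed

text \<open>The moduli of the diagonal entries in \<open>schur_pair_real\<close> dictate
  \<open>\<alpha> = |mu_plus| / \<eta>\<close> and \<open>\<beta> = |mu_minus| \<eta> / K\<close>:
  since \<open>|mu_plus|^2 = |r1|\<close>, both \<open>|r1| / \<eta> = |mu_plus| \<alpha>\<close>
  and \<open>\<eta> = |mu_plus| / \<alpha>\<close>, and likewise for \<open>\<beta>\<close>. The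
  phases \<open>t1\<close> and \<open>t2\<close> supply the arguments.\<close>

lemma schur_pair_mu_nontempered:
  assumes cs: "c > 0" "s > 0" "c\<^sup>2 + s\<^sup>2 = 1" and k: "k \<ge> 1" "k < K"
    and l: "0 < l" "l\<^sup>2 = c\<^sup>2 * (real K + 1) * (real k + 1)" "l \<notin> tempered_interval K k"
  obtains \<alpha> \<beta> \<gamma> \<delta> where "0 < \<alpha>" "\<alpha> \<le> real K" "0 < \<beta>" "\<beta> \<le> real K"
    "cmod \<gamma> \<le> real K" "cmod \<delta> \<le> real K"
    "schur_pair K k c s (mu_plus K k l * of_real \<alpha>) \<gamma> (mu_minus K k l * of_real \<beta>)
       (mu_plus K k l / of_real \<alpha>) \<delta> (mu_minus K k l / of_real \<beta>)"
proof -
  define p q where "p = mu_plus K k l" and "q = mu_minus K k l"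
  obtain r1 r2 where pq: "p\<^sup>2 = of_real r1" "q\<^sup>2 = of_real r2"
    and r: "r1 + r2 = l\<^sup>2 - real K - real k" "r1 * r2 = real K * real k"
    unfolding p_def q_def by (rule mu_nontempered[OF l(1,3) less_imp_le[OF k(2)]])
  have kK: "0 < real k" "0 < real K" "1 \<le> real K" "real k \<le> real K" "1 \<le> real k" using k by auto
  obtain \<eta> \<gamma> \<delta> :: real where b: "1 \<le> \<eta>" "\<eta> \<le> K" "\<bar>r1\<bar> \<le> k * \<eta>" "\<bar>r2\<bar> * \<eta> \<le> real K * real k"
    "\<bar>\<gamma>\<bar> \<le> k" "\<bar>\<delta>\<bar> \<le> K"
    and sp: "schur_pair K k c s (of_real (r1 / \<eta>)) (of_real \<gamma>) (of_real (- r2 * \<eta> / K))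
       (of_real \<eta>) (of_real \<delta>) (of_real (- real K / \<eta>))"
    by (rule schur_pair_real[OF cs k r[unfolded l(2)]])
  have r0: "r1 \<noteq> 0" "r2 \<noteq> 0" using r(2) kK by auto
  then have pq0: "p \<noteq> 0" "q \<noteq> 0" using pq by auto
  have np: "(cmod p)\<^sup>2 = \<bar>r1\<bar>" "(cmod q)\<^sup>2 = \<bar>r2\<bar>"
    using pq by (simp_all flip: norm_power)
  define \<alpha> \<beta> where "\<alpha> = cmod p / \<eta>" and "\<beta> = cmod q * \<eta> / K"
  \<comment> \<open>The sign in \<open>t2\<close> compensates the minus signs of
    \<open>- r2 * \<eta> / K\<close> and \<open>- K / \<eta>\<close>.\<close>
  define t1 t2 where "t1 = cnj p / of_real (cmod p)" and "t2 = - cnj q / of_real (cmod q)"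
  have cc: "p * cnj p = of_real ((cmod p)\<^sup>2)" "q * cnj q = of_real ((cmod q)\<^sup>2)"
    by (simp_all only: complex_norm_square)
  have nt: "cmod t1 = 1" "cmod t2 = 1" using pq0 by (simp_all add: t1_def t2_def norm_divide)
  have t: "t1 * cnj t1 = 1" "t2 * cnj t2 = 1"
    unfolding complex_norm_square[symmetric] nt by simp_all
  have "\<alpha>\<^sup>2 \<le> (real K)\<^sup>2"
  proof -
    have "\<alpha>\<^sup>2 = \<bar>r1\<bar> / \<eta>\<^sup>2" by (simp add: \<alpha>_def power_divide np)
    also have "\<dots> \<le> k * \<eta> / \<eta>\<^sup>2" using b by (intro divide_right_mono) auto
    also have "\<dots> = k / \<eta>" using b by (simp add: power2_eq_square)
    also have "\<dots> \<le> real k" using b mult_left_mono[of 1 \<eta> "real k"] by (simp add: field_simps)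
    also have "\<dots> \<le> (real K)\<^sup>2" using mult_mono[of 1 "real K" "real k" "real K"] kK by (simp add: power2_eq_square)
    finally show ?thesis .
  qed
  then have a: "\<alpha> \<le> real K" by (rule power2_le_imp_le) simp
  have "\<beta>\<^sup>2 \<le> (real K)\<^sup>2"
  proof -
    have "\<beta>\<^sup>2 = (cmod q)\<^sup>2 * \<eta>\<^sup>2 / (real K)\<^sup>2" by (simp add: \<beta>_def power_divide power_mult_distrib)
    also have "\<dots> = (\<bar>r2\<bar> * \<eta>) * \<eta> / (real K)\<^sup>2" by (simp add: np power2_eq_square[of \<eta>])
    also have "\<dots> \<le> (real K * real k) * real K / (real K)\<^sup>2"
      by (rule divide_right_mono, rule mult_mono) (use b in auto)
    also have "\<dots> = k" using kK by (simp add: power2_eq_square)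
    also have "\<dots> \<le> (real K)\<^sup>2" using mult_mono[of 1 "real K" "real k" "real K"] kK by (simp add: power2_eq_square)
    finally show ?thesis .
  qed
  then have b': "\<beta> \<le> real K" by (rule power2_le_imp_le) simp
  have pos: "0 < \<alpha>" "0 < \<beta>" using pq0 b kK by (simp_all add: \<alpha>_def \<beta>_def)
  have frac: "(a / b) * (y\<^sup>2 / c) = (y * a) * (y / (b * c))"
      "(- a / b) * (- (y\<^sup>2) * c / d) = (y * a) * (y * c / (b * d))"
    for a b c d y :: complex
    by (simp_all add: power2_eq_square mult_ac)
  have canc: "a\<^sup>2 * (y / (a * b)) = y * (a / b)" "a\<^sup>2 * (y * c / (a * b)) = y * (a * c / b)"
    if "a \<noteq> 0" for a b c y :: complex
    using that by (simp_all add: power2_eq_square)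
  have npq0: "complex_of_real (cmod p) \<noteq> 0" "complex_of_real (cmod q) \<noteq> 0"
    using pq0 by simp_all
  have e1: "t1 * of_real (r1 / \<eta>) = p * of_real \<alpha>"
    unfolding t1_def \<alpha>_def of_real_divide pq(1)[symmetric] frac cc of_real_power
    by (rule canc[OF npq0(1)])
  have e2: "t2 * of_real (- r2 * \<eta> / K) = q * of_real \<beta>"
    unfolding t2_def \<beta>_def of_real_divide of_real_mult of_real_minus pq(2)[symmetric] frac cc of_real_power
    by (rule canc[OF npq0(2)])
  have e3: "of_real \<eta> * cnj t1 = p / of_real \<alpha>"
    unfolding t1_def \<alpha>_def complex_cnj_divide complex_cnj_cnj complex_cnj_complex_of_real of_real_divide
    by (simp only: times_divide_eq_right divide_divide_eq_right mult.commute)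
  have frac': "(- a / e) * (- y / b) = y / (b * e / a)" for a b e y :: complex
    by (simp only: times_divide_times_eq minus_mult_minus divide_divide_eq_right mult.commute)
  have e4: "of_real (- real K / \<eta>) * cnj t2 = q / of_real \<beta>"
    unfolding t2_def \<beta>_def complex_cnj_divide complex_cnj_minus complex_cnj_cnj
      complex_cnj_complex_of_real of_real_divide of_real_minus of_real_mult by (rule frac')
  have "schur_pair K k c s (p * of_real \<alpha>) (t2 * of_real \<gamma>) (q * of_real \<beta>)
      (p / of_real \<alpha>) (of_real \<delta> * cnj t1) (q / of_real \<beta>)"
    using schur_pair_rotate[OF sp t] unfolding e1 e2 e3 e4 .
  moreover have "cmod (t2 * of_real \<gamma>) \<le> K" "cmod (of_real \<delta> * cnj t1) \<le> K"
    using b nt kK by (simp_all add: norm_mult)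
  ultimately show thesis
    using a b' pos unfolding p_def q_def by (intro that)
qed

section \<open>The blocks of orthogonal pairs of eigenfunctions\<close>

text \<open>The common shape of both kinds of 4-by-4 blocks. The first two basis functions live on
  the arcs leaving \<open>L\<close>, the last two on those leaving \<open>R\<close>; the triangular
  \<open>X\<close> stands in the upper right corner, the triangular \<open>Y\<close> in the lower
  left one.\<close>

definition schur_block ::
    "complex \<Rightarrow> complex \<Rightarrow> complex \<Rightarrow> complex \<Rightarrow> complex \<Rightarrow> complex \<Rightarrow> complex mat" where
  "schur_block x1 x12 x2 y1 y12 y2 = mat_of_rows_list 4
     [[0, 0, x1, x12], [0, 0, 0, x2], [y1, y12, 0, 0], [0, y2, 0, 0]]"

lemma block_tempered_eq:
  "block_tempered K k l =
     schur_block (mu_plus K k l * of_real (root 4 (real k / real K))) (of_nat k - 1)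
       (- mu_minus_left K k l * of_real (root 4 (real k / real K)))
       (mu_plus K k l * of_real (root 4 (real K / real k))) (of_nat K - 1)
       (- mu_minus_left K k l * of_real (root 4 (real K / real k)))"
  by (simp add: block_tempered_def schur_block_def Let_def)

lemma block_nontempered_eq:
  "block_nontempered K k l \<alpha> \<beta> \<gamma> \<delta> =
     schur_block (mu_plus K k l * of_real \<alpha>) \<gamma> (mu_minus K k l * of_real \<beta>)
       (mu_plus K k l / of_real \<alpha>) \<delta> (mu_minus K k l / of_real \<beta>)"
  by (simp add: block_nontempered_def schur_block_def Let_def)

lemma represents_2:
  "represents T [v0, v1] (mat_of_rows_list 2 [[a00, a01], [a10, a11]]) \<longleftrightarrow>
     T v0 = fun_scale a00 v0 + fun_scale a10 v1 \<and> T v1 = fun_scale a01 v0 + fun_scale a11 v1"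
  by (auto simp: represents_def mat_of_rows_list_def lessThan_Suc All_less_Suc
      numeral_2_eq_2 add_ac)

lemma represents_schur_block:
  assumes "T v0 = fun_scale y1 v2" "T v1 = fun_scale y12 v2 + fun_scale y2 v3"
    and "T v2 = fun_scale x1 v0" "T v3 = fun_scale x12 v0 + fun_scale x2 v1"
  shows "represents T [v0, v1, v2, v3] (schur_block x1 x12 x2 y1 y12 y2)"
  using assms
  by (simp add: represents_def schur_block_def mat_of_rows_list_def lessThan_Suc All_less_Suc
      numeral_eq_Suc add_ac)

context biregular_graph
begin

text \<open>One orientation of every undirected edge; reversal carries functions on it to functions
  on the complementary arcs.\<close>

definition E_LR :: "('a \<times> 'a) set" where
  "E_LR = {e \<in> E. fst e \<in> L}"

lemma L2_space_E_LR: "h \<in> L2_space E_LR \<Longrightarrow> h \<in> L2_space E"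
  by (auto simp: L2_space_def E_LR_def)

lemma mem_E_LR:
  "f \<in> L2_space L \<Longrightarrow> src f \<in> L2_space E_LR"
  "g \<in> L2_space R \<Longrightarrow> tgt g \<in> L2_space E_LR"
  using E_sides by (fastforce simp: L2_space_def E_LR_def src_def tgt_def)+

text \<open>\<open>src f\<close> and \<open>tgt g\<close> have norms \<open>sqrt (K + 1)\<close> and
  \<open>sqrt (k + 1)\<close> and inner product \<open>l\<close>, so \<open>c\<close> is the cosine
  of their angle, and \<open>s > 0\<close> because \<open>l\<close> is below the product of the
  norms. Gram-Schmidt gives \<open>\<sigma>\<close> and \<open>\<rho>\<close>; \<open>\<tau>\<close>
  and \<open>\<nu>\<close> are their reversals. The sums of \<open>\<rho>\<close> over the arcs out
  of a vertex vanish, hence the factor -1; normalised, \<open>src g\<close> and \<open>tgt g\<close>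
  both have coordinates \<open>(c, s)\<close>, hence the matrix \<open>X\<close>.\<close>

lemma mode_basis:
  assumes mode: "mode f g l" and unit: "L2_inner V f f = 1" "L2_inner V g g = 1"
    and l: "0 < l" "l < sqrt ((real K + 1) * (real k + 1))"
  obtains c s \<sigma> \<rho> \<tau> \<nu> where "0 < c" "0 < s" "c\<^sup>2 + s\<^sup>2 = 1"
    "l\<^sup>2 = c\<^sup>2 * (real K + 1) * (real k + 1)"
    "orthonormal E [\<sigma>, \<rho>, \<tau>, \<nu>]" "set [\<sigma>, \<rho>, \<tau>, \<nu>] \<subseteq> arc_span f g"
    "\<sigma> \<in> L2_space E_LR" "\<rho> \<in> L2_space E_LR"
    "src f \<in> cspace.span {\<sigma>, \<rho>}" "tgt g \<in> cspace.span {\<sigma>, \<rho>}"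
    "nb \<sigma> = fun_scale (of_nat K) \<tau>" "nb \<rho> = fun_scale (-1) \<nu>"
    "nb \<tau> = fun_scale (of_real ((real k + 1) * c\<^sup>2 - 1)) \<sigma> + fun_scale (of_real ((real k + 1) * c * s)) \<rho>"
    "nb \<nu> = fun_scale (of_real ((real k + 1) * c * s)) \<sigma> + fun_scale (of_real ((real k + 1) * s\<^sup>2 - 1)) \<rho>"
proof -
  have mem: "f \<in> L2_space L" "g \<in> L2_space R"
    and ad: "ad f = fun_scale (of_real l) g" "ad g = fun_scale (of_real l) f"
    using mode by (auto simp: mode_def)
  define p q where "p = sqrt (real K + 1)" and "q = sqrt (real k + 1)"
  have pq: "p > 0" "q > 0" "p\<^sup>2 = real K + 1" "q\<^sup>2 = real k + 1"
    by (simp_all add: p_def q_def)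
  define c where "c = l / (p * q)"
  define s where "s = sqrt (1 - c\<^sup>2)"
  have l': "l = c * p * q" using pq by (simp add: c_def)
  have "l < p * q" using l(2) by (simp add: p_def q_def real_sqrt_mult)
  then have c: "0 < c" "c < 1" using l(1) pq by (simp_all add: c_def)
  then have "c\<^sup>2 < 1" by (simp add: power_less_one_iff abs_square_less_1)
  then have s: "0 < s" "c\<^sup>2 + s\<^sup>2 = 1" by (simp_all add: s_def)
  have lsq: "l\<^sup>2 = c\<^sup>2 * (real K + 1) * (real k + 1)"
    by (simp only: l' power_mult_distrib pq)
  define C S ip iq p' q' si where
    defs: "C = complex_of_real c" "S = complex_of_real s" "ip = complex_of_real (1 / p)"
      "iq = complex_of_real (1 / q)" "p' = complex_of_real p" "q' = complex_of_real q"
      "si = complex_of_real (1 / s)"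
  have cnjs: "cnj C = C" "cnj S = S" "cnj ip = ip" "cnj iq = iq" "cnj si = si" by (simp_all add: defs)
  have rel: "ip * p' = 1" "iq * q' = 1" "si * S = 1" "p'\<^sup>2 = of_nat K + 1" "q'\<^sup>2 = of_nat k + 1"
    "C\<^sup>2 + S\<^sup>2 = 1" "complex_of_real l = C * p' * q'"
  proof -
    show "ip * p' = 1" "iq * q' = 1" "si * S = 1" using pq s by (simp_all add: defs)
    show "p'\<^sup>2 = of_nat K + 1" "q'\<^sup>2 = of_nat k + 1"
      using pq(3,4)[THEN arg_cong[where f = complex_of_real]] by (simp_all add: defs)
    show "C\<^sup>2 + S\<^sup>2 = 1"
      using s(2)[THEN arg_cong[where f = complex_of_real]] by (simp add: defs)
    show "complex_of_real l = C * p' * q'" by (simp add: l' defs)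
  qed
  define \<sigma> \<tau> where "\<sigma> = fun_scale ip (src f)" and "\<tau> = fun_scale ip (tgt f)"
  define \<rho> where "\<rho> = fun_scale si (fun_scale iq (tgt g) - fun_scale C \<sigma>)"
  define \<nu> where "\<nu> = fun_scale si (fun_scale iq (src g) - fun_scale C \<tau>)"
  note vdefs = \<sigma>_def \<tau>_def \<rho>_def \<nu>_def
  note exp = L2_inner_diff_left L2_inner_diff_right L2_inner_scale_left L2_inner_scale_right cnjs
  have gram:
    "L2_inner E (src f) (src f) = of_nat K + 1" "L2_inner E (tgt f) (tgt f) = of_nat K + 1"
    "L2_inner E (src g) (src g) = of_nat k + 1" "L2_inner E (tgt g) (tgt g) = of_nat k + 1"
    "L2_inner E (src f) (tgt g) = of_real l" "L2_inner E (tgt g) (src f) = of_real l"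
    "L2_inner E (src g) (tgt f) = of_real l" "L2_inner E (tgt f) (src g) = of_real l"
    "L2_inner E (src f) (tgt f) = 0" "L2_inner E (src f) (src g) = 0"
    "L2_inner E (tgt g) (tgt f) = 0" "L2_inner E (tgt g) (src g) = 0"
    by (simp_all add: inner_tgt_tgt inner_src_tgt inner_tgt_src inner_src_src_L inner_src_src_R
        mem ad L2_inner_scale_right inner_LR inner_RL unit)
  have "orthonormal E [\<sigma>, \<rho>, \<tau>, \<nu>]"
  proof -
    have "L2_inner E \<sigma> \<sigma> = 1" "L2_inner E \<tau> \<tau> = 1"
      unfolding vdefs exp gram using rel by Groebner_Basis.algebra+
    moreover have "L2_inner E \<sigma> \<rho> = 0" "L2_inner E \<tau> \<nu> = 0"
      unfolding vdefs exp gram using rel by Groebner_Basis.algebra+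
    moreover have "L2_inner E \<rho> \<rho> = 1" "L2_inner E \<nu> \<nu> = 1"
      unfolding vdefs exp gram using rel by Groebner_Basis.algebra+
    moreover have "L2_inner E \<sigma> \<tau> = 0" "L2_inner E \<sigma> \<nu> = 0" "L2_inner E \<rho> \<tau> = 0" "L2_inner E \<rho> \<nu> = 0"
      unfolding vdefs exp gram by simp_all
    ultimately show ?thesis by (simp add: orthonormal_def)
  qed
  moreover have "set [\<sigma>, \<rho>, \<tau>, \<nu>] \<subseteq> arc_span f g"
    unfolding vdefs using arc_span_base
    by (simp add: cspace.subspace_scale cspace.subspace_diff subspace_arc_span)
  moreover have "\<sigma> \<in> L2_space E_LR" "\<rho> \<in> L2_space E_LR"
    unfolding vdefs using mem_E_LR mem
    by (simp_all add: cspace.subspace_scale cspace.subspace_diff subspace_L2_space)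
  moreover have "src f \<in> cspace.span {\<sigma>, \<rho>}"
  proof -
    have "src f = fun_scale p' \<sigma>"
      unfolding vdefs cspace.scale_scale using rel(1) by (simp add: mult.commute)
    then show ?thesis by (simp add: cspace.span_scale cspace.span_base)
  qed
  moreover have "tgt g \<in> cspace.span {\<sigma>, \<rho>}"
  proof -
    have "tgt g = fun_scale q' (fun_scale C \<sigma> + fun_scale S \<rho>)"
    proof
      fix e
      show "tgt g e = fun_scale q' (fun_scale C \<sigma> + fun_scale S \<rho>) e"
        unfolding vdefs fun_scale_apply plus_fun_apply minus_apply using rel by Groebner_Basis.algebra
    qed
    moreover have "fun_scale q' (fun_scale C \<sigma> + fun_scale S \<rho>) \<in> cspace.span {\<sigma>, \<rho>}"
      by (intro cspace.span_scale cspace.span_add cspace.span_base) auto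
    ultimately show ?thesis by simp
  qed
  moreover
  note nbs = linear_op_diff[OF linear_nb] linear_op_scale[OF linear_nb] nb_src_L[OF mem(1)]
    nb_src_R[OF mem(2)] nb_tgt ad src_tgt_scale
  have re: "complex_of_real ((real k + 1) * c\<^sup>2 - 1) = (of_nat k + 1) * C\<^sup>2 - 1"
    "complex_of_real ((real k + 1) * c * s) = (of_nat k + 1) * C * S"
    "complex_of_real ((real k + 1) * s\<^sup>2 - 1) = (of_nat k + 1) * S\<^sup>2 - 1"
    by (simp_all add: defs)
  have "nb \<sigma> = fun_scale (of_nat K) \<tau>"
  proof
    fix e show "nb \<sigma> e = fun_scale (of_nat K) \<tau> e"
      unfolding vdefs nbs fun_scale_apply plus_fun_apply minus_apply by Groebner_Basis.algebra
  qed
  moreover have "nb \<rho> = fun_scale (-1) \<nu>"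
  proof
    fix e show "nb \<rho> e = fun_scale (-1) \<nu> e"
      unfolding vdefs nbs fun_scale_apply plus_fun_apply minus_apply rel(7)
      using rel(1-6) by Groebner_Basis.algebra
  qed
  moreover have "nb \<tau> = fun_scale (of_real ((real k + 1) * c\<^sup>2 - 1)) \<sigma> + fun_scale (of_real ((real k + 1) * c * s)) \<rho>"
  proof
    fix e show "nb \<tau> e = (fun_scale (of_real ((real k + 1) * c\<^sup>2 - 1)) \<sigma> + fun_scale (of_real ((real k + 1) * c * s)) \<rho>) e"
      unfolding vdefs nbs fun_scale_apply plus_fun_apply minus_apply rel(7) re
      using rel(1-6) by Groebner_Basis.algebra
  qed
  moreover have "nb \<nu> = fun_scale (of_real ((real k + 1) * c * s)) \<sigma> + fun_scale (of_real ((real k + 1) * s\<^sup>2 - 1)) \<rho>"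
  proof
    fix e show "nb \<nu> e = (fun_scale (of_real ((real k + 1) * c * s)) \<sigma> + fun_scale (of_real ((real k + 1) * s\<^sup>2 - 1)) \<rho>) e"
      unfolding vdefs nbs fun_scale_apply plus_fun_apply minus_apply rel(7) re
      using rel(1-6) by Groebner_Basis.algebra
  qed
  ultimately show thesis using c(1) s lsq that by simp
qed

text \<open>\<open>schur_pair\<close> supplies coordinate vectors: the \<open>a\<close> with respect
  to \<open>\<sigma>\<close>, \<open>\<rho>\<close> and the \<open>b\<close> with respect to
  \<open>\<tau>\<close>, \<open>\<nu>\<close>. Their orthonormality passes to the functions because
  these four are orthonormal.\<close>

lemma mode_schur_block:
  assumes "orthonormal E [\<sigma>, \<rho>, \<tau>, \<nu>]" "set [\<sigma>, \<rho>, \<tau>, \<nu>] \<subseteq> arc_span f g"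
    and nb: "nb \<sigma> = fun_scale (of_nat K) \<tau>" "nb \<rho> = fun_scale (-1) \<nu>"
      "nb \<tau> = fun_scale (of_real ((real k + 1) * c\<^sup>2 - 1)) \<sigma> + fun_scale (of_real ((real k + 1) * c * s)) \<rho>"
      "nb \<nu> = fun_scale (of_real ((real k + 1) * c * s)) \<sigma> + fun_scale (of_real ((real k + 1) * s\<^sup>2 - 1)) \<rho>"
    and "schur_pair K k c s x1 x12 x2 y1 y12 y2"
  obtains ws where "orthonormal E ws" "set ws \<subseteq> arc_span f g" "length ws = 4"
    "represents nb ws (schur_block x1 x12 x2 y1 y12 y2)"
proof -
  define A C D where
    "A = complex_of_real ((real k + 1) * c\<^sup>2 - 1)" "C = complex_of_real ((real k + 1) * c * s)"
    "D = complex_of_real ((real k + 1) * s\<^sup>2 - 1)"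
  note ACD = this
  obtain a1 a1' a2 a2' b1 b1' b2 b2' :: complex where
    a: "a1 * cnj a1 + a1' * cnj a1' = 1" "a2 * cnj a2 + a2' * cnj a2' = 1"
      "a1 * cnj a2 + a1' * cnj a2' = 0"
    and b: "b1 * cnj b1 + b1' * cnj b1' = 1" "b2 * cnj b2 + b2' * cnj b2' = 1"
      "b1 * cnj b2 + b1' * cnj b2' = 0"
    and y: "of_nat K * a1 = y1 * b1" "- a1' = y1 * b1'"
      "of_nat K * a2 = y12 * b1 + y2 * b2" "- a2' = y12 * b1' + y2 * b2'"
    and x: "A * b1 + C * b1' = x1 * a1" "C * b1 + D * b1' = x1 * a1'"
      "A * b2 + C * b2' = x12 * a1 + x2 * a2" "C * b2 + D * b2' = x12 * a1' + x2 * a2'"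
    using assms(7) unfolding schur_pair_def ACD by blast
  define v0 v1 v2 v3 where
    "v0 = fun_scale a1 \<sigma> + fun_scale a1' \<rho>" "v1 = fun_scale a2 \<sigma> + fun_scale a2' \<rho>"
    "v2 = fun_scale b1 \<tau> + fun_scale b1' \<nu>" "v3 = fun_scale b2 \<tau> + fun_scale b2' \<nu>"
  note v = this
  have ip: "L2_inner E \<sigma> \<sigma> = 1" "L2_inner E \<rho> \<rho> = 1" "L2_inner E \<tau> \<tau> = 1" "L2_inner E \<nu> \<nu> = 1"
    "L2_inner E \<sigma> \<rho> = 0" "L2_inner E \<sigma> \<tau> = 0" "L2_inner E \<sigma> \<nu> = 0"
    "L2_inner E \<rho> \<tau> = 0" "L2_inner E \<rho> \<nu> = 0" "L2_inner E \<tau> \<nu> = 0"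
    "L2_inner E \<rho> \<sigma> = 0" "L2_inner E \<nu> \<tau> = 0"
    using assms(1) by (auto simp: orthonormal_def L2_inner_zero_sym[of _ \<rho> \<sigma>] L2_inner_zero_sym[of _ \<nu> \<tau>])
  note exp = L2_inner_add_left L2_inner_add_right L2_inner_scale_left L2_inner_scale_right ip
  note nbs = linear_op_add[OF linear_nb] linear_op_scale[OF linear_nb] nb[folded ACD]
  have sub: "\<sigma> \<in> arc_span f g" "\<rho> \<in> arc_span f g" "\<tau> \<in> arc_span f g" "\<nu> \<in> arc_span f g"
    using assms(2) by auto
  show thesis
  proof (rule that[of "[v0, v1, v2, v3]"])
    show "orthonormal E [v0, v1, v2, v3]"
      using a b unfolding orthonormal_def v exp by (simp add: exp mult.commute)
    show "set [v0, v1, v2, v3] \<subseteq> arc_span f g"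
      using sub unfolding v by (simp add: comb_span subspace_arc_span)
    show "represents nb [v0, v1, v2, v3] (schur_block x1 x12 x2 y1 y12 y2)"
    proof (rule represents_schur_block; rule ext)
      fix e
      show "nb v0 e = fun_scale y1 v2 e"
        unfolding v nbs fun_scale_apply plus_fun_apply using y by Groebner_Basis.algebra
      show "nb v1 e = (fun_scale y12 v2 + fun_scale y2 v3) e"
        unfolding v nbs fun_scale_apply plus_fun_apply using y by Groebner_Basis.algebra
      show "nb v2 e = fun_scale x1 v0 e"
        unfolding v nbs fun_scale_apply plus_fun_apply using x by Groebner_Basis.algebra
      show "nb v3 e = (fun_scale x12 v0 + fun_scale x2 v1) e"
        unfolding v nbs fun_scale_apply plus_fun_apply using x by Groebner_Basis.algebra
    qed
  qed simp
qed

lemma mode_block: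
  assumes mode: "mode f g l" "L2_inner V f f = 1" "L2_inner V g g = 1"
    and l: "0 < l" "l < sqrt ((real K + 1) * (real k + 1))" and k: "k \<ge> 1" "k < K"
  obtains \<alpha> \<beta> \<gamma> \<delta> ws us where
    "l \<notin> tempered_interval K k \<longrightarrow> 0 < \<alpha> \<and> \<alpha> \<le> real K \<and> 0 < \<beta> \<and> \<beta> \<le> real K \<and>
       cmod \<gamma> \<le> real K \<and> cmod \<delta> \<le> real K"
    "orthonormal E ws" "set ws \<subseteq> arc_span f g" "length ws = 4"
    "represents nb ws (if l \<in> tempered_interval K k then block_tempered K k l
       else block_nontempered K k l \<alpha> \<beta> \<gamma> \<delta>)"
    "orthonormal E us" "set us \<subseteq> arc_span f g" "length us = 2" "set us \<subseteq> L2_space E_LR"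
    "src f \<in> cspace.span (set us)" "tgt g \<in> cspace.span (set us)"
proof -
  obtain c s \<sigma> \<rho> \<tau> \<nu> where cs: "0 < c" "0 < s" "c\<^sup>2 + s\<^sup>2 = 1"
    and lc: "l\<^sup>2 = c\<^sup>2 * (real K + 1) * (real k + 1)"
    and ortho: "orthonormal E [\<sigma>, \<rho>, \<tau>, \<nu>]" and sub: "set [\<sigma>, \<rho>, \<tau>, \<nu>] \<subseteq> arc_span f g"
    and LR: "\<sigma> \<in> L2_space E_LR" "\<rho> \<in> L2_space E_LR"
    and span: "src f \<in> cspace.span {\<sigma>, \<rho>}" "tgt g \<in> cspace.span {\<sigma>, \<rho>}"
    and nb: "nb \<sigma> = fun_scale (of_nat K) \<tau>" "nb \<rho> = fun_scale (-1) \<nu>"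
      "nb \<tau> = fun_scale (of_real ((real k + 1) * c\<^sup>2 - 1)) \<sigma> + fun_scale (of_real ((real k + 1) * c * s)) \<rho>"
      "nb \<nu> = fun_scale (of_real ((real k + 1) * c * s)) \<sigma> + fun_scale (of_real ((real k + 1) * s\<^sup>2 - 1)) \<rho>"
    using mode_basis[OF mode l] .
  have "orthonormal E [\<sigma>, \<rho>]" using ortho by (simp add: orthonormal_def)
  moreover have "set [\<sigma>, \<rho>] \<subseteq> arc_span f g" "set [\<sigma>, \<rho>] \<subseteq> L2_space E_LR" using sub LR by auto
  moreover have "src f \<in> cspace.span (set [\<sigma>, \<rho>])" "tgt g \<in> cspace.span (set [\<sigma>, \<rho>])"
    using span by auto
  moreover have "length [\<sigma>, \<rho>] = 2" by simp
  moreover note us = calculation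
  show thesis
  proof (cases "l \<in> tempered_interval K k")
    case True
    obtain ws where "orthonormal E ws" "set ws \<subseteq> arc_span f g" "length ws = 4"
      "represents nb ws (block_tempered K k l)"
      using mode_schur_block[OF ortho sub nb schur_pair_mu_tempered[OF cs k l(1) lc True]]
      unfolding block_tempered_eq .
    \<comment> \<open>Dummy parameters: in the tempered case the bounds are vacuous and the block
      does not contain them.\<close>
    then show thesis using that[of 1 1 0 0 ws "[\<sigma>, \<rho>]"] us True by auto
  next
    case False
    obtain \<alpha> \<beta> \<gamma> \<delta> where bounds: "0 < \<alpha>" "\<alpha> \<le> real K" "0 < \<beta>" "\<beta> \<le> real K"
      "cmod \<gamma> \<le> real K" "cmod \<delta> \<le> real K"
      and sp: "schur_pair K k c s (mu_plus K k l * of_real \<alpha>) \<gamma> (mu_minus K k l * of_real \<beta>)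
       (mu_plus K k l / of_real \<alpha>) \<delta> (mu_minus K k l / of_real \<beta>)"
      using schur_pair_mu_nontempered[OF cs k l(1) lc False] .
    obtain ws where "orthonormal E ws" "set ws \<subseteq> arc_span f g" "length ws = 4"
      "represents nb ws (block_nontempered K k l \<alpha> \<beta> \<gamma> \<delta>)"
      using mode_schur_block[OF ortho sub nb sp] unfolding block_nontempered_eq .
    then show thesis using that[of \<alpha> \<beta> \<gamma> \<delta> ws "[\<sigma>, \<rho>]"] us bounds False by auto
  qed
qed

text \<open>
  \<open>ws\<close> is a basis of the invariant space of the pair, and \<open>us\<close> one of its part on the arcs leaving
  \<open>L\<close>. The latter serves to choose the residual functions on those arcs and to count them.
\<close>

definition block_for :: "('a \<Rightarrow> complex) \<Rightarrow> ('a \<Rightarrow> complex) \<Rightarrow> complex mat \<Rightarrow> nat \<Rightarrow> bool" where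
  "block_for f g M n \<longleftrightarrow> (\<exists>l. mode f g l) \<and>
     (\<exists>ws us. orthonormal E ws \<and> set ws \<subseteq> arc_span f g \<and> length ws = 2 * n \<and> represents nb ws M \<and>
        orthonormal E us \<and> set us \<subseteq> arc_span f g \<and> length us = n \<and> set us \<subseteq> L2_space E_LR \<and>
        src f \<in> cspace.span (set us) \<and> tgt g \<in> cspace.span (set us))"

lemma block_for_mode:
  assumes mode: "mode f g l" "L2_inner V f f = 1" "L2_inner V g g = 1"
    and l: "0 < l" "l < sqrt ((real K + 1) * (real k + 1))" and k: "k \<ge> 1" "k < K"
  obtains \<alpha> \<beta> \<gamma> \<delta> where
    "l \<notin> tempered_interval K k \<longrightarrow> 0 < \<alpha> \<and> \<alpha> \<le> real K \<and> 0 < \<beta> \<and> \<beta> \<le> real K \<and>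
       cmod \<gamma> \<le> real K \<and> cmod \<delta> \<le> real K"
    "block_for f g (if l \<in> tempered_interval K k then block_tempered K k l
       else block_nontempered K k l \<alpha> \<beta> \<gamma> \<delta>) 2"
proof -
  obtain \<alpha> \<beta> \<gamma> \<delta> ws us where *: "l \<notin> tempered_interval K k \<longrightarrow> 0 < \<alpha> \<and> \<alpha> \<le> real K \<and> 0 < \<beta> \<and> \<beta> \<le> real K \<and>
       cmod \<gamma> \<le> real K \<and> cmod \<delta> \<le> real K"
    and "orthonormal E ws" "set ws \<subseteq> arc_span f g" "length ws = 4"
    "represents nb ws (if l \<in> tempered_interval K k then block_tempered K k l
       else block_nontempered K k l \<alpha> \<beta> \<gamma> \<delta>)"
    "orthonormal E us" "set us \<subseteq> arc_span f g" "length us = 2" "set us \<subseteq> L2_space E_LR"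
    "src f \<in> cspace.span (set us)" "tgt g \<in> cspace.span (set us)"
    by (rule mode_block[OF assms])
  then have "block_for f g (if l \<in> tempered_interval K k then block_tempered K k l
       else block_nontempered K k l \<alpha> \<beta> \<gamma> \<delta>) 2"
    unfolding block_for_def using mode(1)
    by - (rule conjI, rule exI[of _ l], assumption, rule exI[of _ ws], rule exI[of _ us], intro conjI; simp)
  with * show thesis by (rule that)
qed

text \<open>Equality in Cauchy-Schwarz: \<open>src f\<close> and \<open>tgt g\<close> have norms
  \<open>p\<close> and \<open>q\<close> and inner product \<open>p q\<close>, so their
  normalisations coincide and the arc space collapses to \<open>\<sigma>\<close> and
  \<open>\<tau>\<close>.\<close>

lemma block_for_top:
  assumes mode: "mode f g l" and unit: "L2_inner V f f = 1" "L2_inner V g g = 1"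
    and l: "l = sqrt ((real K + 1) * (real k + 1))"
  shows "block_for f g (block_trivial K k) 1"
proof -
  have mem: "f \<in> L2_space L" "g \<in> L2_space R"
    and ad: "ad f = fun_scale (of_real l) g" "ad g = fun_scale (of_real l) f"
    using mode by (auto simp: mode_def)
  define p q where "p = complex_of_real (sqrt (real K + 1))" and "q = complex_of_real (sqrt (real k + 1))"
  have pq: "p * p = of_nat K + 1" "q * q = of_nat k + 1"
    unfolding p_def q_def by (simp_all flip: of_real_mult)
  have pq0: "p \<noteq> 0" "q \<noteq> 0" by (simp_all add: p_def q_def)
  have lpq: "complex_of_real l = p * q"
    by (simp add: p_def q_def l real_sqrt_mult)
  have cn: "cnj p = p" "cnj q = q" by (simp_all add: p_def q_def)
  define \<sigma> \<tau> where "\<sigma> = fun_scale (1 / p) (src f)" and "\<tau> = fun_scale (1 / p) (tgt f)"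
  define w where "w = \<sigma> - fun_scale (1 / q) (tgt g)"
  have gram: "L2_inner E (src f) (src f) = p * p" "L2_inner E (tgt g) (tgt g) = q * q"
    "L2_inner E (src f) (tgt g) = p * q" "L2_inner E (tgt g) (src f) = p * q"
    "L2_inner E (tgt f) (tgt f) = p * p" "L2_inner E (src f) (tgt f) = 0"
    "L2_inner E (tgt f) (src f) = 0"
    by (simp_all add: inner_tgt_tgt inner_src_tgt inner_tgt_src inner_src_src_L inner_src_src_R
        mem ad L2_inner_scale_right inner_LR inner_RL unit pq flip: lpq)
  have "L2_inner E w w = 0"
    unfolding w_def \<sigma>_def L2_inner_diff_left L2_inner_diff_right L2_inner_scale_left L2_inner_scale_right
      gram complex_cnj_divide complex_cnj_one cn
    using pq0 by simp
  moreover have "w \<in> L2_space E"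
    unfolding w_def \<sigma>_def
    by (intro cspace.subspace_diff cspace.subspace_scale subspace_L2_space src_tgt_mem)
  ultimately have "w = 0" by (intro L2_inner_self_eq_0[OF finite_E])
  then have \<sigma>: "\<sigma> = fun_scale (1 / q) (tgt g)" unfolding w_def by (simp only: right_minus_eq)
  \<comment> \<open>Reversal turns the coincidence of \<open>src f\<close> and \<open>tgt g\<close>
    into that of \<open>tgt f\<close> and \<open>src g\<close>.\<close>
  have "\<tau> = flip \<sigma>" by (auto simp: \<sigma>_def \<tau>_def flip_def fun_eq_iff src_def tgt_def E_sym)
  also have "\<dots> = fun_scale (1 / q) (src g)"
    unfolding \<sigma> by (auto simp: flip_def fun_eq_iff src_def tgt_def E_sym)
  finally have \<tau>: "\<tau> = fun_scale (1 / q) (src g)" .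
  have nb: "nb \<sigma> = fun_scale (of_nat K) \<tau>" "nb \<tau> = fun_scale (of_nat k) \<sigma>"
    unfolding \<tau> \<sigma>_def linear_op_scale[OF linear_nb] nb_src_L[OF mem(1)] nb_src_R[OF mem(2)]
    by (simp_all only: \<tau>[symmetric] \<tau>_def[symmetric] \<sigma>[symmetric] \<sigma>_def[symmetric]
        cspace.scale_left_commute[of "1 / p"] cspace.scale_left_commute[of "1 / q"])
  have ip: "L2_inner E \<sigma> \<sigma> = 1" "L2_inner E \<tau> \<tau> = 1" "L2_inner E \<tau> \<sigma> = 0"
    unfolding \<sigma>_def \<tau>_def L2_inner_scale_left L2_inner_scale_right gram complex_cnj_divide complex_cnj_one cn
    using pq0 by simp_all
  have sub: "\<sigma> \<in> arc_span f g" "\<tau> \<in> arc_span f g"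
    unfolding \<sigma>_def \<tau>_def by (simp_all add: cspace.subspace_scale subspace_arc_span arc_span_base)
  have LR: "\<sigma> \<in> L2_space E_LR"
    unfolding \<sigma>_def using mem_E_LR mem by (simp add: cspace.subspace_scale subspace_L2_space)
  have "src f = fun_scale p \<sigma>" "tgt g = fun_scale q \<sigma>"
    using pq0 by (simp add: \<sigma>_def, simp add: \<sigma>)
  then have span: "src f \<in> cspace.span {\<sigma>}" "tgt g \<in> cspace.span {\<sigma>}"
    by (simp_all add: cspace.span_scale cspace.span_base)
  show ?thesis
    unfolding block_for_def
  \<comment> \<open>\<open>\<tau>\<close> comes first because \<open>K\<close>, the factor in
    \<open>nb \<sigma>\<close>, stands in the second column of the block.\<close>
  proof (rule conjI, rule exI[of _ l], rule mode, rule exI[of _ "[\<tau>, \<sigma>]"], rule exI[of _ "[\<sigma>]"],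
      intro conjI)
    show "represents nb [\<tau>, \<sigma>] (block_trivial K k)"
      unfolding block_trivial_def represents_2 using nb by simp
  qed (use ip sub LR span in \<open>simp_all add: orthonormal_def\<close>)
qed

text \<open>Only \<open>src f\<close> and \<open>tgt f\<close> remain, and \<open>B\<close> sends
  them to \<open>K\<close> times \<open>tgt f\<close> and to \<open>- src f\<close>. The phase
  \<open>-\<i>\<close> in \<open>\<tau>\<close> turns the sign into the factors \<open>\<i>\<close>
  of the block.\<close>

lemma block_for_excess_L:
  assumes f: "f \<in> L2_space L" "ad f = 0" and unit: "L2_inner V f f = 1"
  shows "block_for f 0 (block_excess_L K) 1"
proof -
  define p where "p = complex_of_real (sqrt (real K + 1))"
  have p: "p * p = of_nat K + 1" unfolding p_def by (simp flip: of_real_mult)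
  have p0: "p \<noteq> 0" "cnj p = p" by (simp_all add: p_def)
  define \<sigma> \<tau> where "\<sigma> = fun_scale (1 / p) (src f)" and "\<tau> = fun_scale (- \<i> * (1 / p)) (tgt f)"
  have gram: "L2_inner E (src f) (src f) = p * p" "L2_inner E (tgt f) (tgt f) = p * p"
    "L2_inner E (src f) (tgt f) = 0"
    by (simp_all add: inner_tgt_tgt inner_src_tgt inner_src_src_L f unit p)
  have ip: "L2_inner E \<sigma> \<sigma> = 1" "L2_inner E \<tau> \<tau> = 1" "L2_inner E \<sigma> \<tau> = 0"
    unfolding \<sigma>_def \<tau>_def L2_inner_scale_left L2_inner_scale_right gram
    using p0 by simp_all
  have ad0: "ad 0 = 0" by (rule linear_op_zero[OF linear_ad])
  have nb: "nb \<sigma> = fun_scale (\<i> * of_nat K) \<tau>" "nb \<tau> = fun_scale \<i> \<sigma>"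
    unfolding \<sigma>_def \<tau>_def linear_op_scale[OF linear_nb] nb_src_L[OF f(1)] nb_tgt f(2) src_tgt_zero
    by (auto simp: fun_eq_iff mult.left_commute mult.assoc)
  have mode: "mode f 0 0" using f by (simp add: mode_def ad0 L2_space_def)
  have sub: "\<sigma> \<in> arc_span f 0" "\<tau> \<in> arc_span f 0"
    unfolding \<sigma>_def \<tau>_def by (rule cspace.subspace_scale[OF subspace_arc_span], rule arc_span_base)+
  have LR: "\<sigma> \<in> L2_space E_LR"
    unfolding \<sigma>_def using mem_E_LR f by (simp add: cspace.subspace_scale subspace_L2_space)
  have "src f = fun_scale p \<sigma>" using p0 by (simp add: \<sigma>_def)
  then have span: "src f \<in> cspace.span {\<sigma>}" "tgt 0 \<in> cspace.span {\<sigma>}"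
    by (simp_all add: cspace.span_scale cspace.span_base src_tgt_zero cspace.span_zero)
  show ?thesis
    unfolding block_for_def
  proof (rule conjI, rule exI[of _ 0], rule mode, rule exI[of _ "[\<sigma>, \<tau>]"], rule exI[of _ "[\<sigma>]"],
      intro conjI)
    show "represents nb [\<sigma>, \<tau>] (block_excess_L K)"
      unfolding block_excess_L_def represents_2 using nb by simp
  qed (use ip sub LR span in \<open>simp_all add: orthonormal_def\<close>)
qed

text \<open>The mirror case. Here \<open>\<sigma>\<close> comes from \<open>tgt g\<close>, since on
  the arcs leaving \<open>L\<close> a function on \<open>R\<close> is read at the target.\<close>

lemma block_for_excess_R:
  assumes g: "g \<in> L2_space R" "ad g = 0" and unit: "L2_inner V g g = 1"
  shows "block_for 0 g (block_excess_R k) 1"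
proof -
  define q where "q = complex_of_real (sqrt (real k + 1))"
  have q: "q * q = of_nat k + 1" unfolding q_def by (simp flip: of_real_mult)
  have q0: "q \<noteq> 0" "cnj q = q" by (simp_all add: q_def)
  define \<sigma> \<tau> where "\<sigma> = fun_scale (1 / q) (tgt g)" and "\<tau> = fun_scale (\<i> * (1 / q)) (src g)"
  have gram: "L2_inner E (src g) (src g) = q * q" "L2_inner E (tgt g) (tgt g) = q * q"
    "L2_inner E (tgt g) (src g) = 0"
    by (simp_all add: inner_tgt_tgt inner_tgt_src inner_src_src_R g unit q)
  have ip: "L2_inner E \<sigma> \<sigma> = 1" "L2_inner E \<tau> \<tau> = 1" "L2_inner E \<sigma> \<tau> = 0"
    unfolding \<sigma>_def \<tau>_def L2_inner_scale_left L2_inner_scale_right gram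
    using q0 by simp_all
  have ad0: "ad 0 = 0" by (rule linear_op_zero[OF linear_ad])
  have nb: "nb \<sigma> = fun_scale \<i> \<tau>" "nb \<tau> = fun_scale (\<i> * of_nat k) \<sigma>"
    unfolding \<sigma>_def \<tau>_def linear_op_scale[OF linear_nb] nb_src_R[OF g(1)] nb_tgt g(2) src_tgt_zero
    by (auto simp: fun_eq_iff)
  have mode: "mode 0 g 0" using g by (simp add: mode_def ad0 L2_space_def)
  have sub: "\<sigma> \<in> arc_span 0 g" "\<tau> \<in> arc_span 0 g"
    unfolding \<sigma>_def \<tau>_def by (rule cspace.subspace_scale[OF subspace_arc_span], rule arc_span_base)+
  have LR: "\<sigma> \<in> L2_space E_LR"
    unfolding \<sigma>_def using mem_E_LR g by (simp add: cspace.subspace_scale subspace_L2_space)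
  have "tgt g = fun_scale q \<sigma>" using q0 by (simp add: \<sigma>_def)
  then have span: "tgt g \<in> cspace.span {\<sigma>}" "src 0 \<in> cspace.span {\<sigma>}"
    by (simp_all add: cspace.span_scale cspace.span_base src_tgt_zero cspace.span_zero)
  show ?thesis
    unfolding block_for_def
  proof (rule conjI, rule exI[of _ 0], rule mode, rule exI[of _ "[\<sigma>, \<tau>]"], rule exI[of _ "[\<sigma>]"],
      intro conjI)
    show "represents nb [\<sigma>, \<tau>] (block_excess_R k)"
      unfolding block_excess_R_def represents_2 using nb by simp
  qed (use ip sub LR span in \<open>simp_all add: orthonormal_def\<close>)
qed

section \<open>The residual space\<close>

lemma E_LR_subset: "E_LR \<subseteq> E" and finite_E_LR [simp]: "finite E_LR"
  by (auto simp: E_LR_def intro: finite_subset[OF _ finite_E])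

lemma E_LR_Sigma: "E_LR = Sigma L nbrs" and swap_E_LR: "prod.swap ` E_LR = Sigma R nbrs"
  and E_split: "E = E_LR \<union> prod.swap ` E_LR" "E_LR \<inter> prod.swap ` E_LR = {}"
  using E_sides E_sym by (fastforce simp: E_LR_def nbrs_def image_iff)+

lemma card_E_LR: "card E_LR = card L * (K + 1)" "card E_LR = card R * (k + 1)"
  and card_E: "card E = 2 * card E_LR"
proof -
  show "card E_LR = card L * (K + 1)"
    unfolding E_LR_Sigma using card_nbrs by (subst card_SigmaI) auto
  have sw: "card (prod.swap ` E_LR) = card E_LR"
    by (rule card_image) (auto intro: inj_onI)
  have "card (prod.swap ` E_LR) = card R * (k + 1)"
    unfolding swap_E_LR using card_nbrs by (subst card_SigmaI) auto
  then show "card E_LR = card R * (k + 1)" using sw by simp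
  show "card E = 2 * card E_LR"
    using sw by (subst E_split(1), subst card_Un_disjoint) (simp_all add: E_split(2))
qed

text \<open>The adjoint of \<open>src\<close>; composed with \<open>flip\<close> it becomes the
  adjoint of \<open>tgt\<close>.\<close>

definition out_sum :: "('a \<times> 'a \<Rightarrow> complex) \<Rightarrow> 'a \<Rightarrow> complex" where
  "out_sum h = (\<lambda>v. \<Sum>u\<in>nbrs v. h (v, u))"

lemma inner_src_out_sum: "L2_inner E (src F) h = L2_inner V F (out_sum h)"
  unfolding inner_src_left L2_inner_def[of V] out_sum_def ..

lemma inner_tgt_out_sum: "L2_inner E (tgt F) h = L2_inner V F (out_sum (flip h))"
  using inner_flip[of "src F" "flip h"] by (simp add: inner_src_out_sum)

lemma out_sum_E_LR: "h \<in> L2_space E_LR \<Longrightarrow> out_sum h \<in> L2_space L"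
  "h \<in> L2_space E_LR \<Longrightarrow> out_sum (flip h) \<in> L2_space R"
  using E_sides
  by (auto simp: L2_space_def out_sum_def flip_def E_LR_def intro!: sum.neutral)

lemma flip_mem: "h \<in> L2_space E \<Longrightarrow> flip h \<in> L2_space E"
  using E_sym by (auto simp: L2_space_def flip_def)

lemma inner_flip_E_LR:
  assumes "h \<in> L2_space E_LR" "h' \<in> L2_space E_LR"
  shows "L2_inner E h (flip h') = 0" "L2_inner E (flip h) h' = 0"
proof -
  have "h (v, u) = 0 \<or> h' (u, v) = 0" for v u
    using assms E_sides unfolding L2_space_def E_LR_def by fastforce
  then show "L2_inner E h (flip h') = 0" "L2_inner E (flip h) h' = 0"
    using E_sym unfolding L2_inner_def flip_def by (fastforce intro: sum.neutral)+
qed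

lemma nb_residual:
  assumes "h \<in> L2_space E" "out_sum h = 0"
  shows "nb h = - flip h"
proof (rule ext, clarify)
  fix v u
  show "nb h (v, u) = (- flip h) (v, u)"
  proof (cases "(v, u) \<in> E")
    case True
    then show ?thesis
      using nb_apply[OF True, of h] fun_cong[OF assms(2), of u] by (simp add: out_sum_def flip_def)
  next
    case False
    then have "h (u, v) = 0" using assms(1) E_sym by (auto simp: L2_space_def)
    then show ?thesis using False by (simp add: nb_outside flip_def)
  qed
qed

text \<open>\<open>B\<close> acts on a residual \<open>h\<close> as minus reversal, so the
  antisymmetric combination has eigenvalue 1 and the symmetric one has -1.\<close>

definition sign_pair :: "('a \<times> 'a \<Rightarrow> complex) \<Rightarrow> ('a \<times> 'a \<Rightarrow> complex) list" where
  "sign_pair h = [fun_scale (of_real (1 / sqrt 2)) (h - flip h), fun_scale (of_real (1 / sqrt 2)) (h + flip h)]"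

lemma represents_sign_pair:
  assumes "h \<in> L2_space E" "out_sum h = 0" "out_sum (flip h) = 0"
  shows "represents nb (sign_pair h) block_sign"
proof -
  have *: "nb h = - flip h" "nb (flip h) = - h"
    using nb_residual[OF assms(1,2)] nb_residual[OF flip_mem[OF assms(1)] assms(3)] by simp_all
  have e: "nb (h - flip h) = h - flip h" "nb (h + flip h) = - (h + flip h)"
    unfolding linear_op_diff[OF linear_nb] linear_op_add[OF linear_nb] * by (simp_all add: fun_eq_iff)
  define r where "r = complex_of_real (1 / sqrt 2)"
  show ?thesis
    unfolding sign_pair_def block_sign_def represents_2 linear_op_scale[OF linear_nb] e r_def[symmetric]
    by (simp add: fun_eq_iff algebra_simps)
qed

lemma orthonormal_sign_pair:
  assumes "h \<in> L2_space E_LR" "L2_inner E h h = 1"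
  shows "orthonormal E (sign_pair h)"
proof -
  define r where "r = complex_of_real (1 / sqrt 2)"
  have "r * r = complex_of_real (1 / 2)" "cnj r = r"
    unfolding r_def of_real_mult[symmetric] by simp_all
  then have r: "r * (2 * r) = 1" "cnj r = r" by (simp_all add: mult_ac)
  show ?thesis
    unfolding sign_pair_def r_def[symmetric]
    using assms inner_flip_E_LR[OF assms(1,1)] r
    by (simp add: orthonormal_def L2_inner_diff_left L2_inner_diff_right
        L2_inner_add_left L2_inner_add_right L2_inner_scale_left L2_inner_scale_right inner_flip)
qed

lemma inner_sign_pairs:
  assumes "h \<in> L2_space E_LR" "h' \<in> L2_space E_LR" "L2_inner E h h' = 0"
    and "x \<in> set (sign_pair h)" "y \<in> set (sign_pair h')"
  shows "L2_inner E x y = 0"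
  using assms(4,5) inner_flip_E_LR[OF assms(1,2)] assms(3)
  by (auto simp: sign_pair_def L2_inner_diff_left L2_inner_diff_right
        L2_inner_add_left L2_inner_add_right L2_inner_scale_left L2_inner_scale_right inner_flip)

text \<open>Vanishing vertex sums of \<open>h\<close> and of its reversal mean orthogonality to
  every lifted function, in particular to the generators of the arc space.\<close>

lemma inner_arc_span_sign_pair:
  assumes "out_sum h = 0" "out_sum (flip h) = 0" "x \<in> arc_span f g" "y \<in> set (sign_pair h)"
  shows "L2_inner E x y = 0"
proof -
  have "L2_inner E z h = 0 \<and> L2_inner E z (flip h) = 0" if "z \<in> {src f, tgt f, src g, tgt g}" for z
    using that assms(1,2) by (auto simp: inner_src_out_sum inner_tgt_out_sum)
  then have "L2_inner E x h = 0" "L2_inner E x (flip h) = 0"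
    using L2_inner_span_zero[OF _ assms(3)[unfolded arc_span_def], of "{h, flip h}" E]
      cspace.span_base[of _ "{h, flip h}"] by blast+
  then show ?thesis
    using assms(4) by (auto simp: sign_pair_def L2_inner_diff_right L2_inner_add_right L2_inner_scale_right)
qed

text \<open>The lists \<open>W\<close> carry the matrices; the lists \<open>U\<close> serve to find
  the rest. A function on the arcs leaving \<open>L\<close> that is orthogonal to all of
  \<open>U\<close> is orthogonal to every \<open>src f\<close> and \<open>tgt g\<close>, so its
  vertex sums are orthogonal to all \<open>f\<close> and \<open>g\<close> and vanish by
  completeness.\<close>

lemma assemble:
  fixes ds :: "(('a \<Rightarrow> complex) \<times> ('a \<Rightarrow> complex) \<times> complex mat \<times> nat) list"
  assumes blocks: "\<forall>(f, g, M, n)\<in>set ds. block_for f g M n"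
    and ortho: "sorted_wrt (\<lambda>(f, g, _) (f', g', _). L2_inner V f f' = 0 \<and> L2_inner V g g' = 0) ds"
    and completeL: "\<And>F. F \<in> L2_space L \<Longrightarrow> \<forall>(f, _)\<in>set ds. L2_inner V f F = 0 \<Longrightarrow> F = 0"
    and completeR: "\<And>F. F \<in> L2_space R \<Longrightarrow> \<forall>(_, g, _)\<in>set ds. L2_inner V g F = 0 \<Longrightarrow> F = 0"
  obtains \<chi> where "(\<Sum>(f, g, M, n)\<leftarrow>ds. n) + \<chi> = card E_LR"
    "unitarily_equivalent E nb (diag_block_mat (map (\<lambda>(f, g, M, n). M) ds @ replicate \<chi> block_sign))"
proof -
  define P where "P d w \<longleftrightarrow> (case d of (f, g, M, n) \<Rightarrow> case w of (ws, us) \<Rightarrow>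
    orthonormal E ws \<and> set ws \<subseteq> arc_span f g \<and> length ws = 2 * n \<and> represents nb ws M \<and>
        orthonormal E us \<and> set us \<subseteq> arc_span f g \<and> length us = n \<and> set us \<subseteq> L2_space E_LR \<and>
        src f \<in> cspace.span (set us) \<and> tgt g \<in> cspace.span (set us))"
    for d :: "('a \<Rightarrow> complex) \<times> ('a \<Rightarrow> complex) \<times> complex mat \<times> nat"
      and w :: "('a \<times> 'a \<Rightarrow> complex) list \<times> ('a \<times> 'a \<Rightarrow> complex) list"
  have "\<forall>d\<in>set ds. \<exists>w. P d w"
    using blocks by (fastforce simp: P_def block_for_def)
  then obtain WU where WU: "\<forall>d\<in>set ds. P d (WU d)" by (rule bchoice[THEN exE])
  define W U where "W d = fst (WU d)" and "U d = snd (WU d)" for d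
  have W: "orthonormal E (W d)" "set (W d) \<subseteq> arc_span f g" "length (W d) = 2 * n" "represents nb (W d) M"
    and U: "orthonormal E (U d)" "set (U d) \<subseteq> arc_span f g" "length (U d) = n" "set (U d) \<subseteq> L2_space E_LR"
      "src f \<in> cspace.span (set (U d))" "tgt g \<in> cspace.span (set (U d))"
    if "d \<in> set ds" "d = (f, g, M, n)" for d f g M n
    using bspec[OF WU that(1)] unfolding that(2) P_def W_def U_def
    by (cases "WU (f, g, M, n)"; simp)+
  have orth2: "sorted_wrt (\<lambda>d d'. \<forall>x\<in>set (X d). \<forall>y\<in>set (X d'). L2_inner E x y = 0) ds"
    if X: "\<And>f g M n. (f, g, M, n) \<in> set ds \<Longrightarrow> set (X (f, g, M, n)) \<subseteq> arc_span f g" for X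
  proof (rule sorted_wrt_mono_rel[OF _ ortho], clarsimp)
    fix f g M n f' g' M' n' x y
    assume d: "(f, g, M, n) \<in> set ds" "(f', g', M', n') \<in> set ds"
      "L2_inner V f f' = 0" "L2_inner V g g' = 0" "x \<in> set (X (f, g, M, n))" "y \<in> set (X (f', g', M', n'))"
    obtain l l' where "mode f g l" "mode f' g' l'"
      using bspec[OF blocks d(1)] bspec[OF blocks d(2)] by (auto simp: block_for_def)
    then show "L2_inner E x y = 0"
      using d(3,4) subsetD[OF X[OF d(1)] d(5)] subsetD[OF X[OF d(2)] d(6)] by (rule arc_span_orthogonal)
  qed
  define us where "us = concat (map U ds)"
  have us: "orthonormal E us" "set us \<subseteq> L2_space E_LR"
  proof -
    show "orthonormal E us"
      unfolding us_def
    proof (rule orthonormal_concat)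
      show "\<forall>ws\<in>set (map U ds). orthonormal E ws" using U(1) by (auto simp: split_paired_all)
      show "sorted_wrt (\<lambda>vs ws. \<forall>v\<in>set vs. \<forall>w\<in>set ws. L2_inner E v w = 0) (map U ds)"
        unfolding sorted_wrt_map by (rule orth2) (use U(2) in blast)
    qed
    show "set us \<subseteq> L2_space E_LR" using U(4) unfolding us_def by fastforce
  qed
  have len_us: "length us = (\<Sum>(f, g, M, n)\<leftarrow>ds. n)"
  proof -
    have "map (length \<circ> U) ds = map (\<lambda>(f, g, M, n). n) ds"
      using U(3) by (auto simp: split_paired_all)
    then show ?thesis by (simp only: us_def length_concat map_map)
  qed
  \<comment> \<open>Residual functions are chosen on one orientation of the edges only; reversal
    supplies the other half through \<open>sign_pair\<close>.\<close>
  obtain hs where hs: "set hs \<subseteq> L2_space E_LR" "orthonormal E (us @ hs)"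
    and len: "length us + length hs = card E_LR"
    by (rule orthonormal_extend_L2_space[OF finite_E E_LR_subset us])
  have hs_unit: "L2_inner E h h = 1" if "h \<in> set hs" for h
    using hs(2) that by (auto simp: orthonormal_append orthonormal_def)
  have hs_out: "out_sum h = 0" "out_sum (flip h) = 0" if h: "h \<in> set hs" for h
  proof -
    have *: "L2_inner E (src f) h = 0 \<and> L2_inner E (tgt g) h = 0" if d: "(f, g, M, n) \<in> set ds" for f g M n
    proof -
      have "L2_inner E x h = 0" if "x \<in> set (U (f, g, M, n))" for x
        using that d h hs(2) unfolding orthonormal_append us_def by auto
      then have "L2_inner E y h = 0" if "y \<in> cspace.span (set (U (f, g, M, n)))" for y
        using L2_inner_span_zero[OF _ that, of "{h}" E] cspace.span_base[of _ "{h}"] by blast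
      then show ?thesis using U(5,6)[OF d refl] by blast
    qed
    have "\<forall>(f, _)\<in>set ds. L2_inner V f (out_sum h) = 0"
      using * by (auto simp flip: inner_src_out_sum)
    then show "out_sum h = 0" using completeL out_sum_E_LR(1) hs(1) h by blast
    have "\<forall>(_, g, _)\<in>set ds. L2_inner V g (out_sum (flip h)) = 0"
      using * by (auto simp flip: inner_tgt_out_sum)
    then show "out_sum (flip h) = 0" using completeR out_sum_E_LR(2) hs(1) h by blast
  qed
  define wss where "wss = map W ds @ map sign_pair hs"
  have "orthonormal E (concat wss)"
  proof (rule orthonormal_concat)
    show "\<forall>ws\<in>set wss. orthonormal E ws"
      using W(1) orthonormal_sign_pair hs(1) hs_unit by (auto simp: wss_def split_paired_all)
    have "sorted_wrt (\<lambda>d d'. \<forall>x\<in>set (W d). \<forall>y\<in>set (W d'). L2_inner E x y = 0) ds"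
      by (rule orth2) (use W(2) in blast)
    moreover have "sorted_wrt (\<lambda>h h'. \<forall>x\<in>set (sign_pair h). \<forall>y\<in>set (sign_pair h'). L2_inner E x y = 0) hs"
    proof (rule sorted_wrt_mono_rel)
      show "sorted_wrt (\<lambda>h h'. L2_inner E h h' = 0) hs"
        using hs(2) unfolding orthonormal_append by (simp add: orthonormal_def)
    qed (use inner_sign_pairs hs(1) in blast)
    moreover have "L2_inner E x y = 0"
      if "d \<in> set ds" "h \<in> set hs" "x \<in> set (W d)" "y \<in> set (sign_pair h)" for d h x y
    proof -
      obtain f g M n where "d = (f, g, M, n)" by (cases d)
      then have "x \<in> arc_span f g" using W(2) that by blast
      then show ?thesis using inner_arc_span_sign_pair hs_out that by blast
    qed
    ultimately show "sorted_wrt (\<lambda>vs ws. \<forall>v\<in>set vs. \<forall>w\<in>set ws. L2_inner E v w = 0) wss"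
      by (auto simp: wss_def sorted_wrt_append sorted_wrt_map)
  qed
  moreover have "set (concat wss) \<subseteq> L2_space E"
  proof -
    have "set (W d) \<subseteq> L2_space E" if "d \<in> set ds" for d
      using W(2)[OF that] arc_span_subset by (cases d) blast
    moreover have "set (sign_pair h) \<subseteq> L2_space E" if "h \<in> set hs" for h
    proof -
      have "h \<in> L2_space E" using hs(1) that L2_space_E_LR by blast
      then show ?thesis
        by (simp add: sign_pair_def cspace.subspace_scale cspace.subspace_diff cspace.subspace_add
            subspace_L2_space flip_mem)
    qed
    ultimately have "set ws \<subseteq> L2_space E" if "ws \<in> set wss" for ws
      using that unfolding wss_def set_append set_map by blast
    then show ?thesis unfolding set_concat by blast
  qed
  \<comment> \<open>Counting replaces a proof of spanning: \<open>2 * n\<close> functions per block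
    and 2 per residual function make twice the size of a basis of
    \<open>L2_space E_LR\<close>.\<close>
  moreover have "length (concat wss) = card E"
  proof -
    have "map (length \<circ> W) ds = map (\<lambda>(f, g, M, n). 2 * n) ds"
      using W(3) by (auto simp: split_paired_all)
    moreover have "(\<Sum>(f, g, M, n)\<leftarrow>ds'. 2 * n) = 2 * (\<Sum>(f, g, M, n)\<leftarrow>ds'. n)"
      for ds' :: "(('a \<Rightarrow> complex) \<times> ('a \<Rightarrow> complex) \<times> complex mat \<times> nat) list"
      by (induction ds') auto
    moreover have "sum_list (map (length \<circ> sign_pair) hs') = 2 * length hs'" for hs'
      by (induction hs') (auto simp: sign_pair_def)
    ultimately have "length (concat wss) = 2 * length us + 2 * length hs"
      by (simp only: wss_def length_concat len_us map_append map_map sum_list_append)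
    then show ?thesis using len card_E by simp
  qed
  moreover have "represents nb (concat wss)
      (diag_block_mat (map (\<lambda>(f, g, M, n). M) ds @ replicate (length hs) block_sign))"
  proof (rule represents_concat)
    have "list_all2 (represents nb) (map W ds) (map (\<lambda>(f, g, M, n). M) ds)"
      using W(4) by (auto simp: list_all2_conv_all_nth split: prod.split) (metis nth_mem)
    moreover have "represents nb (sign_pair h) block_sign" if "h \<in> set hs" for h
      using represents_sign_pair hs_out[OF that] hs(1) that L2_space_E_LR by blast
    then have "list_all2 (represents nb) (map sign_pair hs) (replicate (length hs) block_sign)"
      by (simp add: list_all2_conv_all_nth)
    ultimately show "list_all2 (represents nb) wss
        (map (\<lambda>(f, g, M, n). M) ds @ replicate (length hs) block_sign)"
      unfolding wss_def by (rule list_all2_appendI)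
  qed
  ultimately have "unitarily_equivalent E nb
      (diag_block_mat (map (\<lambda>(f, g, M, n). M) ds @ replicate (length hs) block_sign))"
    by (rule represents_unitarily_equivalent[OF finite_E linear_nb])
  with len show thesis unfolding len_us by (rule that)
qed

section \<open>Eigenfunctions and the count of blocks\<close>

lemma subspace_eigenspace: "cspace.subspace (eigenspace G x)"
  unfolding eigenspace_def cspace.subspace_def
  by (auto simp: cspace.subspace_add[OF subspace_L2_space] cspace.subspace_scale[OF subspace_L2_space]
      cspace.subspace_0[OF subspace_L2_space] linear_op_zero[OF linear_ad] linear_op_add[OF linear_ad]
      linear_op_scale[OF linear_ad] cspace.scale_right_distrib cspace.scale_left_commute)

definition restr :: "'a set \<Rightarrow> ('a \<Rightarrow> complex) \<Rightarrow> 'a \<Rightarrow> complex" where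
  "restr S F = (\<lambda>v. if v \<in> S then F v else 0)"

lemma restr_apply: "restr S F v = (if v \<in> S then F v else 0)"
  by (simp add: restr_def)

lemma restr_add: "F \<in> L2_space V \<Longrightarrow> restr L F + restr R F = F"
  using V_eq disjoint by (auto simp: restr_def L2_space_def fun_eq_iff)

lemma restr_mem: "restr S F \<in> L2_space S"
  by (simp add: restr_def L2_space_def)

text \<open>The adjacency operator exchanges functions on the two sides, so the eigenvalue equation
  splits into its parts on \<open>R\<close> and on \<open>L\<close>.\<close>

lemma eigenspace_mode:
  assumes "F \<in> eigenspace G l"
  shows "mode (restr L F) (restr R F) l"
proof -
  have F: "F \<in> L2_space V" "ad F = fun_scale (of_real l) F"
    using assms by (auto simp: eigenspace_def)
  have sum: "ad (restr L F) v + ad (restr R F) v = of_real l * F v" for v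
    using fun_cong[OF F(2), of v] linear_op_add[OF linear_ad, of "restr L F" "restr R F"]
    by (simp add: restr_add[OF F(1)])
  have 0: "ad (restr L F) v = 0" if "v \<notin> R" for v
    using ad_L[OF restr_mem] that by (simp add: L2_space_def)
  have 1: "ad (restr R F) v = 0" if "v \<notin> L" for v
    using ad_R[OF restr_mem] that by (simp add: L2_space_def)
  have excl: "v \<notin> L \<or> v \<notin> R" for v using disjoint by blast
  have "ad (restr L F) = fun_scale (of_real l) (restr R F)"
  proof
    fix v show "ad (restr L F) v = fun_scale (of_real l) (restr R F) v"
      using sum[of v] 0[of v] 1[of v] excl[of v] by (cases "v \<in> R") (auto simp: restr_apply)
  qed
  moreover have "ad (restr R F) = fun_scale (of_real l) (restr L F)"
  proof
    fix v show "ad (restr R F) v = fun_scale (of_real l) (restr L F) v"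
      using sum[of v] 0[of v] 1[of v] excl[of v] by (cases "v \<in> L") (auto simp: restr_apply)
  qed
  ultimately show ?thesis by (simp add: mode_def restr_mem)
qed

lemma mode_inner:
  assumes "mode f g l" "mode f' g' l'"
  shows "of_real l * L2_inner V f f' = of_real l' * L2_inner V g g'"
proof -
  have "L2_inner V (ad g) f' = L2_inner V g (ad f')" by (rule ad_symmetric)
  then show ?thesis using assms by (simp add: mode_def L2_inner_scale_left L2_inner_scale_right)
qed

lemma mode_scale: "mode f g l \<Longrightarrow> mode (fun_scale c f) (fun_scale c g) l"
  by (simp add: mode_def linear_op_scale[OF linear_ad] cspace.scale_left_commute[of c]
      cspace.subspace_scale[OF subspace_L2_space] mult.commute)

text \<open>A bijection between the indices \<open>j\<close> with \<open>lam j = x\<close> and the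
  positions in an orthonormal basis of the eigenspace distributes the eigenfunctions; it exists
  because multiplicities are listed. Let \<open>a\<close> and \<open>b\<close> be the inner products
  of the parts of \<open>F i\<close> and \<open>F j\<close> on \<open>L\<close> and on
  \<open>R\<close>. From \<open>a + b = 0\<close> or \<open>1\<close> and
  \<open>lam i * a = lam j * b\<close>, positivity gives 0 for both if \<open>i\<close> and
  \<open>j\<close> differ, and 1/2 otherwise.\<close>

lemma positive_modes:
  assumes "positive_eigenvalues G m lam"
  obtains f g where "\<forall>j\<in>{1..m}. mode (f j) (g j) (lam j)"
    "\<forall>i\<in>{1..m}. \<forall>j\<in>{1..m}. L2_inner V (f i) (f j) = (if i = j then 1 else 0)"
    "\<forall>i\<in>{1..m}. \<forall>j\<in>{1..m}. L2_inner V (g i) (g j) = (if i = j then 1 else 0)"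
proof -
  define J where "J x = {j \<in> {1..m}. lam j = x}" for x
  have pos: "0 < lam j" if "j \<in> {1..m}" for j
    using assms that by (auto simp: positive_eigenvalues_def)
  have "\<exists>bs. set bs \<subseteq> eigenspace G x \<and> orthonormal V bs \<and> length bs = complex_dim (eigenspace G x)" for x
  proof -
    obtain bs where bs: "set bs \<subseteq> eigenspace G x" "orthonormal V ([] @ bs)" "complete_in V (eigenspace G x) ([] @ bs)"
      by (rule orthonormal_extend[OF finite_V subspace_eigenspace[of x], of "[]"])
        (auto simp: eigenspace_def orthonormal_def)
    then show ?thesis
      using complete_length[OF bs(2) subspace_eigenspace _ bs(3)] by auto
  qed
  then obtain bs where bs: "\<And>x. set (bs x) \<subseteq> eigenspace G x" "\<And>x. orthonormal V (bs x)"
    "\<And>x. length (bs x) = complex_dim (eigenspace G x)"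
    by metis
  have "\<exists>h. bij_betw h (J x) {0..<card (J x)}" for x
    by (rule ex_bij_betw_finite_nat) (simp add: J_def)
  then obtain h where h: "\<And>x. bij_betw (h x) (J x) {0..<card (J x)}" by metis
  define F where "F j = bs (lam j) ! h (lam j) j" for j
  have idx: "h (lam j) j < length (bs (lam j))" if "j \<in> {1..m}" for j
  proof -
    have "j \<in> J (lam j)" using that by (simp add: J_def)
    then have "h (lam j) j < card (J (lam j))" using h[of "lam j"] by (auto dest: bij_betwE)
    also have "card (J (lam j)) = length (bs (lam j))"
      using assms pos[OF that] unfolding bs(3) J_def positive_eigenvalues_def by blast
    finally show ?thesis .
  qed
  have F: "F j \<in> eigenspace G (lam j)" if "j \<in> {1..m}" for j
    using bs(1) nth_mem[OF idx[OF that]] unfolding F_def by blast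
  have inner: "L2_inner V (F i) (F j) = (if i = j then 1 else 0)"
    if ij: "i \<in> {1..m}" "j \<in> {1..m}" for i j
  proof (cases "lam i = lam j")
    case True
    have "i \<in> J (lam j)" "j \<in> J (lam j)" using ij True by (simp_all add: J_def)
    then have "h (lam j) i = h (lam j) j \<longleftrightarrow> i = j"
      using bij_betw_imp_inj_on[OF h[of "lam j"]] by (auto dest: inj_onD)
    then show ?thesis
      using orthonormal_nth[OF bs(2)[of "lam j"] _ idx[OF ij(2)], of "h (lam j) i"] idx[OF ij(1)]
      unfolding F_def True by simp
  next
    case False
    have "ad (F i) = fun_scale (of_real (lam i)) (F i)" "ad (F j) = fun_scale (of_real (lam j)) (F j)"
      using F ij by (auto simp: eigenspace_def)
    then have "of_real (lam i) * L2_inner V (F i) (F j) = of_real (lam j) * L2_inner V (F i) (F j)"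
      using ad_symmetric[of "F i" "F j"] by (simp add: L2_inner_scale_left L2_inner_scale_right)
    then show ?thesis using False by auto
  qed
  \<comment> \<open>Half of the squared norm of an eigenfunction for a nonzero eigenvalue lives on each side.\<close>
  define f g where "f j = fun_scale (of_real (sqrt 2)) (restr L (F j))"
    and "g j = fun_scale (of_real (sqrt 2)) (restr R (F j))" for j
  have mode: "mode (restr L (F j)) (restr R (F j)) (lam j)" if "j \<in> {1..m}" for j
    by (rule eigenspace_mode[OF F[OF that]])
  have two: "complex_of_real (sqrt 2) * (complex_of_real (sqrt 2) * z) = 2 * z" for z
    unfolding mult.assoc[symmetric] of_real_mult[symmetric] by simp
  have main: "2 * L2_inner V (restr L (F i)) (restr L (F j)) = (if i = j then 1 else 0) \<and>
      2 * L2_inner V (restr R (F i)) (restr R (F j)) = (if i = j then 1 else 0)"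
    if ij: "i \<in> {1..m}" "j \<in> {1..m}" for i j
  proof -
    define a b where "a = L2_inner V (restr L (F i)) (restr L (F j))"
      and "b = L2_inner V (restr R (F i)) (restr R (F j))"
    have "F i \<in> L2_space V" "F j \<in> L2_space V" using F ij by (auto simp: eigenspace_def)
    then have "L2_inner V (F i) (F j) = L2_inner V (restr L (F i) + restr R (F i)) (restr L (F j) + restr R (F j))"
      by (simp only: restr_add)
    also have "\<dots> = a + b"
      unfolding L2_inner_add_left L2_inner_add_right a_def b_def
      using inner_LR[OF restr_mem restr_mem] inner_RL[OF restr_mem restr_mem] by simp
    finally have ab: "a + b = (if i = j then 1 else 0)" using inner[OF ij] by simp
    have l: "of_real (lam i) * a = of_real (lam j) * b"
      unfolding a_def b_def by (rule mode_inner[OF mode[OF ij(1)] mode[OF ij(2)]])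
    show ?thesis
    proof (cases "i = j")
      case True
      then have "a = b" using l pos[OF ij(1)] by simp
      then show ?thesis using ab True unfolding a_def[symmetric] b_def[symmetric] by simp
    next
      case False
      then have b: "b = - a" using ab by (simp add: eq_neg_iff_add_eq_0 add.commute)
      then have "of_real (lam i + lam j) * a = 0" using l by (simp add: distrib_right)
      moreover have "lam i + lam j \<noteq> 0" using pos[OF ij(1)] pos[OF ij(2)] by simp
      ultimately have "a = 0" by (metis mult_eq_0_iff of_real_eq_0_iff)
      then show ?thesis using b False unfolding a_def[symmetric] b_def[symmetric] by simp
    qed
  qed
  show thesis
  proof (rule that[of f g])
    show "\<forall>j\<in>{1..m}. mode (f j) (g j) (lam j)"
      unfolding f_def g_def using mode_scale[OF mode] by blast
    show "\<forall>i\<in>{1..m}. \<forall>j\<in>{1..m}. L2_inner V (f i) (f j) = (if i = j then 1 else 0)"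
      "\<forall>i\<in>{1..m}. \<forall>j\<in>{1..m}. L2_inner V (g i) (g j) = (if i = j then 1 else 0)"
      using main unfolding f_def g_def L2_inner_scale_left L2_inner_scale_right complex_cnj_complex_of_real two
      by blast+
  qed
qed

text \<open>Cauchy-Schwarz for \<open>src f\<close> and \<open>tgt g\<close>: the squared norm of
  \<open>q * src f - p * tgt g\<close> is \<open>2 p q (p q - l)\<close>.\<close>

lemma mode_eigenvalue_le:
  assumes mode: "mode f g l" and unit: "L2_inner V f f = 1" "L2_inner V g g = 1"
  shows "l \<le> sqrt ((real K + 1) * (real k + 1))"
proof -
  have mem: "f \<in> L2_space L" "g \<in> L2_space R"
    and ad: "ad f = fun_scale (of_real l) g" "ad g = fun_scale (of_real l) f"
    using mode by (auto simp: mode_def)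
  define p q where "p = sqrt (real K + 1)" and "q = sqrt (real k + 1)"
  have pq: "p > 0" "q > 0" "p * p = real K + 1" "q * q = real k + 1"
    by (simp_all add: p_def q_def)
  define w where "w = fun_scale (of_real q) (src f) - fun_scale (of_real p) (tgt g)"
  have gram: "L2_inner E (src f) (src f) = of_real (p * p)" "L2_inner E (tgt g) (tgt g) = of_real (q * q)"
    "L2_inner E (src f) (tgt g) = of_real l" "L2_inner E (tgt g) (src f) = of_real l"
    unfolding pq
    by (simp_all add: inner_tgt_tgt inner_src_tgt inner_tgt_src inner_src_src_L inner_src_src_R
        mem ad L2_inner_scale_right unit)
  have "L2_inner E w w = of_real (2 * (p * q) * (p * q - l))"
    unfolding w_def L2_inner_diff_left L2_inner_diff_right L2_inner_scale_left L2_inner_scale_right gram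
      complex_cnj_complex_of_real
    by (simp add: algebra_simps)
  moreover have "L2_inner E w w = of_real (\<Sum>e\<in>E. (cmod (w e))\<^sup>2)" by (rule L2_inner_self)
  ultimately have "2 * (p * q) * (p * q - l) = (\<Sum>e\<in>E. (cmod (w e))\<^sup>2)" by (metis of_real_eq_iff)
  also have "\<dots> \<ge> 0" by (rule sum_nonneg) simp
  finally have "0 \<le> 2 * (p * q) * (p * q - l)" .
  moreover have "0 < 2 * (p * q)" using pq by simp
  ultimately have "0 \<le> p * q - l"
    using mult_pos_neg[of "2 * (p * q)" "p * q - l"] by linarith
  then show ?thesis by (simp add: p_def q_def real_sqrt_mult)
qed

text \<open>For \<open>k = 0\<close> a vertex of \<open>R\<close> has one neighbour, and
  \<open>ad f\<close> copies its value, so \<open>tgt (ad f)\<close> is \<open>src f\<close>;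
  comparing norms gives \<open>l^2 = K + 1\<close>. This rules out \<open>k = 0\<close> for the
  4-by-4 blocks, which divide by \<open>k\<close>.\<close>

lemma mode_eigenvalue_k_0:
  assumes mode: "mode f g l" and unit: "L2_inner V f f = 1" "L2_inner V g g = 1"
    and "k = 0" "0 < l"
  shows "l = sqrt ((real K + 1) * (real k + 1))"
proof -
  have mem: "f \<in> L2_space L" "g \<in> L2_space R" and ad: "ad f = fun_scale (of_real l) g"
    using mode by (auto simp: mode_def)
  have "tgt (ad f) = src f"
  proof (rule ext, clarify)
    fix v u
    show "tgt (ad f) (v, u) = src f (v, u)"
    proof (cases "(v, u) \<in> E")
      case True
      show ?thesis
      proof (cases "u \<in> R")
        case u: True
        then have "card (nbrs u) = 1" using card_nbrs(2) \<open>k = 0\<close> by simp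
        moreover have "v \<in> nbrs u" using True E_sym by (simp add: nbrs_def)
        ultimately have "nbrs u = {v}" by (metis card_1_singletonE singletonD)
        then show ?thesis using True by (simp add: tgt_def src_def ad_eq)
      next
        case False
        then have "v \<notin> L" "ad f u = 0" using True E_sides ad_L[OF mem(1)] by (auto simp: L2_space_def)
        then show ?thesis using True mem(1) by (simp add: tgt_def src_def L2_space_def)
      qed
    qed (simp add: tgt_def src_def)
  qed
  then have "fun_scale (of_real l) (tgt g) = src f" by (simp add: ad src_tgt_scale)
  then have "of_real l * (of_real l * L2_inner E (tgt g) (tgt g)) = L2_inner E (src f) (src f)"
    by (metis L2_inner_scale_left L2_inner_scale_right complex_cnj_complex_of_real)
  then have "complex_of_real (l * l) = complex_of_real (real K + 1)"
    using \<open>k = 0\<close> by (simp add: inner_tgt_tgt inner_src_src_L inner_src_src_R mem unit)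
  then have "l\<^sup>2 = (real K + 1) * (real k + 1)"
    unfolding of_real_eq_iff using \<open>k = 0\<close> by (simp add: power2_eq_square)
  then show ?thesis using \<open>0 < l\<close> by (metis less_imp_le real_sqrt_unique)
qed

text \<open>The Perron eigenfunction is explicit: \<open>sqrt (K + 1)\<close> on \<open>L\<close>
  and \<open>sqrt (k + 1)\<close> on \<open>R\<close>. A nonzero eigenspace forces its eigenvalue
  into the list.\<close>

lemma top_eigenvalue:
  assumes "positive_eigenvalues G m lam" "V \<noteq> {}"
  shows "\<exists>j\<in>{1..m}. lam j = sqrt ((real K + 1) * (real k + 1))"
proof -
  define l where "l = sqrt ((real K + 1) * (real k + 1))"
  define p q where "p = complex_of_real (sqrt (real K + 1))" and "q = complex_of_real (sqrt (real k + 1))"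
  have pq: "of_nat (Suc K) = p * p" "of_nat (Suc k) = q * q" "complex_of_real l = p * q"
    unfolding p_def q_def l_def by (simp_all add: real_sqrt_mult flip: of_real_mult)
  have pq0: "p \<noteq> 0" "q \<noteq> 0" by (simp_all add: p_def q_def)
  define F where "F v = (if v \<in> L then p else if v \<in> R then q else 0)" for v
  have "ad F v = of_real l * F v" for v
  proof (cases "v \<in> L")
    case True
    then have "ad F v = (\<Sum>w\<in>nbrs v. q)"
      unfolding ad_eq using E_sides by (intro sum.cong) (auto simp: F_def nbrs_def)
    then show ?thesis using True card_nbrs(1)[of v] by (simp add: pq F_def del: of_nat_Suc)
  next
    case v: False
    show ?thesis
    proof (cases "v \<in> R")
      case True
      then have "ad F v = (\<Sum>w\<in>nbrs v. p)"
        unfolding ad_eq using E_sides by (intro sum.cong) (auto simp: F_def nbrs_def)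
      then show ?thesis using True v card_nbrs(2)[of v] by (simp add: pq F_def del: of_nat_Suc)
    next
      case False
      then have "nbrs v = {}" using v E_sides by (auto simp: nbrs_def)
      then show ?thesis using False v by (simp add: ad_eq F_def)
    qed
  qed
  then have mem: "F \<in> eigenspace G l"
    using V_eq by (auto simp: eigenspace_def L2_space_def F_def fun_eq_iff)
  obtain v where "v \<in> V" using assms(2) by blast
  then have "F v \<noteq> 0" using V_eq pq0 by (auto simp: F_def)
  then have F0: "F \<noteq> 0" by auto
  obtain bs where bs: "set bs \<subseteq> eigenspace G l" "orthonormal V ([] @ bs)" "complete_in V (eigenspace G l) ([] @ bs)"
    by (rule orthonormal_extend[OF finite_V subspace_eigenspace[of l], of "[]"])
      (auto simp: eigenspace_def orthonormal_def)
  have "bs \<noteq> []" using bs(3) mem F0 by (auto simp: complete_in_def)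
  moreover have "length bs = complex_dim (eigenspace G l)"
    using complete_length[OF bs(2) subspace_eigenspace _ bs(3)] bs(1) by simp
  ultimately have "complex_dim (eigenspace G l) \<noteq> 0" by (metis length_0_conv)
  moreover have "0 < l" by (simp add: l_def)
  ultimately have "card {j \<in> {1..m}. lam j = l} \<noteq> 0"
    using assms(1) by (simp add: positive_eigenvalues_def)
  then have "{j \<in> {1..m}. lam j = l} \<noteq> {}" by (metis card.empty)
  then show ?thesis by (auto simp: l_def)
qed

section \<open>Kernels, the cycle rank and orthonormal bases of the two sides\<close>

lemma adjacency_kernel_subspace: "cspace.subspace {f \<in> L2_space S. ad f = 0}"
  unfolding cspace.subspace_def
  by (auto simp: cspace.subspace_add[OF subspace_L2_space] cspace.subspace_scale[OF subspace_L2_space]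
      cspace.subspace_0[OF subspace_L2_space] linear_op_zero[OF linear_ad] linear_op_add[OF linear_ad]
      linear_op_scale[OF linear_ad])

lemma L2_space_V: "F \<in> L2_space L \<Longrightarrow> F \<in> L2_space V" "F \<in> L2_space R \<Longrightarrow> F \<in> L2_space V"
  using V_eq by (auto simp: L2_space_def)

lemma cycle_rank_eq: "cycle_rank G = int (card E_LR) - int (card L) - int (card R) + 1"
  using card_Un_disjoint[of L R] disjoint by (simp add: cycle_rank_def V_eq card_E)

text \<open>Counting the edges from either side expresses \<open>card R\<close> through
  \<open>card L\<close>.\<close>

lemma cycle_rank_real:
  "real_of_int (cycle_rank G) = (real K * real k - 1) / (real k + 1) * real (card L) + 1"
proof -
  have "real (card L * (K + 1)) = real (card R * (k + 1))"
    using card_E_LR by simp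
  then have R: "real (card R) = real (card L) * (real K + 1) / (real k + 1)"
    by (simp add: field_simps)
  have "real_of_int (cycle_rank G) = real (card L) * (real K + 1) - real (card L) - real (card R) + 1"
    unfolding cycle_rank_eq card_E_LR(1) by (simp add: algebra_simps)
  also have "\<dots> = (real K * real k - 1) / (real k + 1) * real (card L) + 1"
    unfolding R by (simp add: field_simps)
  finally show ?thesis .
qed

text \<open>On \<open>R\<close>, \<open>gs\<close> is an arbitrary completion of the
  \<open>g j\<close> to a basis; completeness on \<open>L\<close> forces its members into the
  kernel. Conversely kernel functions are orthogonal to the \<open>g j\<close>, so \<open>gs\<close>
  exhausts the kernel and its length is the nullity.\<close>

lemma mode_bases:
  assumes pe: "positive_eigenvalues G m lam" and m: "m = card L - adjacency_nullity G L"
  obtains f g fs gs where "\<forall>j\<in>{1..m}. mode (f j) (g j) (lam j)"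
    "orthonormal V (map f [1..<m + 1] @ fs)" "orthonormal V (map g [1..<m + 1] @ gs)"
    "complete_in V (L2_space L) (map f [1..<m + 1] @ fs)"
    "complete_in V (L2_space R) (map g [1..<m + 1] @ gs)"
    "\<forall>h\<in>set fs. h \<in> L2_space L \<and> ad h = 0" "\<forall>h\<in>set gs. h \<in> L2_space R \<and> ad h = 0"
    "length fs = adjacency_nullity G L" "length gs = adjacency_nullity G R"
    "m + length fs = card L" "m + length gs = card R"
proof -
  obtain f g where mode': "\<forall>j\<in>{1..m}. mode (f j) (g j) (lam j)"
    and f: "\<forall>i\<in>{1..m}. \<forall>j\<in>{1..m}. L2_inner V (f i) (f j) = (if i = j then 1 else 0)"
    and g: "\<forall>i\<in>{1..m}. \<forall>j\<in>{1..m}. L2_inner V (g i) (g j) = (if i = j then 1 else 0)"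
    using positive_modes[OF pe] .
  then have mode: "mode (f j) (g j) (lam j)" if "j \<in> {1..m}" for j using that by blast
  have pos: "0 < lam j" if "j \<in> {1..m}" for j
    using pe that by (auto simp: positive_eigenvalues_def)
  have mem: "f j \<in> L2_space L" "g j \<in> L2_space R" and ad: "ad (f j) = fun_scale (of_real (lam j)) (g j)"
    "ad (g j) = fun_scale (of_real (lam j)) (f j)" if "j \<in> {1..m}" for j
    using mode[OF that] by (auto simp: mode_def)
  define ms where "ms = [1..<m + 1]"
  have ms: "set ms = {1..m}" "length ms = m" "sorted_wrt (<) ms"
    unfolding ms_def by (auto simp del: upt_Suc)
  have ortho_map: "orthonormal V (map h ms)"
    if h: "\<forall>i\<in>{1..m}. \<forall>j\<in>{1..m}. L2_inner V (h i) (h j) = (if i = j then 1 else 0)" for h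
    unfolding orthonormal_def sorted_wrt_map
  proof
    show "sorted_wrt (\<lambda>i j. L2_inner V (h i) (h j) = 0) ms"
    proof (rule sorted_wrt_mono_rel[OF _ ms(3)])
      show "L2_inner V (h i) (h j) = 0" if "i \<in> set ms" "j \<in> set ms" "i < j" for i j
        using h that unfolding ms(1) by auto
    qed
    show "\<forall>w\<in>set (map h ms). L2_inner V w w = 1" using h unfolding set_map ms(1) by simp
  qed
  define WL WR where "WL = {f \<in> L2_space L. ad f = 0}" and "WR = {f \<in> L2_space R. ad f = 0}"
  have subW: "cspace.subspace WL" "cspace.subspace WR"
    unfolding WL_def WR_def by (rule adjacency_kernel_subspace)+
  obtain fs where fs: "set fs \<subseteq> WL" "orthonormal V ([] @ fs)" "complete_in V WL ([] @ fs)"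
    by (rule orthonormal_extend[OF finite_V subW(1), of "[]"])
      (auto simp: WL_def orthonormal_def L2_space_V)
  have len_fs: "length fs = adjacency_nullity G L"
    using complete_length[OF fs(2) subW(1) _ fs(3)] fs(1) by (simp add: adjacency_nullity_def WL_def)
  have ker_f: "h \<in> L2_space L \<and> ad h = 0" if "h \<in> set fs" for h
    using fs(1) that by (auto simp: WL_def)
  have cross: "L2_inner V (f j) h = 0" if j: "j \<in> {1..m}" and h: "ad h = 0" for j h
  proof -
    have "of_real (lam j) * L2_inner V (f j) h = 0"
      using ad_symmetric[of "g j" h] h by (simp add: ad[OF j] L2_inner_scale_left)
    then show ?thesis using pos[OF j] by simp
  qed
  have cross': "L2_inner V h (g j) = 0" if j: "j \<in> {1..m}" and h: "ad h = 0" for j h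
  proof -
    have "of_real (lam j) * L2_inner V h (g j) = 0"
      using ad_symmetric[of h "f j"] h by (simp add: ad[OF j] L2_inner_scale_right)
    then show ?thesis using pos[OF j] by simp
  qed
  have fL: "orthonormal V (map f ms @ fs)"
    unfolding orthonormal_append using ortho_map[OF f] fs(2) cross ker_f by (auto simp: ms)
  have fL_mem: "set (map f ms @ fs) \<subseteq> L2_space L"
    using mem(1) ker_f by (auto simp: ms)
  obtain us where us: "orthonormal V ((map f ms @ fs) @ us)"
    "complete_in V (L2_space L) ((map f ms @ fs) @ us)"
    "length (map f ms @ fs) + length us = card L"
    using orthonormal_extend_L2_space[OF finite_V _ fL fL_mem] V_eq by blast
  then have len: "m + length fs + length us = card L" by (simp add: ms)
  \<comment> \<open>The subtraction in \<open>m\<close> is truncated, so this bound is what gives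
    \<open>m + adjacency_nullity G L = card L\<close>; no room is then left for
    \<open>us\<close>.\<close>
  moreover have "adjacency_nullity G L \<le> card L"
    using len_fs len by linarith
  ultimately have "us = []" using m len_fs by simp
  then have fL_complete: "complete_in V (L2_space L) (map f ms @ fs)" using us by simp
  have gR: "orthonormal V (map g ms)" "set (map g ms) \<subseteq> L2_space R"
    using ortho_map[OF g] mem(2) by (auto simp: ms)
  obtain gs where gs: "set gs \<subseteq> L2_space R" "orthonormal V (map g ms @ gs)"
    "complete_in V (L2_space R) (map g ms @ gs)"
    "length (map g ms) + length gs = card R"
    using orthonormal_extend_L2_space[OF finite_V _ gR] V_eq by blast
  have ker_g: "h \<in> L2_space R \<and> ad h = 0" if h: "h \<in> set gs" for h
  proof
    show hR: "h \<in> L2_space R" using gs(1) h by blast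
    \<comment> \<open>Moving \<open>ad\<close> to \<open>w\<close> gives \<open>lam j\<close> times
      the product with \<open>g j\<close>, or 0 for a kernel function.\<close>
    have "L2_inner V (ad h) w = 0" if w: "w \<in> set (map f ms @ fs)" for w
    proof -
      consider j where "j \<in> {1..m}" "w = f j" | "w \<in> set fs" using w by (auto simp: ms)
      then show ?thesis
      proof cases
        case 1
        have "L2_inner V (g j) h = 0" using gs(2) 1(1) h unfolding orthonormal_append by (auto simp: ms)
        then show ?thesis
          unfolding ad_symmetric 1(2) ad(1)[OF 1(1)] L2_inner_scale_right
          by (simp add: L2_inner_zero_sym[of V h])
      next
        case 2
        then show ?thesis unfolding ad_symmetric using ker_f[OF 2] by simp
      qed
    qed
    then show "ad h = 0" using fL_complete ad_R[OF hR] unfolding complete_in_def by blast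
  qed
  have "complete_in V WR gs"
    unfolding complete_in_def
  proof (intro ballI impI)
    fix h assume h: "h \<in> WR" "\<forall>w\<in>set gs. L2_inner V h w = 0"
    then have "\<forall>w\<in>set (map g ms @ gs). L2_inner V h w = 0"
      using cross' by (auto simp: WR_def ms)
    then show "h = 0" using gs(3) h(1) unfolding complete_in_def WR_def by blast
  qed
  moreover have "orthonormal V gs" using gs(2) by (simp add: orthonormal_append)
  moreover have "set gs \<subseteq> WR" using ker_g by (auto simp: WR_def)
  ultimately have len_gs: "length gs = adjacency_nullity G R"
    using complete_length[OF _ subW(2)] by (simp add: adjacency_nullity_def WR_def)
  show thesis
    by (rule that[OF mode' fL[unfolded ms_def] gs(2)[unfolded ms_def] fL_complete[unfolded ms_def]
          gs(3)[unfolded ms_def] _ _ len_fs len_gs])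
      (use len \<open>us = []\<close> gs(4) ker_f ker_g in \<open>auto simp: ms\<close>)
qed

lemma non_backtracking_block_form:
  assumes ne: "V \<noteq> {}" and kK: "k < K" and m: "m = card L - adjacency_nullity G L"
    and pe: "positive_eigenvalues G m lam"
  shows "\<exists>\<alpha> \<beta> \<gamma> \<delta>.
      (\<forall>j\<in>{2..m}. lam j \<notin> tempered_interval K k \<longrightarrow>
         0 < \<alpha> j \<and> \<alpha> j \<le> real K \<and> 0 < \<beta> j \<and> \<beta> j \<le> real K \<and>
         cmod (\<gamma> j) \<le> real K \<and> cmod (\<delta> j) \<le> real K) \<and>
      unitarily_equivalent E nb
        (diag_block_mat (
           [block_trivial K k] @
           map (\<lambda>j. if lam j \<in> tempered_interval K k
                    then block_tempered K k (lam j)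
                    else block_nontempered K k (lam j) (\<alpha> j) (\<beta> j) (\<gamma> j) (\<delta> j)) [2..<m + 1] @
           replicate (adjacency_nullity G L) (block_excess_L K) @
           replicate (adjacency_nullity G R) (block_excess_R k) @
           replicate (nat (cycle_rank G)) block_sign))"
proof -
  obtain f g fs gs where mode': "\<forall>j\<in>{1..m}. mode (f j) (g j) (lam j)"
    and ortho: "orthonormal V (map f [1..<m + 1] @ fs)" "orthonormal V (map g [1..<m + 1] @ gs)"
    and complete: "complete_in V (L2_space L) (map f [1..<m + 1] @ fs)"
    "complete_in V (L2_space R) (map g [1..<m + 1] @ gs)"
    and ker: "\<forall>h\<in>set fs. h \<in> L2_space L \<and> ad h = 0" "\<forall>h\<in>set gs. h \<in> L2_space R \<and> ad h = 0"
    and len: "length fs = adjacency_nullity G L" "length gs = adjacency_nullity G R"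
    "m + length fs = card L" "m + length gs = card R"
    using mode_bases[OF pe m] .
  have mode: "mode (f j) (g j) (lam j)" if "j \<in> {1..m}" for j using mode' that by blast
  define \<Lambda> where "\<Lambda> = sqrt ((real K + 1) * (real k + 1))"
  have unit: "L2_inner V (f j) (f j) = 1" "L2_inner V (g j) (g j) = 1" if "j \<in> {1..m}" for j
    using ortho that unfolding orthonormal_append orthonormal_def by (auto simp del: upt_Suc)
  \<comment> \<open>\<open>\<Lambda>\<close> occurs in the list and no mode exceeds it, so
    monotonicity puts it at index 1; in particular \<open>m \<ge> 1\<close>.\<close>
  obtain j0 where j0: "j0 \<in> {1..m}" "lam j0 = \<Lambda>"
    using top_eigenvalue[OF pe ne] unfolding \<Lambda>_def by blast
  then have m1: "1 \<in> {1..m}" by simp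
  have "lam j0 \<le> lam 1" using pe j0(1) unfolding positive_eigenvalues_def by auto
  then have lam1: "lam 1 = \<Lambda>"
    using mode_eigenvalue_le[OF mode[OF m1] unit[OF m1]] j0(2) unfolding \<Lambda>_def by linarith
  have lamj: "0 < lam j" "lam j < \<Lambda>" if "j \<in> {2..m}" for j
    using pe that lam1 by (auto simp: positive_eigenvalues_def)
  define Q where "Q j t \<longleftrightarrow> (case t of (\<alpha>, \<beta>, \<gamma>, \<delta>) \<Rightarrow>
      (lam j \<notin> tempered_interval K k \<longrightarrow> 0 < \<alpha> \<and> \<alpha> \<le> real K \<and> 0 < \<beta> \<and> \<beta> \<le> real K \<and>
         cmod \<gamma> \<le> real K \<and> cmod \<delta> \<le> real K) \<and>
      block_for (f j) (g j) (if lam j \<in> tempered_interval K k then block_tempered K k (lam j)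
       else block_nontempered K k (lam j) \<alpha> \<beta> \<gamma> \<delta>) 2)" for j t
  have "\<exists>t. Q j t" if j: "j \<in> {2..m}" for j
  proof -
    have j': "j \<in> {1..m}" using j by simp
    \<comment> \<open>For \<open>k = 0\<close> every positive eigenvalue would be
      \<open>\<Lambda>\<close>, contrary to \<open>lam j < \<Lambda>\<close>.\<close>
    have "k \<noteq> 0"
      using mode_eigenvalue_k_0[OF mode[OF j'] unit[OF j']] lamj[OF j] unfolding \<Lambda>_def by fastforce
    then have "k \<ge> 1" by simp
    from mode[OF j'] unit[OF j'] lamj[OF j, unfolded \<Lambda>_def] this kK
    obtain \<alpha> \<beta> \<gamma> \<delta> where
      "lam j \<notin> tempered_interval K k \<longrightarrow> 0 < \<alpha> \<and> \<alpha> \<le> real K \<and> 0 < \<beta> \<and> \<beta> \<le> real K \<and>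
         cmod \<gamma> \<le> real K \<and> cmod \<delta> \<le> real K"
      "block_for (f j) (g j) (if lam j \<in> tempered_interval K k then block_tempered K k (lam j)
       else block_nontempered K k (lam j) \<alpha> \<beta> \<gamma> \<delta>) 2"
      by (rule block_for_mode)
    then have "Q j (\<alpha>, \<beta>, \<gamma>, \<delta>)" unfolding Q_def prod.case by (rule conjI)
    then show ?thesis by (rule exI)
  qed
  then have "\<forall>j\<in>{2..m}. \<exists>t. Q j t" by (rule ballI)
  then obtain t where t: "\<forall>j\<in>{2..m}. Q j (t j)" by (rule bchoice[THEN exE])
  define \<alpha> \<beta> \<gamma> \<delta> where "\<alpha> j = fst (t j)" and "\<beta> j = fst (snd (t j))" and "\<gamma> j = fst (snd (snd (t j)))"
    and "\<delta> j = snd (snd (snd (t j)))" for j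
  define M where "M j = (if lam j \<in> tempered_interval K k then block_tempered K k (lam j)
       else block_nontempered K k (lam j) (\<alpha> j) (\<beta> j) (\<gamma> j) (\<delta> j))" for j
  have bounds: "lam j \<notin> tempered_interval K k \<longrightarrow> 0 < \<alpha> j \<and> \<alpha> j \<le> real K \<and> 0 < \<beta> j \<and> \<beta> j \<le> real K \<and>
         cmod (\<gamma> j) \<le> real K \<and> cmod (\<delta> j) \<le> real K"
    and M: "block_for (f j) (g j) (M j) 2" if "j \<in> {2..m}" for j
    using bspec[OF t that] unfolding M_def \<alpha>_def \<beta>_def \<gamma>_def \<delta>_def Q_def split_beta by blast+
  \<comment> \<open>The last component is the number of dimensions on the arcs leaving
    \<open>L\<close>, half the size of the block. Kernel functions are paired with 0.\<close>
  define ds where "ds = [(f 1, g 1, block_trivial K k, 1 :: nat)] @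
    map (\<lambda>j. (f j, g j, M j, 2)) [2..<m + 1] @ map (\<lambda>f. (f, 0, block_excess_L K, 1)) fs @
    map (\<lambda>g. (0, g, block_excess_R k, 1)) gs"
  have upt: "[1..<m + 1] = 1 # [2..<m + 1]"
    using m1 by (simp add: upt_conv_Cons numeral_2_eq_2 del: upt_Suc)
  have unit_ker: "L2_inner V h h = 1" if "h \<in> set fs \<or> h \<in> set gs" for h
    using ortho that unfolding orthonormal_append orthonormal_def by auto
  obtain \<chi> where \<chi>: "(\<Sum>(f, g, M, n)\<leftarrow>ds. n) + \<chi> = card E_LR"
    and equiv: "unitarily_equivalent E nb
      (diag_block_mat (map (\<lambda>(f, g, M, n). M) ds @ replicate \<chi> block_sign))"
  proof (rule assemble[of ds])
    have "block_for (f 1) (g 1) (block_trivial K k) 1"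
      by (rule block_for_top[OF mode[OF m1] unit[OF m1] lam1[unfolded \<Lambda>_def]])
    then show "\<forall>(f, g, M, n)\<in>set ds. block_for f g M n"
      using M block_for_excess_L block_for_excess_R ker unit_ker unfolding ds_def by auto
    have f: "sorted_wrt (\<lambda>v w. L2_inner V v w = 0) ((f 1 # map f [2..<m + 1]) @ fs)"
      and g: "sorted_wrt (\<lambda>v w. L2_inner V v w = 0) ((g 1 # map g [2..<m + 1]) @ gs)"
      using ortho unfolding upt orthonormal_def by simp_all
    show "sorted_wrt (\<lambda>(f, g, _) (f', g', _). L2_inner V f f' = 0 \<and> L2_inner V g g' = 0) ds"
    proof -
      \<comment> \<open>The zeros paired with kernel functions are orthogonal to everything, so
        orthogonality of the two bases carries over.\<close>
      have "sorted_wrt (\<lambda>v w. L2_inner V v w = 0) (map fst ds)"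
        using f unfolding ds_def
        by (simp add: comp_def sorted_wrt_append sorted_wrt_map ball_Un sorted_wrt_true del: upt_Suc)
      moreover have "sorted_wrt (\<lambda>v w. L2_inner V v w = 0) (map (\<lambda>d. fst (snd d)) ds)"
        using g unfolding ds_def
        by (simp add: comp_def sorted_wrt_append sorted_wrt_map ball_Un sorted_wrt_true del: upt_Suc)
      ultimately show ?thesis
        unfolding split_beta sorted_wrt_conj sorted_wrt_map by (rule conjI)
    qed
    show "F = 0" if F: "F \<in> L2_space L" "\<forall>(f, _)\<in>set ds. L2_inner V f F = 0" for F
    proof -
      have "\<forall>w\<in>set (map f [1..<m + 1] @ fs). L2_inner V w F = 0"
        using F(2) unfolding upt ds_def by (simp add: split_beta ball_Un del: upt_Suc)
      then show ?thesis
        using complete(1) F(1) L2_inner_zero_sym unfolding complete_in_def by blast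
    qed
    show "F = 0" if F: "F \<in> L2_space R" "\<forall>(_, g, _)\<in>set ds. L2_inner V g F = 0" for F
    proof -
      have "\<forall>w\<in>set (map g [1..<m + 1] @ gs). L2_inner V w F = 0"
        using F(2) unfolding upt ds_def by (simp add: split_beta ball_Un del: upt_Suc)
      then show ?thesis
        using complete(2) F(1) L2_inner_zero_sym unfolding complete_in_def by blast
    qed
  qed
  \<comment> \<open>As \<open>m + length fs = card L\<close> and
    \<open>m + length gs = card R\<close>, this is \<open>card L + card R - 1\<close>. What remains
    of \<open>card E_LR\<close> is the cycle rank, which is therefore nonnegative, so
    \<open>nat\<close> loses nothing.\<close>
  have "(\<Sum>(f, g, M, n)\<leftarrow>ds. n) = 1 + 2 * (m - 1) + length fs + length gs"
    unfolding ds_def using m1 by (simp add: comp_def sum_list_triv del: upt_Suc)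
  then have "cycle_rank G = int \<chi>"
    unfolding cycle_rank_eq using \<chi> len(3,4) m1 by simp
  then have \<chi>: "\<chi> = nat (cycle_rank G)" by simp
  have "map (\<lambda>(f, g, M, n). M) ds @ replicate \<chi> block_sign = [block_trivial K k] @ map M [2..<m + 1] @
      replicate (adjacency_nullity G L) (block_excess_L K) @ replicate (adjacency_nullity G R) (block_excess_R k) @
      replicate (nat (cycle_rank G)) block_sign"
    unfolding ds_def \<chi> by (simp add: comp_def map_replicate_const len del: upt_Suc)
  with equiv bounds show ?thesis
    unfolding M_def
    by (intro exI[of _ \<alpha>] exI[of _ \<beta>] exI[of _ \<gamma>] exI[of _ \<delta>] conjI ballI) simp_all
qed

end

theorem theorem3p1:
  fixes G :: "'a pair_pre_digraph" and L R :: "'a set" and K k n m :: nat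
    and lam :: "nat \<Rightarrow> real"
  assumes "biregular_bipartite G L R K k"
    and "Digraph_Component.connected (with_proj G)"
    and "K > k"
    and "n = card L"
    and "m = n - adjacency_nullity G L"
    and "positive_eigenvalues G m lam"
  shows "real_of_int (cycle_rank G) = (real K * real k - 1) / (real k + 1) * real n + 1 \<and>
    (\<exists>(\<alpha> :: nat \<Rightarrow> real) (\<beta> :: nat \<Rightarrow> real) (\<gamma> :: nat \<Rightarrow> complex) (\<delta> :: nat \<Rightarrow> complex).
      (\<forall>j\<in>{2..m}. lam j \<notin> tempered_interval K k \<longrightarrow>
         0 < \<alpha> j \<and> \<alpha> j \<le> real K \<and> 0 < \<beta> j \<and> \<beta> j \<le> real K \<and>
         cmod (\<gamma> j) \<le> real K \<and> cmod (\<delta> j) \<le> real K) \<and>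
      unitarily_equivalent (parcs G) (non_backtracking_op G)
        (diag_block_mat (
           [block_trivial K k] @
           map (\<lambda>j. if lam j \<in> tempered_interval K k
                    then block_tempered K k (lam j)
                    else block_nontempered K k (lam j) (\<alpha> j) (\<beta> j) (\<gamma> j) (\<delta> j)) [2..<m + 1] @
           replicate (adjacency_nullity G L) (block_excess_L K) @
           replicate (adjacency_nullity G R) (block_excess_R k) @
           replicate (nat (cycle_rank G)) block_sign)))"
proof -
  interpret biregular_graph G L R K k
    by unfold_locales (rule assms(1))
  \<comment> \<open>Connectedness demands a vertex; on an empty graph the trivial block would have
    no place.\<close>
  have "pverts G \<noteq> {}"
    using assms(2) by (auto simp: Digraph_Component.connected_def strongly_connected_def)
  with cycle_rank_real non_backtracking_block_form[OF _ assms(3) assms(5)[unfolded assms(4)] assms(6)]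
  show ?thesis unfolding assms(4) by blast
qed

end
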